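(* Let $\gamma\in(0,1)$ and $\frac1{2(1-\gamma)}<\alpha<2$. Let $W_\alpha(t)$, $t\in\mathbb R$, be a separable centered Gaussian random process with $W_\alpha(-t)=W_\alpha(t)$ and covariance function $$R(t,s)=\mathbf E W_\alpha(t)W_\alpha(s)=\tfrac12\left(|t|^\alpha+|s|^\alpha-\big||t|-|s|\big|^\alpha\right).$$ Let $\phi$ be an $f$-wavelet and $\psi$ the corresponding $m$-wavelet, both continuous, and suppose: (a) assumption $S(\gamma)$ holds for $\phi$ and $\psi$ with a function $\Phi$, and there is an even function $c:\mathbb R\to\mathbb R$, non-decreasing on $[0,\infty)$, with $c(0)>0$, such that for some function $A:(0,\infty)\to(0,\infty)$ and some $a_0,x_0\in(0,\infty)$ one has $c(ax)\le c(x)A(a)$ for all $a\ge a_0$, $x\ge x_0$, and such that $\int_{\mathbb R}c(x)\Phi(|x|)\,dx<\infty$ and $R(t,t)^{1/2}=|t|^{\alpha/2}\le c(t)$ for all $t\in\mathbb R$; (b) $\int_{\mathbb R}\ln^{\alpha}(1+|u|)\,|\widehat\psi(u)|\,du<\infty$ and $\int_{\mathbb R}\ln^{\alpha}(1+|u|)\,|\widehat\phi(u)|\,du<\infty$; (c) $\int_{\mathbb R}|u|^\alpha|\psi(u)|\,du<\infty$ and $\int_{\mathbb R}|u|^\alpha|\phi(u)|\,du<\infty$; (d) $\widehat\phi$ is twice differentiable, $\widehat\phi(z)\to0$ and $\widehat\phi'(z)\to0$ as $z\to\pm\infty$, and the integrals $\int_{\mathbb R}|\widehat\phi'(u)|\,du$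 and $\int_{\mathbb R}\ln^{\alpha}(1+|u|)\,|\widehat\phi^{(i)}(u)|\,du$, $i=0,1,2$, converge. Then the wavelet expansions $\mathbf X_{n,\mathbf k_n}(t)$ of $\mathbf X=W_\alpha$ converge uniformly in probability to $W_\alpha(t)$ on each interval $[0,T]$, $T>0$, i.e. for every $\varepsilon>0$ $$P\Big\{\sup_{0\le t\le T}|W_\alpha(t)-\mathbf X_{n,\mathbf k_n}(t)|>\varepsilon\Big\}\to0,$$ when $n\to\infty$, $k_0'\to\infty$ and $k_j\to\infty$ for all $j\in\mathbb N_0$.
   Context: Notation: $\mathbb N_0=\{0,1,2,\dots\}$; $\widehat f(y)=\int_{\mathbb R}e^{-iyx}f(x)\,dx$. $f$-wavelet and $m$-wavelet: $\phi\in L_2(\mathbb R)$ is an $f$-wavelet if $\widehat\phi(0)\ne0$, $\widehat\phi$ is continuous at $0$, $\sum_{k\in\mathbb Z}|\widehat\phi(y+2\pi k)|^2=1$ a.e., and there is a $2\pi$-periodic $m_0\in L_2([0,2\pi])$ with $\widehat\phi(y)=m_0(y/2)\widehat\phi(y/2)$ a.e. The corresponding $m$-wavelet $\psi$ is the inverse Fourier transform of $\widehat\psi(y)=\overline{m_0(y/2+\pi)}\,e^{-iy/2}\,\widehat\phi(y/2)$. Set $\phi_{jk}(x)=2^{j/2}\phi(2^jx-k)$, $\psi_{jk}(x)=2^{j/2}\psi(2^jx-k)$, $j,k\in\mathbb Z$. (Then $\{\phi_{0k},\psi_{jk}: j\in\mathbb N_0,k\in\mathbb Z\}$ is an orthonormal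 basis of $L_2(\mathbb R)$.) Assumption $S(\gamma)$, $\gamma>0$: there is a bounded non-increasing function $\Phi:[0,\infty)\to[0,\infty)$ with $|\phi(x)|\le\Phi(|x|)$ and $|\psi(x)|\le\Phi(|x|)$ for a.e. $x\in\mathbb R$ and $\int_{\mathbb R}\Phi(|x|)^{\gamma}\,dx<\infty$. Coefficients of a process $\mathbf X$ (integrals in the mean-square sense): $\xi_{0k}=\int_{\mathbb R}\mathbf X(t)\overline{\phi_{0k}(t)}\,dt$, $\eta_{jk}=\int_{\mathbb R}\mathbf X(t)\overline{\psi_{jk}(t)}\,dt$. Wavelet expansions (approximants): for $\mathbf k_n=(k_0',k_0,\dots,k_{n-1})$, $$\mathbf X_{n,\mathbf k_n}(t)=\sum_{|k|\le k_0'}\xi_{0k}\phi_{0k}(t)+\sum_{j=0}^{n-1}\sum_{|k|\le k_j}\eta_{jk}\psi_{jk}(t).$$ The limit "$n\to\infty$, $k_0'\to\infty$, $k_j\to\infty$ for all $j$" is along any sequence of choices of $(n,\mathbf k_n)$ for which $n\to\infty$, $k_0'\to\infty$, and for each fixed $j\in\mathbb N_0$ the entry $k_j$ tends to infinity. *)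

theory Defs
  imports "HOL-Probability.Probability"
begin

section \<open>Fourier transforms\<close>

text \<open>\<open>fourier f\<close> is the pointwise integral, which is meaningful for \<open>f\<close> in \<open>L\<^sub>1\<close>.
  \<open>L2_fourier f h\<close> says that \<open>h\<close> is a representative of the Fourier--Plancherel
  transform of \<open>f\<close> in \<open>L\<^sub>2\<close>, i.e. the \<open>L\<^sub>2\<close>-limit of the transforms of the truncations
  of \<open>f\<close> to \<open>[-N, N]\<close>. On the intersection of \<open>L\<^sub>1\<close> and \<open>L\<^sub>2\<close> the two agree almost everywhere.\<close>

definition fourier :: "(real \<Rightarrow> complex) \<Rightarrow> real \<Rightarrow> complex" where
  "fourier f y = (LINT x|lborel. exp (- (\<i> * of_real y * of_real x)) * f x)"

definition L2 :: "(real \<Rightarrow> complex) \<Rightarrow> bool" where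
  "L2 f \<longleftrightarrow> f \<in> borel_measurable borel \<and> integrable lborel (\<lambda>x. (cmod (f x))\<^sup>2)"

definition L2_fourier :: "(real \<Rightarrow> complex) \<Rightarrow> (real \<Rightarrow> complex) \<Rightarrow> bool" where
  "L2_fourier f h \<longleftrightarrow> L2 f \<and> L2 h \<and>
     ((\<lambda>N. \<integral>\<^sup>+ y. ennreal ((cmod (h y -
         (LINT x:{-N..N}|lborel. exp (- (\<i> * of_real y * of_real x)) * f x)))\<^sup>2) \<partial>lborel)
       \<longlongrightarrow> 0) at_top"

section \<open>Wavelets\<close>

definition refinement_mask :: "(real \<Rightarrow> complex) \<Rightarrow> (real \<Rightarrow> complex) \<Rightarrow> bool" where
  "refinement_mask \<phi> m0 \<longleftrightarrow>
     m0 \<in> borel_measurable borel \<and>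
     (\<forall>y. m0 (y + 2 * pi) = m0 y) \<and>
     set_integrable lborel {0..2 * pi} (\<lambda>y. (cmod (m0 y))\<^sup>2) \<and>
     (\<exists>h. L2_fourier \<phi> h \<and> (AE y in lborel. h y = m0 (y / 2) * h (y / 2)))"

text \<open>The transform of a function in \<open>L\<^sub>2\<close> is only determined up to null sets; the conditions at
  the point \<open>0\<close> refer to a representative that is continuous there (its value at \<open>0\<close> is then
  unique).\<close>

definition f_wavelet :: "(real \<Rightarrow> complex) \<Rightarrow> bool" where
  "f_wavelet \<phi> \<longleftrightarrow>
     L2 \<phi> \<and>
     (\<exists>h. L2_fourier \<phi> h \<and> h 0 \<noteq> 0 \<and> isCont h 0 \<and>
        (AE y in lborel. ((\<lambda>k::int. (cmod (h (y + 2 * pi * of_int k)))\<^sup>2) has_sum 1) UNIV)) \<and>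
     (\<exists>m0. refinement_mask \<phi> m0)"

text \<open>For an f-wavelet the mask \<open>m0\<close> is unique up to a null set, since for almost every \<open>y\<close> the
  transform does not vanish at some \<open>y + 2 \<pi> k\<close>. So the existential quantifier over \<open>m0\<close>
  involves no choice.\<close>

definition m_wavelet :: "(real \<Rightarrow> complex) \<Rightarrow> (real \<Rightarrow> complex) \<Rightarrow> bool" where
  "m_wavelet \<phi> \<psi> \<longleftrightarrow>
     (\<exists>m0 h g. refinement_mask \<phi> m0 \<and> L2_fourier \<phi> h \<and> L2_fourier \<psi> g \<and>
        (AE y in lborel.
           g y = cnj (m0 (y / 2 + pi)) * exp (- (\<i> * of_real y / 2)) * h (y / 2)))"

definition dilate :: "(real \<Rightarrow> complex) \<Rightarrow> int \<Rightarrow> int \<Rightarrow> real \<Rightarrow> complex" where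
  "dilate f j k x = of_real (2 powr (of_int j / 2)) * f (2 powr of_int j * x - of_int k)"

definition assumption_S ::
  "real \<Rightarrow> (real \<Rightarrow> real) \<Rightarrow> (real \<Rightarrow> complex) \<Rightarrow> (real \<Rightarrow> complex) \<Rightarrow> bool" where
  "assumption_S \<gamma> \<Phi> \<phi> \<psi> \<longleftrightarrow>
     (\<forall>x\<ge>0. 0 \<le> \<Phi> x) \<and> bounded (\<Phi> ` {0..}) \<and> antimono_on {0..} \<Phi> \<and>
     (AE x in lborel. cmod (\<phi> x) \<le> \<Phi> \<bar>x\<bar>) \<and>
     (AE x in lborel. cmod (\<psi> x) \<le> \<Phi> \<bar>x\<bar>) \<and>
     integrable lborel (\<lambda>x. \<Phi> \<bar>x\<bar> powr \<gamma>)"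

section \<open>Random processes\<close>

text \<open>Gaussian random variables may be degenerate (constant almost surely).\<close>

definition gaussian_rv :: "'a measure \<Rightarrow> ('a \<Rightarrow> real) \<Rightarrow> bool" where
  "gaussian_rv M X \<longleftrightarrow> X \<in> borel_measurable M \<and>
     (\<exists>\<mu> \<sigma>. (0 < \<sigma> \<and> distributed M lborel X (\<lambda>x. ennreal (normal_density \<mu> \<sigma> x))) \<or>
            (AE \<omega> in M. X \<omega> = \<mu>))"

definition gaussian_process :: "'a measure \<Rightarrow> (real \<Rightarrow> 'a \<Rightarrow> real) \<Rightarrow> bool" where
  "gaussian_process M X \<longleftrightarrow>
     (\<forall>I a. finite I \<longrightarrow> gaussian_rv M (\<lambda>\<omega>. \<Sum>t\<in>I. a t * X t \<omega>))"

definition centered_process :: "'a measure \<Rightarrow> (real \<Rightarrow> 'a \<Rightarrow> real) \<Rightarrow> bool" where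
  "centered_process M X \<longleftrightarrow> (\<forall>t. integrable M (X t) \<and> (LINT \<omega>|M. X t \<omega>) = 0)"

text \<open>Separability in the sense of Doob, relative to the closed sets.\<close>

definition separable_process :: "'a measure \<Rightarrow> (real \<Rightarrow> 'a \<Rightarrow> real) \<Rightarrow> bool" where
  "separable_process M X \<longleftrightarrow>
     (\<exists>S N. countable S \<and> closure S = UNIV \<and> N \<in> null_sets M \<and>
        (\<forall>\<omega>\<in>space M - N. \<forall>G F. open G \<longrightarrow> closed F \<longrightarrow>
           (\<forall>s\<in>G \<inter> S. X s \<omega> \<in> F) \<longrightarrow> (\<forall>t\<in>G. X t \<omega> \<in> F)))"

text \<open>Mean-square integrals: on \<open>[a, b]\<close> the mean-square limit of the Riemann sums as the mesh
  tends to \<open>0\<close> (the gauge is constant), and on the real line the mean-square limit of the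
  integrals over \<open>[a, b]\<close> as \<open>a\<close> tends to minus and \<open>b\<close> to plus infinity. The integral is
  determined up to almost sure equality; \<open>ms_integral\<close> selects a version.\<close>

definition ms_dist :: "'a measure \<Rightarrow> ('a \<Rightarrow> complex) \<Rightarrow> ('a \<Rightarrow> complex) \<Rightarrow> ennreal" where
  "ms_dist M Y Z = (\<integral>\<^sup>+ \<omega>. ennreal ((cmod (Y \<omega> - Z \<omega>))\<^sup>2) \<partial>M)"

definition has_ms_integral_on ::
  "'a measure \<Rightarrow> (real \<Rightarrow> 'a \<Rightarrow> complex) \<Rightarrow> real \<Rightarrow> real \<Rightarrow> ('a \<Rightarrow> complex) \<Rightarrow> bool" where
  "has_ms_integral_on M Z a b Y \<longleftrightarrow> Y \<in> borel_measurable M \<and>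
     (\<forall>\<epsilon>>0. \<exists>\<delta>>0. \<forall>p. p tagged_division_of {a..b} \<longrightarrow> (\<lambda>x. ball x \<delta>) fine p \<longrightarrow>
        ms_dist M (\<lambda>\<omega>. \<Sum>(x, K)\<in>p. measure lborel K *\<^sub>R Z x \<omega>) Y < ennreal \<epsilon>)"

definition has_ms_integral ::
  "'a measure \<Rightarrow> (real \<Rightarrow> 'a \<Rightarrow> complex) \<Rightarrow> ('a \<Rightarrow> complex) \<Rightarrow> bool" where
  "has_ms_integral M Z Y \<longleftrightarrow> Y \<in> borel_measurable M \<and>
     (\<exists>J. (\<forall>a b. a \<le> b \<longrightarrow> has_ms_integral_on M Z a b (J a b)) \<and>
          ((\<lambda>(a, b). ms_dist M (J a b) Y) \<longlongrightarrow> 0) (at_bot \<times>\<^sub>F at_top))"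

definition ms_integral :: "'a measure \<Rightarrow> (real \<Rightarrow> 'a \<Rightarrow> complex) \<Rightarrow> 'a \<Rightarrow> complex" where
  "ms_integral M Z = (SOME Y. has_ms_integral M Z Y)"

definition wavelet_coeff ::
  "'a measure \<Rightarrow> (real \<Rightarrow> 'a \<Rightarrow> real) \<Rightarrow> (real \<Rightarrow> complex) \<Rightarrow> int \<Rightarrow> int \<Rightarrow> 'a \<Rightarrow> complex" where
  "wavelet_coeff M X f j k = ms_integral M (\<lambda>t \<omega>. of_real (X t \<omega>) * cnj (dilate f j k t))"

definition wavelet_expansion ::
  "'a measure \<Rightarrow> (real \<Rightarrow> 'a \<Rightarrow> real) \<Rightarrow> (real \<Rightarrow> complex) \<Rightarrow> (real \<Rightarrow> complex) \<Rightarrow>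
   nat \<Rightarrow> nat \<Rightarrow> (nat \<Rightarrow> nat) \<Rightarrow> real \<Rightarrow> 'a \<Rightarrow> complex" where
  "wavelet_expansion M X \<phi> \<psi> n k0' k t \<omega> =
     (\<Sum>l\<in>{- int k0'..int k0'}. wavelet_coeff M X \<phi> 0 l \<omega> * dilate \<phi> 0 l t) +
     (\<Sum>j<n. \<Sum>l\<in>{- int (k j)..int (k j)}.
        wavelet_coeff M X \<psi> (int j) l \<omega> * dilate \<psi> (int j) l t)"

definition W_cov :: "real \<Rightarrow> real \<Rightarrow> real \<Rightarrow> real" where
  "W_cov \<alpha> t s = (\<bar>t\<bar> powr \<alpha> + \<bar>s\<bar> powr \<alpha> - \<bar>\<bar>t\<bar> - \<bar>s\<bar>\<bar> powr \<alpha>) / 2"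

text \<open>The probability that the supremum of \<open>|Y t - X t|\<close> over \<open>[0, T]\<close> exceeds \<open>\<epsilon>\<close>. The supremum
  is taken in the extended reals. For a separable \<open>X\<close> and a sample-continuous \<open>Y\<close> the event differs
  from a measurable set by a subset of a null set only, hence the probability is that of the
  completion.\<close>

definition prob_sup_dist_gt ::
  "'a measure \<Rightarrow> (real \<Rightarrow> 'a \<Rightarrow> real) \<Rightarrow> (real \<Rightarrow> 'a \<Rightarrow> complex) \<Rightarrow> real \<Rightarrow> real \<Rightarrow> real" where
  "prob_sup_dist_gt M X Y T \<epsilon> =
     measure (completion M)
       {\<omega> \<in> space M. (SUP t\<in>{0..T}. ereal (cmod (of_real (X t \<omega>) - Y t \<omega>))) > ereal \<epsilon>}"

end

theory Submission
  imports Defs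
begin

text \<open>
  Write \<open>\<beta> = \<alpha> / 2\<close> and \<open>f\<^sub>a u = E (W u a)\<close> for a square integrable variable \<open>a\<close>. The covariance
  gives \<open>E |W u - W v|\<^sup>2 = ||u| - |v||\<^sup>\<alpha>\<close>, so \<open>f\<^sub>a\<close> is even and Hoelder of order \<open>\<beta>\<close> with constant \<open>\<parallel>a\<parallel>\<close>,
  and \<open>E (\<xi> a)\<close> is the ordinary wavelet coefficient of \<open>f\<^sub>a\<close> for every mean-square coefficient \<open>\<xi>\<close> of
  \<open>W\<close>. By duality in \<open>L\<^sub>2\<close>, every mean-square statement about the expansion reduces to a deterministic
  one about Hoelder functions, uniform in the constant.

  Deterministic part: the relations between the mask and the transforms of \<open>\<phi>\<close> and \<open>\<psi>\<close> say, on the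
  level of Fourier coefficients, that the projections onto the translates of \<open>\<phi>\<close> and of \<open>\<psi>\<close> add up to
  the projection onto the next level when applied to an exponential. Approximation of an even function
  by cosine polynomials extends this to the functions \<open>f\<^sub>a\<close>, and the projection at level \<open>n\<close>
  reproduces constants, so it differs from \<open>f\<^sub>a\<close> by \<open>O (2 powr (- n \<beta>))\<close>.

  Pathwise part: since \<open>\<psi>\<close> has integral \<open>0\<close>, the coefficients satisfy \<open>\<parallel>\<eta>\<^sub>j\<^sub>k\<parallel> \<le> C 2 powr (- j (1/2 + \<beta>))\<close>; being
  Gaussian, they have comparable moments of order \<open>16\<close>, and therefore almost surely
  \<open>|\<eta>\<^sub>j\<^sub>k| \<le> B (1 + |k|) powr (\<beta>/2) 2 powr (- j (1/2 + 3\<beta>/4))\<close>. This makes all expansions converge uniformly on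
  compact sets, for almost every path, to a limit which the first part identifies with \<open>W\<close> at each
  point; separability passes from a countable dense set to the supremum.
\<close>

subsection \<open>Trigonometric approximation of even functions\<close>

text \<open>The functions \<open>f\<^sub>a\<close> grow like \<open>|u| powr \<beta>\<close>, so
  neither periodic approximation nor \<open>L\<^sub>2\<close> theory reaches them directly. Evenness
  overcomes this: the fold \<open>u -> m / pi * arccos (cos (pi / m * u))\<close> agrees with
  \<open>|u|\<close> on \<open>[-m, m]\<close> and never increases \<open>|u|\<close>. Cosine
  polynomials close to the folded function converge pointwise to \<open>f\<^sub>a\<close> under one
  fixed growth bound, and dominated convergence carries identities from exponentials over to
  \<open>f\<^sub>a\<close>. Constants are reproduced because the transform of \<open>\<phi>\<close>
  has modulus 1 at 0; the proof of this rests on the integrability of its derivative. The pathwise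
  exponents share out \<open>\<beta>\<close>, the mean-square decay rate beyond
  \<open>2 powr (- j / 2)\<close>: a quarter pays for summing moments over \<open>j\<close>, a half
  for the weight \<open>(1 + |k|) powr (\<beta> / 2)\<close> at \<open>k\<close> near
  \<open>2 ^ j * t\<close>, and the last quarter makes the levels summable. Order 16 serves the sum
  over \<open>k\<close>: \<open>16 * \<beta> / 2 > 2\<close> because
  \<open>\<beta> > 1/4\<close>.\<close>

lemma AE_lborel_dense:
  fixes x e :: real
  assumes "AE y in lborel. P y" "e > 0"
  obtains y where "x < y" "y < x + e" "P y"
proof -
  obtain N where N: "{y. \<not> P y} \<subseteq> N" "emeasure lborel N = 0" "N \<in> sets lborel"
    using AE_E[OF assms(1)] by auto
  have "\<not> {x<..<x+e} \<subseteq> N"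
  proof
    assume "{x<..<x+e} \<subseteq> N"
    then have "emeasure lborel {x<..<x+e} \<le> emeasure lborel N"
      using N by (intro emeasure_mono) auto
    then show False using N assms(2) by simp
  qed
  then obtain y where "y \<in> {x<..<x+e}" "y \<notin> N" by blast
  then show thesis using N by (intro that[of y]) auto
qed

lemma inverse_Suc_tendsto: "(\<lambda>n. 1 / real (Suc n)) \<longlonglongrightarrow> 0"
  using LIMSEQ_inverse_real_of_nat by (simp add: inverse_eq_divide)

lemma AE_lborel_sequence:
  fixes x :: real
  assumes "AE y in lborel. P y"
  obtains y where "\<And>n. x < y n" "\<And>n. y n < x + 1 / real (Suc n)" "\<And>n. P (y n)" "y \<longlonglongrightarrow> x"
proof -
  have "\<exists>y. x < y \<and> y < x + 1 / real (Suc n) \<and> P y" for n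
    by (rule AE_lborel_dense[OF assms(1), of "1 / real (Suc n)" x]) auto
  then obtain y where y: "\<And>n. x < y n" "\<And>n. y n < x + 1 / real (Suc n)" "\<And>n. P (y n)"
    by metis
  have "y \<longlonglongrightarrow> x"
  proof (rule real_tendsto_sandwich[where f = "\<lambda>_. x" and h = "\<lambda>n. x + 1 / real (Suc n)"])
    show "(\<lambda>n. x + 1 / real (Suc n)) \<longlonglongrightarrow> x"
      using tendsto_add[OF tendsto_const inverse_Suc_tendsto, of x] by simp
  qed (use y in \<open>auto intro!: eventuallyI less_imp_le\<close>)
  with y show thesis by (rule that)
qed

lemma AE_lborel_eq_isCont:
  fixes f g :: "real \<Rightarrow> 'b :: metric_space"
  assumes "AE y in lborel. f y = g y" "isCont f x" "isCont g x"
  shows "f x = g x"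
proof -
  obtain y where y: "\<And>n. f (y n) = g (y n)" "y \<longlonglongrightarrow> x"
    by (rule AE_lborel_sequence[OF assms(1), of x]) blast
  have "(\<lambda>n. f (y n)) \<longlonglongrightarrow> f x" "(\<lambda>n. g (y n)) \<longlonglongrightarrow> g x"
    using isCont_tendsto_compose[OF assms(2) y(2)] isCont_tendsto_compose[OF assms(3) y(2)] by simp_all
  then show ?thesis by (simp add: y(1) LIMSEQ_unique)
qed

lemma AE_lborel_eq_continuous:
  fixes f g :: "real \<Rightarrow> 'b :: metric_space"
  assumes "AE y in lborel. f y = g y" "continuous_on UNIV f" "continuous_on UNIV g"
  shows "f x = g x"
  by (rule AE_lborel_eq_isCont[OF assms(1)]) (use assms in \<open>auto simp: continuous_on_eq_continuous_at\<close>)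

text \<open>The set where \<open>P\<close> fails need not be measurable, so the substitution is made
  in a null set that contains it.\<close>

lemma AE_lborel_affine:
  fixes P :: "real \<Rightarrow> bool"
  assumes "AE x in lborel. P x" "c \<noteq> 0"
  shows "AE x in lborel. P (t + c * x)"
proof -
  obtain N where N: "\<And>y. y \<notin> N \<Longrightarrow> P y" "N \<in> null_sets lborel"
    by (rule AE_E3[OF assms(1)]) auto
  have "AE x in lborel. x \<notin> N" using N(2) by (rule AE_not_in)
  moreover have "{x. x \<notin> N} \<in> sets borel"
    using N(2) borel_comp[of N] by (simp add: null_sets_def Compl_eq)
  ultimately have "AE x in lborel. t + c * x \<notin> N"
    using AE_borel_affine[of c "\<lambda>x. x \<notin> N" t] assms(2) N(2) by (simp add: null_sets_def pred_def)
  then show ?thesis by eventually_elim (use N(1) in auto)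
qed

text \<open>The map \<open>x -> arccos (cos x)\<close> folds the line onto \<open>[0, pi]\<close>.
  The last bound says that folding moves no point away from the origin, which keeps growth bounds
  valid for folded functions.\<close>

lemma arccos_cos_bounds: "0 \<le> arccos (cos x)" "arccos (cos x) \<le> pi" "arccos (cos x) \<le> \<bar>x\<bar>"
proof -
  show "0 \<le> arccos (cos x)" "arccos (cos x) \<le> pi"
    by (simp_all add: arccos_lbound arccos_ubound)
  then show "arccos (cos x) \<le> \<bar>x\<bar>"
    using arccos_cos[of "\<bar>x\<bar>"] by (cases "\<bar>x\<bar> \<le> pi") auto
qed

text \<open>The folded function is a continuous function of \<open>y = cos (pi / m * u)\<close> on
  \<open>[-1, 1]\<close>, so the Weierstrass theorem in the variable \<open>y\<close> gives an
  approximation that is uniform on the whole line.\<close>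

lemma even_approx_cos_poly:
  fixes f :: "real \<Rightarrow> real"
  assumes cont: "continuous_on UNIV f" and m: "0 < m" and e: "0 < e"
  obtains a n where
    "\<And>u. \<bar>f (m / pi * arccos (cos (pi / m * u))) - (\<Sum>i\<le>n. a i * cos (pi / m * u) ^ i)\<bar> < e"
proof -
  have "continuous_on {-1..1} (\<lambda>y. f (m / pi * arccos y))"
    by (rule continuous_on_compose2[OF cont]) (auto intro!: continuous_intros)
  then obtain g where g: "real_polynomial_function g"
      "\<And>y. y \<in> {-1..1} \<Longrightarrow> \<bar>f (m / pi * arccos y) - g y\<bar> < e"
    using Stone_Weierstrass_real_polynomial_function[of "{-1..1::real}" "\<lambda>y. f (m / pi * arccos y)" e] e
    by auto
  obtain a n where an: "g = (\<lambda>x. \<Sum>i\<le>n. a i * x ^ i)"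
    using g(1) real_polynomial_function_iff_sum by blast
  show thesis
    by (rule that[where a = a and n = n]) (use g(2) an in auto)
qed

text \<open>The class on which functionals are required to be linear: it is closed under the
  operations of the cosine recursion, and its members can be integrated against all the kernels that
  occur.\<close>

definition bdd_fun :: "(real \<Rightarrow> complex) \<Rightarrow> bool" where
  "bdd_fun f \<longleftrightarrow> f \<in> borel_measurable borel \<and> bounded (range f)"

lemma bdd_fun_simps:
  "bdd_fun (\<lambda>u. cis (a * u))"
  "bdd_fun f \<Longrightarrow> bdd_fun g \<Longrightarrow> bdd_fun (\<lambda>u. f u * g u)"
  "bdd_fun f \<Longrightarrow> bdd_fun g \<Longrightarrow> bdd_fun (\<lambda>u. f u + g u)"
  "bdd_fun (\<lambda>u. c)"
  "bdd_fun (\<lambda>u. of_real (cos (a * u)))"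
proof -
  show "bdd_fun (\<lambda>u. cis (a * u))" for a
    unfolding bdd_fun_def cis_conv_exp by (auto intro!: boundedI[where B = 1])
  show "bdd_fun (\<lambda>u. of_real (cos (a * u)))"
    unfolding bdd_fun_def by (auto intro!: boundedI[where B = 1])
  show "bdd_fun (\<lambda>u. c)" by (auto simp: bdd_fun_def)
  assume f: "bdd_fun f" and g: "bdd_fun g"
  then obtain A B where AB: "\<And>u. norm (f u) \<le> A" "\<And>u. norm (g u) \<le> B"
    by (auto simp: bdd_fun_def bounded_iff)
  have A: "0 \<le> A" using AB(1)[of 0] norm_ge_zero order_trans by blast
  show "bdd_fun (\<lambda>u. f u * g u)"
    using f g AB A unfolding bdd_fun_def
    by (auto intro!: boundedI[where B = "A * B"] mult_mono simp: norm_mult)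
  show "bdd_fun (\<lambda>u. f u + g u)"
    using f g AB unfolding bdd_fun_def
    by (auto intro!: boundedI[where B = "A + B"] norm_triangle_mono)
qed

lemma bdd_fun_power: "bdd_fun f \<Longrightarrow> bdd_fun (\<lambda>u. f u ^ k)"
  by (induction k) (auto intro: bdd_fun_simps)

lemma bdd_fun_sum: "(\<And>i. i \<in> I \<Longrightarrow> bdd_fun (f i)) \<Longrightarrow> bdd_fun (\<lambda>u. \<Sum>i\<in>I. f i u)"
  by (induction I rule: infinite_finite_induct) (simp_all add: bdd_fun_simps(3,4))

text \<open>The recursion \<open>2 cos (\<theta> u) e\<^sub>l = e\<^sub>l\<^sub>+\<^sub>1 + e\<^sub>l\<^sub>-\<^sub>1\<close> avoids expanding
  powers of the cosine into exponentials.\<close>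

lemma linear_vanish_cos_poly:
  fixes L :: "(real \<Rightarrow> complex) \<Rightarrow> complex"
  assumes add: "\<And>f g. bdd_fun f \<Longrightarrow> bdd_fun g \<Longrightarrow> L (\<lambda>u. f u + g u) = L f + L g"
    and scale: "\<And>c f. bdd_fun f \<Longrightarrow> L (\<lambda>u. c * f u) = c * L f"
    and zero: "\<And>l::int. L (\<lambda>u. cis (\<theta> * of_int l * u)) = 0"
  shows "L (\<lambda>u. of_real (\<Sum>i\<le>n. a i * cos (\<theta> * u) ^ i)) = 0"
proof -
  \<comment> \<open>The claim is made for all frequencies \<open>l\<close> at once, since one more
    factor of the cosine moves \<open>l\<close> to \<open>l + 1\<close> and
    \<open>l - 1\<close>.\<close>
  have pow: "L (\<lambda>u. of_real (cos (\<theta> * u)) ^ k * cis (\<theta> * of_int l * u)) = 0" for k and l :: int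
  proof (induction k arbitrary: l)
    case 0
    then show ?case using zero by simp
  next
    case (Suc k)
    let ?c = "\<lambda>u. complex_of_real (cos (\<theta> * u)) ^ k"
    have eq: "of_real (cos (\<theta> * u)) ^ Suc k * cis (\<theta> * of_int l * u) =
        (1/2) * (?c u * cis (\<theta> * of_int (l + 1) * u) + ?c u * cis (\<theta> * of_int (l - 1) * u))" for u
    proof -
      have "cis (\<theta> * of_int (l + 1) * u) + cis (\<theta> * of_int (l - 1) * u) =
          2 * of_real (cos (\<theta> * u)) * cis (\<theta> * of_int l * u)"
        by (auto simp: complex_eq_iff ring_distribs cos_add cos_diff sin_add sin_diff)
      then show ?thesis by (simp add: distrib_left[symmetric])
    qed
    have "bdd_fun (\<lambda>u. ?c u * cis (\<theta> * of_int l' * u))" for l' :: int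
      by (intro bdd_fun_simps bdd_fun_power)
    then show ?case
      unfolding eq
      by (subst scale, intro bdd_fun_simps bdd_fun_power, subst add) (simp_all only: Suc, simp)
  qed
  have "L (\<lambda>u. \<Sum>i\<le>n. of_real (a i) * of_real (cos (\<theta> * u)) ^ i) = 0"
  proof (induction n)
    case 0
    then show ?case using scale[of "\<lambda>_. 1" "of_real (a 0)"] pow[of 0 0] by (simp add: bdd_fun_simps)
  next
    case (Suc n)
    have b: "bdd_fun (\<lambda>u. complex_of_real (cos (\<theta> * u)) ^ k)" for k
      by (intro bdd_fun_simps bdd_fun_power)
    have "L (\<lambda>u. (\<Sum>i\<le>n. of_real (a i) * of_real (cos (\<theta> * u)) ^ i)
        + of_real (a (Suc n)) * of_real (cos (\<theta> * u)) ^ Suc n) = 0"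
      using pow[of "Suc n" 0] Suc b[of "Suc n"]
      by (subst add) (auto intro!: bdd_fun_sum bdd_fun_simps bdd_fun_power simp: scale simp del: power_Suc)
    then show ?case by simp
  qed
  then show ?thesis by simp
qed

lemma set_integrable_compact_continuous:
  fixes f :: "real \<Rightarrow> 'b::{banach, second_countable_topology}"
  shows "compact S \<Longrightarrow> continuous_on S f \<Longrightarrow> set_integrable lborel S f"
  unfolding set_integrable_def by (rule borel_integrable_compact)

lemma set_integral_reflect:
  fixes f :: "real \<Rightarrow> complex"
  shows "(LINT v:{-a..a}|lborel. f (- v)) = (LINT v:{-a..a}|lborel. f v)"
proof -
  have "indicator {-a..a} (- v) = (indicator {-a..a} v :: real)" for v
    by (auto simp: indicator_def)
  then show ?thesis
    unfolding set_lebesgue_integral_def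
    using lborel_integral_real_affine[of "-1" "\<lambda>v. indicator {-a..a} v *\<^sub>R f v" 0] by simp
qed

text \<open>The point \<open>x\<close> is made the centre: the even part
  \<open>E v = q (x + v) + q (x - v)\<close> can be handled by cosine polynomials on
  \<open>[-1/2, 1/2]\<close>, since an even function has equal values at both ends even if
  \<open>q\<close> is not periodic. Being orthogonal to its own real and imaginary parts,
  \<open>E\<close> vanishes, and \<open>E 0 = 2 * q x\<close>.\<close>

lemma fourier_coeff_unique:
  fixes q :: "real \<Rightarrow> complex"
  assumes cont: "continuous_on UNIV q"
    and z: "\<And>x (l::int). (LINT v:{-1/2..1/2}|lborel. q (x + v) * cis (2 * pi * of_int l * v)) = 0"
  shows "q x = 0"
proof -
  let ?I = "{-1/2..1/2::real}"
  define Q where "Q v = q (x + v)" for v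
  define E where "E v = Q v + Q (- v)" for v
  have cQ: "continuous_on UNIV Q"
    unfolding Q_def by (rule continuous_on_compose2[OF cont]) (auto intro!: continuous_intros)
  have cE: "continuous_on UNIV E"
    unfolding E_def
    by (intro continuous_on_add cQ continuous_on_compose2[OF cQ]) (auto intro!: continuous_intros)
  have mQ: "Q \<in> borel_measurable borel" using cQ by (rule borel_measurable_continuous_onI)
  have si: "set_integrable lborel ?I (\<lambda>v. Q v * f v)" if bf: "bdd_fun f" for f
  proof -
    have mf: "f \<in> borel_measurable borel" using bf by (simp add: bdd_fun_def)
    obtain B where B: "\<And>u. norm (f u) \<le> B"
      using bf by (auto simp: bdd_fun_def bounded_iff)
    have "set_integrable lborel ?I (\<lambda>v. norm (Q v) * B)"
      by (rule set_integrable_compact_continuous) (auto intro!: continuous_intros continuous_on_subset[OF cQ])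
    then show ?thesis
      unfolding set_integrable_def
      by (rule Bochner_Integration.integrable_bound)
         (use mQ mf B in \<open>auto simp: indicator_def norm_mult intro!: AE_I2 mult_left_mono order_trans[OF _ abs_ge_self]\<close>)
  qed
  define L where "L f = (LINT v:?I|lborel. Q v * f v)" for f
  have poly0: "L (\<lambda>u. of_real (\<Sum>i\<le>n. a i * cos (2 * pi * u) ^ i)) = 0" for a n
  proof (rule linear_vanish_cos_poly)
    fix f g assume "bdd_fun f" "bdd_fun g"
    then show "L (\<lambda>u. f u + g u) = L f + L g"
      unfolding L_def distrib_left by (intro set_integral_add si)
  next
    fix c f assume "bdd_fun f"
    show "L (\<lambda>u. c * f u) = c * L f"
      unfolding L_def by (subst set_integral_mult_right[symmetric]) (simp add: mult_ac)
  next
    fix l :: int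
    show "L (\<lambda>u. cis (2 * pi * of_int l * u)) = 0"
      unfolding L_def Q_def by (rule z)
  qed
  define K where "K = (LINT v:?I|lborel. norm (Q v))"
  have even0: "L (\<lambda>u. of_real (f u)) = 0" if cf: "continuous_on UNIV f" and ev: "\<And>u. f (- u) = f u" for f
  proof -
    have "norm (L (\<lambda>u. of_real (f u))) \<le> e * K" if e: "e > 0" for e
    proof -
      obtain a n where an: "\<And>u. \<bar>f ((1/2) / pi * arccos (cos (pi / (1/2) * u))) -
           (\<Sum>i\<le>n. a i * cos (pi / (1/2) * u) ^ i)\<bar> < e"
        using even_approx_cos_poly[OF cf, of "1/2" e] e by auto
      define p where "p u = (\<Sum>i\<le>n. a i * cos (2 * pi * u) ^ i)" for u
      have "\<bar>f u - p u\<bar> \<le> e" if "u \<in> ?I" for u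
      proof -
        have "arccos (cos (2 * pi * u)) = 2 * pi * \<bar>u\<bar>"
        proof -
          have "2 * pi * \<bar>u\<bar> \<le> pi" using that by (auto simp: abs_if)
          moreover have "cos (2 * pi * u) = cos (2 * pi * \<bar>u\<bar>)" by (cases "u \<ge> 0") auto
          ultimately show ?thesis by (simp add: arccos_cos)
        qed
        then have "(1/2) / pi * arccos (cos (pi / (1/2) * u)) = \<bar>u\<bar>" by (simp add: mult_ac)
        moreover have "f \<bar>u\<bar> = f u" using ev by (simp add: abs_if)
        ultimately show ?thesis using an[of u] by (simp add: p_def mult_ac)
      qed note fp = this
      have cp: "continuous_on UNIV p" unfolding p_def by (intro continuous_intros)
      have sif: "set_integrable lborel ?I (\<lambda>v. Q v * of_real (h v))" if "continuous_on UNIV h" for h :: "real \<Rightarrow> real"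
        by (rule set_integrable_compact_continuous)
           (auto intro!: continuous_intros continuous_on_subset[OF cQ] continuous_on_subset[OF that])
      have "L (\<lambda>u. of_real (f u)) = L (\<lambda>u. of_real (f u)) - L (\<lambda>u. of_real (p u))"
        using poly0[of a n] by (simp add: p_def)
      also have "\<dots> = (LINT v:?I|lborel. Q v * of_real (f v - p v))"
        unfolding L_def
        by (subst set_integral_diff(2)[OF sif[OF cf] sif[OF cp], symmetric]) (simp add: algebra_simps)
      also have "norm \<dots> \<le> (LINT v:?I|lborel. e * norm (Q v))"
        unfolding set_lebesgue_integral_def
      proof (rule Bochner_Integration.integral_norm_bound_integral)
        have "set_integrable lborel ?I (\<lambda>v. Q v * of_real (f v - p v))"
          by (intro sif continuous_intros cf cp)
        then show "integrable lborel (\<lambda>x. indicat_real ?I x *\<^sub>R (Q x * complex_of_real (f x - p x)))"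
          by (simp add: set_integrable_def)
        have "set_integrable lborel ?I (\<lambda>v. e * norm (Q v))"
          by (rule set_integrable_compact_continuous) (auto intro!: continuous_intros continuous_on_subset[OF cQ])
        then show "integrable lborel (\<lambda>x. indicat_real ?I x *\<^sub>R (e * norm (Q x)))"
          by (simp add: set_integrable_def)
        show "norm (indicat_real ?I v *\<^sub>R (Q v * complex_of_real (f v - p v)))
            \<le> indicat_real ?I v *\<^sub>R (e * norm (Q v))" for v
          using fp[of v] by (auto simp: indicator_def norm_mult mult.commute[of e] simp del: of_real_diff intro!: mult_left_mono)
      qed
      also have "\<dots> = e * K" unfolding K_def by simp
      finally show ?thesis .
    qed note le = this
    have K0: "K \<ge> 0" unfolding K_def set_lebesgue_integral_def by (intro integral_nonneg_AE) auto
    have "norm (L (\<lambda>u. of_real (f u))) \<le> 0 + e" if "e > 0" for e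
    proof -
      have "norm (L (\<lambda>u. of_real (f u))) \<le> e / (K + 1) * K"
        using le[of "e / (K+1)"] K0 that by simp
      also have "\<dots> \<le> e" using K0 that by (simp add: field_simps)
      finally show ?thesis by simp
    qed
    then have "norm (L (\<lambda>u. of_real (f u))) \<le> 0" by (rule field_le_epsilon)
    then show ?thesis by simp
  qed
  \<comment> \<open>Used with \<open>f\<close> the real and then the imaginary part of
    \<open>E\<close>; premise \<open>s\<close> says that for these two the orthogonality to
    \<open>E\<close> is a vanishing integral of the square.\<close>
  have zero: "f 0 = 0" if cf: "continuous_on UNIV f" and ev: "\<And>u. f (- u) = f u"
      and s: "(LINT v:?I|lborel. E v * of_real (f v)) = 0 \<Longrightarrow> 
        (LINT v:?I|lborel. (f v)\<^sup>2) = 0" for f :: "real \<Rightarrow> real"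
  proof -
    have sif: "set_integrable lborel ?I (\<lambda>v. H v * of_real (f v))" if "continuous_on UNIV H" for H :: "real \<Rightarrow> complex"
      by (rule set_integrable_compact_continuous)
         (auto intro!: continuous_intros continuous_on_subset[OF cf] continuous_on_subset[OF that])
    have cQm: "continuous_on UNIV (\<lambda>v. Q (- v))"
      by (rule continuous_on_compose2[OF cQ]) (auto intro!: continuous_intros)
    have "(LINT v:?I|lborel. E v * of_real (f v)) =
        (LINT v:?I|lborel. Q v * of_real (f v)) + (LINT v:?I|lborel. Q (- v) * of_real (f v))"
      unfolding E_def distrib_right by (intro set_integral_add sif cQ cQm)
    also have "(LINT v:?I|lborel. Q (- v) * of_real (f v)) = (LINT v:?I|lborel. Q v * of_real (f v))"
      using set_integral_reflect[of "1/2" "\<lambda>v. Q v * of_real (f v)"] by (simp add: ev)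
    finally have "(LINT v:?I|lborel. E v * of_real (f v)) = 0"
      using even0[OF cf ev] by (simp add: L_def)
    then have i0: "(LINT v:?I|lborel. (f v)\<^sup>2) = 0" by (rule s)
    have "set_integrable lborel ?I (\<lambda>v. (f v)\<^sup>2)"
      by (rule set_integrable_compact_continuous) (auto intro!: continuous_intros continuous_on_subset[OF cf])
    then have "AE v in lborel. indicator ?I v *\<^sub>R (f v)\<^sup>2 = 0"
      using i0 unfolding set_lebesgue_integral_def set_integrable_def
      by (subst (asm) integral_nonneg_eq_0_iff_AE) auto
    then have ae: "AE v in lborel. v \<in> ?I \<longrightarrow> f v = 0" by eventually_elim (auto simp: indicator_def)
    show "f 0 = 0"
    proof (rule ccontr)
      assume "f 0 \<noteq> 0"
      then have "\<exists>e>0. \<forall>y. dist 0 y < e \<longrightarrow> f y \<noteq> 0"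
        using cf by (intro continuous_on_open_avoid[of UNIV f 0 0]) auto
      then obtain e where e: "e > 0" "\<And>y. \<bar>y\<bar> < e \<Longrightarrow> f y \<noteq> 0" by auto
      obtain y where "0 < y" "y < 0 + min e (1/2)" "y \<in> ?I \<longrightarrow> f y = 0"
        by (rule AE_lborel_dense[OF ae, of "min e (1/2)" 0]) (use e in auto)
      then show False using e(2)[of y] by auto
    qed
  qed
  have sE: "set_integrable lborel ?I (\<lambda>v. E v * of_real (f v))" if "continuous_on UNIV f" for f :: "real \<Rightarrow> real"
    by (rule set_integrable_compact_continuous)
       (auto intro!: continuous_intros continuous_on_subset[OF cE] continuous_on_subset[OF that])
  have "Re (E 0) = 0"
  proof (rule zero)
    assume a: "(LINT v:?I|lborel. E v * of_real (Re (E v))) = 0"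
    have "continuous_on UNIV (\<lambda>u. Re (E u))" by (intro continuous_on_Re continuous_on_Im cE)
    from integral_Re[OF sE[OF this, unfolded set_integrable_def]] a
    show "(LINT v:?I|lborel. (Re (E v))\<^sup>2) = 0"
      by (simp add: set_lebesgue_integral_def power2_eq_square)
  qed (rule continuous_on_Re[OF cE], simp add: E_def add.commute)
  moreover have "Im (E 0) = 0"
  proof (rule zero)
    assume a: "(LINT v:?I|lborel. E v * of_real (Im (E v))) = 0"
    have "continuous_on UNIV (\<lambda>u. Im (E u))" by (intro continuous_on_Re continuous_on_Im cE)
    from integral_Im[OF sE[OF this, unfolded set_integrable_def]] a
    show "(LINT v:?I|lborel. (Im (E v))\<^sup>2) = 0"
      by (simp add: set_lebesgue_integral_def power2_eq_square)
  qed (rule continuous_on_Im[OF cE], simp add: E_def add.commute)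
  ultimately have "E 0 = 0" by (simp add: complex_eq_iff)
  then show ?thesis by (simp add: E_def Q_def)
qed

subsection \<open>Translates of rapidly decaying functions\<close>

text \<open>The added 1 makes the weight submultiplicative and at least 1 while it still dominates
  \<open>|x| powr \<beta>\<close>. Growth at \<open>x + y\<close> can thus be split into a factor
  for \<open>x\<close> and a factor for \<open>y\<close>.\<close>

definition gw :: "real \<Rightarrow> real \<Rightarrow> real" where
  "gw \<beta> x = (1 + \<bar>x\<bar>) powr \<beta>"

lemma gw_minus [simp]: "gw \<beta> (- x) = gw \<beta> x"
  by (simp add: gw_def)

lemma gw_pos: "0 < gw \<beta> x"
  by (simp add: gw_def)

lemma gw_nonneg [simp]: "0 \<le> gw \<beta> x"
  by (simp add: gw_def)

lemma gw_ge_1: "0 \<le> \<beta> \<Longrightarrow> 1 \<le> gw \<beta> x"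
  by (simp add: gw_def ge_one_powr_ge_zero)

lemma gw_mono: "0 \<le> \<beta> \<Longrightarrow> \<bar>x\<bar> \<le> \<bar>y\<bar> \<Longrightarrow> gw \<beta> x \<le> gw \<beta> y"
  by (simp add: gw_def powr_mono2)

lemma gw_submult: "0 \<le> \<beta> \<Longrightarrow> gw \<beta> (x + y) \<le> gw \<beta> x * gw \<beta> y"
proof -
  assume b: "0 \<le> \<beta>"
  have "1 + \<bar>x + y\<bar> \<le> (1 + \<bar>x\<bar>) * (1 + \<bar>y\<bar>)"
  proof -
    have "0 \<le> \<bar>x\<bar> * \<bar>y\<bar>" by simp
    then show ?thesis using abs_triangle_ineq[of x y] unfolding ring_distribs by linarith
  qed
  then have "(1 + \<bar>x + y\<bar>) powr \<beta> \<le> ((1 + \<bar>x\<bar>) * (1 + \<bar>y\<bar>)) powr \<beta>"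
    using b by (intro powr_mono2) auto
  then show ?thesis by (simp add: gw_def powr_mult)
qed

lemma gw_measurable [measurable]: "gw \<beta> \<in> borel_measurable borel"
  unfolding gw_def[abs_def] by measurable

lemma cnj_measurable [measurable]:
  "f \<in> borel_measurable M \<Longrightarrow> (\<lambda>x. cnj (f x)) \<in> borel_measurable M"
  by (rule borel_measurable_continuous_on[of cnj]) (auto intro!: continuous_intros)

text \<open>Lattice sums are written as Bochner integrals over the counting measure, so that Fubini
  and dominated convergence apply to them as to any other integral.\<close>

abbreviation IZ :: "int measure" where "IZ \<equiv> count_space UNIV"

interpretation IZ: sigma_finite_measure IZ
  by (rule sigma_finite_measure_count_space_countable) simp

interpretation IZ_lborel: pair_sigma_finite IZ "lborel :: real measure" ..
interpretation lborel_IZ: pair_sigma_finite "lborel :: real measure" IZ ..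

lemma IZ_single:
  fixes h :: "int \<Rightarrow> 'b :: {banach, second_countable_topology}"
  assumes "\<And>k. k \<noteq> a \<Longrightarrow> h k = 0"
  shows "integrable IZ h" "(LINT k|IZ. h k) = h a"
proof -
  have sub: "{k. h k \<noteq> 0} \<subseteq> {a}" using assms by auto
  then have fin: "finite {k. h k \<noteq> 0}" by (rule finite_subset) simp
  have "(\<integral>\<^sup>+ k. ennreal (norm (h k)) \<partial>IZ) = (\<Sum>k | k \<in> UNIV \<and> 0 < ennreal (norm (h k)). ennreal (norm (h k)))"
    using fin by (intro nn_integral_count_space) (auto elim: rev_finite_subset)
  also have "\<dots> < \<infinity>" by (simp add: less_top[symmetric])
  finally show "integrable IZ h" by (simp add: integrable_iff_bounded)
  have "(LINT k|IZ. h k) = (\<Sum>k | h k \<noteq> 0. h k)"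
    using lebesgue_integral_count_space_finite_support[of UNIV h] fin by simp
  also have "\<dots> = (\<Sum>k\<in>{a}. h k)" by (rule sum.mono_neutral_left) (use sub in auto)
  finally show "(LINT k|IZ. h k) = h a" by simp
qed

lemma measurable_IZ_lborel:
  fixes f :: "int \<Rightarrow> real \<Rightarrow> 'b :: {banach, second_countable_topology}"
  assumes "\<And>k. f k \<in> borel_measurable lborel"
  shows "case_prod f \<in> borel_measurable (IZ \<Otimes>\<^sub>M lborel)"
  by (rule measurable_pair_measure_countable1) (use assms in auto)

lemma measurable_lborel_IZ:
  fixes f :: "int \<Rightarrow> real \<Rightarrow> 'b :: {banach, second_countable_topology}"
  assumes "\<And>k. f k \<in> borel_measurable lborel"
  shows "(\<lambda>(y, k). f k y) \<in> borel_measurable (lborel \<Otimes>\<^sub>M IZ)"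
  using measurable_pair_swap[OF measurable_IZ_lborel[OF assms]] by simp

lemma IZ_lborel_exchange:
  fixes f :: "int \<Rightarrow> real \<Rightarrow> complex"
  assumes i: "\<And>k. integrable lborel (f k)"
    and s: "integrable IZ (\<lambda>k. LINT v|lborel. norm (f k v))"
  shows "(LINT v|lborel. LINT k|IZ. f k v) = (LINT k|IZ. LINT v|lborel. f k v)"
proof -
  have "integrable (IZ \<Otimes>\<^sub>M lborel) (case_prod f)"
    by (rule IZ_lborel.Fubini_integrable) (use i s measurable_IZ_lborel[of f] in auto)
  from IZ_lborel.Fubini_integral[OF this] show ?thesis .
qed

text \<open>Half-open cells centred at the integers tile the line: for each \<open>y\<close> only
  the index \<open>floor (y + 1/2)\<close> contributes, and both claims are Fubini.\<close>

lemma cell_decomposition: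
  fixes h :: "real \<Rightarrow> 'b :: {banach, second_countable_topology}"
  assumes h: "integrable lborel h"
  shows "integrable IZ (\<lambda>k. LINT y|lborel. indicator {of_int k - 1/2..<of_int k + 1/2} y *\<^sub>R h y)" (is "integrable _ (\<lambda>k. LINT y|_. ?f k y)")
    and "(LINT k|IZ. LINT y|lborel. indicator {of_int k - 1/2..<of_int k + 1/2} y *\<^sub>R h y) = (LINT y|lborel. h y)"
proof -
  have z: "?f k y = 0" if "k \<noteq> \<lfloor>y + 1/2\<rfloor>" for k y
    using that by (auto simp: indicator_def) linarith+
  have o: "?f \<lfloor>y + 1/2\<rfloor> y = h y" for y
    by (auto simp: indicator_def) linarith+
  have mf: "(\<lambda>(y, k). ?f k y) \<in> borel_measurable (lborel \<Otimes>\<^sub>M IZ)"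
    by (rule measurable_lborel_IZ) (use h in auto)
  have e: "(LINT k|IZ. norm (?f k y)) = norm (h y)" for y
    using IZ_single(2)[of "\<lfloor>y + 1/2\<rfloor>" "\<lambda>k. norm (?f k y)"] z o by force
  have e': "(LINT k|IZ. ?f k y) = h y" for y
    using IZ_single(2)[of "\<lfloor>y + 1/2\<rfloor>" "\<lambda>k. ?f k y"] z o by force
  have int: "integrable (lborel \<Otimes>\<^sub>M IZ) (\<lambda>(y, k). ?f k y)"
  proof (rule lborel_IZ.Fubini_integrable[OF mf])
    show "integrable lborel (\<lambda>y. LINT k|IZ. norm (case (y, k) of (y, k) \<Rightarrow> ?f k y))"
      using h by (simp only: e prod.case integrable_norm)
    show "AE y in lborel. integrable IZ (\<lambda>k. case (y, k) of (y, k) \<Rightarrow> ?f k y)"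
    proof (rule AE_I2)
      fix y show "integrable IZ (\<lambda>k. case (y, k) of (y, k) \<Rightarrow> ?f k y)"
        using IZ_single(1)[of "\<lfloor>y + 1/2\<rfloor>" "\<lambda>k. ?f k y"] z by force
    qed
  qed
  show "integrable IZ (\<lambda>k. LINT y|lborel. ?f k y)"
    using lborel_IZ.integrable_snd[OF int] .
  have "(LINT k|IZ. LINT y|lborel. ?f k y) = (LINT y|lborel. LINT k|IZ. ?f k y)"
    using lborel_IZ.Fubini_integral[OF int] .
  then show "(LINT k|IZ. LINT y|lborel. ?f k y) = (LINT y|lborel. h y)"
    by (simp only: e')
qed

lemma IZ_shift:
  fixes h :: "int \<Rightarrow> 'b :: {banach, second_countable_topology}"
  shows "integrable IZ (\<lambda>k. h (a - k)) \<longleftrightarrow> integrable IZ h" "(LINT k|IZ. h (a - k)) = (LINT k|IZ. h k)"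
    and "integrable IZ (\<lambda>k. h (a + k)) \<longleftrightarrow> integrable IZ h" "(LINT k|IZ. h (a + k)) = (LINT k|IZ. h k)"
proof -
  have b1: "bij_betw (\<lambda>k. a - k) UNIV (UNIV :: int set)"
    by (rule bij_betwI[where g = "\<lambda>k. a - k"]) auto
  have b2: "bij_betw (\<lambda>k. a + k) UNIV (UNIV :: int set)"
    by (rule bij_betwI[where g = "\<lambda>k. k - a"]) auto
  show "integrable IZ (\<lambda>k. h (a - k)) \<longleftrightarrow> integrable IZ h" "(LINT k|IZ. h (a - k)) = (LINT k|IZ. h k)"
    "integrable IZ (\<lambda>k. h (a + k)) \<longleftrightarrow> integrable IZ h" "(LINT k|IZ. h (a + k)) = (LINT k|IZ. h k)"
    using integrable_bij_count_space[OF b1, of h] integral_bij_count_space[OF b1, of h]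
      integrable_bij_count_space[OF b2, of h] integral_bij_count_space[OF b2, of h] by auto
qed

lemma integral_periodization:
  fixes h :: "real \<Rightarrow> complex"
  assumes h: "integrable lborel h"
  shows "(LINT v:{-1/2..1/2}|lborel. LINT k|IZ. h (v - of_int k)) = (LINT y|lborel. h y)"
proof -
  let ?J = "{-1/2..<1/2::real}"
  define f where "f k v = indicator ?J v *\<^sub>R h (v + of_int k)" for k :: int and v
  define f1 where "f1 k y = indicator {of_int k - 1/2..<of_int k + 1/2} y *\<^sub>R h y" for k :: int and y :: real
  have shift: "f1 k (of_int k + 1 * v) = f k v" for k v
    unfolding f_def f1_def by (auto simp: indicator_def add.commute)
  have i1: "integrable lborel (f1 k)" for k
    unfolding f1_def using h by (intro integrable_mult_indicator) auto
  have if': "integrable lborel (f k)" for k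
    using lborel_integrable_real_affine[OF i1[of k], of 1 "of_int k"] by (simp only: shift; simp)
  have eqi: "(LINT v|lborel. f k v) = (LINT y|lborel. f1 k y)" for k
    using lborel_integral_real_affine[of 1 "f1 k" "of_int k"] by (simp only: shift; simp)
  have eqn: "(LINT v|lborel. norm (f k v)) = (LINT y|lborel. norm (f1 k y))" for k
    using lborel_integral_real_affine[of 1 "\<lambda>y. norm (f1 k y)" "of_int k"] by (simp only: shift; simp)
  have n1: "norm (f1 k y) = indicator {of_int k - 1/2..<of_int k + 1/2} y *\<^sub>R norm (h y)" for k y
    by (simp add: f1_def indicator_def)
  have "integrable IZ (\<lambda>k. LINT v|lborel. norm (f k v))"
    unfolding eqn n1 by (rule cell_decomposition(1)) (use h in auto)
  from IZ_lborel_exchange[OF if' this]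
  have "(LINT v|lborel. LINT k|IZ. f k v) = (LINT k|IZ. LINT y|lborel. f1 k y)"
    by (simp add: eqi)
  also have "\<dots> = (LINT y|lborel. h y)"
    unfolding f1_def by (rule cell_decomposition(2)[OF h])
  also have "(LINT v|lborel. LINT k|IZ. f k v) = (LINT v:{-1/2..1/2}|lborel. LINT k|IZ. h (v - of_int k))"
    unfolding set_lebesgue_integral_def
  proof (rule integral_cong_AE)
    have mh: "(\<lambda>(v, k). h (v - of_int k)) \<in> borel_measurable (lborel \<Otimes>\<^sub>M IZ)"
      by (rule measurable_lborel_IZ) (use h in measurable)
    have mf: "(\<lambda>(v, k). f k v) \<in> borel_measurable (lborel \<Otimes>\<^sub>M IZ)"
      by (rule measurable_lborel_IZ) (use if' in auto)
    show "(\<lambda>v. LINT k|IZ. f k v) \<in> borel_measurable lborel"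
      using IZ.borel_measurable_lebesgue_integral[OF mf] by simp
    show "(\<lambda>v. indicat_real {- 1 / 2..1 / 2} v *\<^sub>R (LINT k|IZ. h (v - of_int k))) \<in> borel_measurable lborel"
      using IZ.borel_measurable_lebesgue_integral[OF mh] by (intro borel_measurable_scaleR) simp_all
    \<comment> \<open>The closed interval and the half-open cell differ only at \<open>1/2\<close>;
      the sign of \<open>k\<close> is reversed by a reflection of the index.\<close>
    show "AE v in lborel. (LINT k|IZ. f k v) = indicat_real {- 1 / 2..1 / 2} v *\<^sub>R (LINT k|IZ. h (v - of_int k))"
      using AE_lborel_singleton[of "1/2"]
    proof eventually_elim
      case (elim v)
      then have *: "f k v = indicat_real {- 1 / 2..1 / 2} v *\<^sub>R h (v + of_int k)" for k
        by (auto simp: f_def indicator_def)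
      have "(LINT k|IZ. h (v + of_int k)) = (LINT k|IZ. h (v - of_int k))"
        using IZ_shift(2)[of "\<lambda>k. h (v + of_int k)" 0] by simp
      then show ?case unfolding * by simp
    qed
  qed
  finally show ?thesis .
qed

section \<open>Coefficients and projections for functions of polynomial growth\<close>

definition wcoef :: "(real \<Rightarrow> complex) \<Rightarrow> (real \<Rightarrow> complex) \<Rightarrow> int \<Rightarrow> complex" where
  "wcoef g f k = (LINT u|lborel. f u * cnj (g (u - of_int k)))"

text \<open>When the integer translates of \<open>g\<close> are orthonormal, this is the orthogonal
  projection onto their closed span, in a form that also makes sense outside
  \<open>L\<^sub>2\<close>.\<close>

definition proj :: "(real \<Rightarrow> complex) \<Rightarrow> (real \<Rightarrow> complex) \<Rightarrow> real \<Rightarrow> complex" where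
  "proj g f x = (LINT k|IZ. wcoef g f k * g (x - of_int k))"

lemma fourier_cis: "fourier g y = (LINT x|lborel. cis (- (y * x)) * g x)"
  unfolding fourier_def by (simp add: cis_conv_exp mult_ac)

text \<open>A weighted Wiener amalgam condition: the suprema of
  \<open>gw \<beta> x * norm (g x)\<close> over the cells \<open>[l, l + 1)\<close> have a summable
  majorant. It controls integrals and lattice sums of translates by the single constant
  \<open>S\<close>.\<close>

locale amalgam =
  fixes \<beta> :: real and \<omega> :: "int \<Rightarrow> real" and g :: "real \<Rightarrow> complex"
  assumes \<beta>: "0 \<le> \<beta>"
    and cont: "continuous_on UNIV g"
    and summ: "integrable IZ \<omega>"
    and bound: "\<And>x. gw \<beta> x * norm (g x) \<le> \<omega> \<lfloor>x\<rfloor>"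
begin

definition S :: real where "S = (LINT k|IZ. \<omega> k)"

lemma \<omega>_nonneg: "0 \<le> \<omega> l"
proof -
  have "0 \<le> gw \<beta> (of_int l) * norm (g (of_int l))" by simp
  also have "\<dots> \<le> \<omega> l" using bound[of "of_int l"] by simp
  finally show ?thesis .
qed

lemma S_nonneg: "0 \<le> S"
  unfolding S_def by (intro integral_nonneg_AE) (simp add: \<omega>_nonneg)

lemma g_measurable [measurable]: "g \<in> borel_measurable borel"
  by (rule borel_measurable_continuous_onI[OF cont])

lemma norm_le: "norm (g x) \<le> \<omega> \<lfloor>x\<rfloor>"
proof -
  have "1 * norm (g x) \<le> gw \<beta> x * norm (g x)" using gw_ge_1[OF \<beta>] by (intro mult_right_mono) auto
  then show ?thesis using bound[of x] by simp
qed

lemma integrable_floor: "integrable lborel (\<lambda>u::real. \<omega> \<lfloor>u\<rfloor>)" (is ?A)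
  and integral_floor: "(LINT u|lborel. \<omega> \<lfloor>u :: real\<rfloor>) = S" (is ?B)
proof -
  have "(\<integral>\<^sup>+ u. ennreal (\<omega> \<lfloor>u :: real\<rfloor>) \<partial>lborel) =
      (\<integral>\<^sup>+ u. \<integral>\<^sup>+ k. ennreal (\<omega> k) * indicator {of_int k..<of_int k + 1} (u :: real) \<partial>IZ \<partial>lborel)"
  proof (rule nn_integral_cong)
    fix u :: real
    have "(\<integral>\<^sup>+ k. ennreal (\<omega> k) * indicator {of_int k..<of_int k + 1} u \<partial>IZ) =
        (\<integral>\<^sup>+ k. ennreal (\<omega> k) * indicator {\<lfloor>u\<rfloor>} k \<partial>IZ)"
      by (rule nn_integral_cong) (auto simp: indicator_def; linarith)
    also have "\<dots> = ennreal (\<omega> \<lfloor>u\<rfloor>)"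
      by simp
    finally show "ennreal (\<omega> \<lfloor>u\<rfloor>) = (\<integral>\<^sup>+ k. ennreal (\<omega> k) * indicator {of_int k..<of_int k + 1} u \<partial>IZ)" ..
  qed
  also have "\<dots> = (\<integral>\<^sup>+ k. \<integral>\<^sup>+ u. ennreal (\<omega> k) * indicator {of_int k..<of_int k + 1} (u :: real) \<partial>lborel \<partial>IZ)"
    by (rule nn_integral_count_space_nn_integral) auto
  also have "\<dots> = (\<integral>\<^sup>+ k. ennreal (\<omega> k) \<partial>IZ)"
    by (simp add: nn_integral_cmult)
  also have "\<dots> = ennreal S"
    unfolding S_def by (rule nn_integral_eq_integral[OF summ]) (simp add: \<omega>_nonneg)
  finally have "(\<integral>\<^sup>+ u. ennreal (\<omega> \<lfloor>u :: real\<rfloor>) \<partial>lborel) = ennreal S" .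
  moreover have "(\<lambda>u::real. \<omega> \<lfloor>u\<rfloor>) \<in> borel_measurable lborel"
    by measurable
  ultimately have "has_bochner_integral lborel (\<lambda>u::real. \<omega> \<lfloor>u\<rfloor>) S"
    by (intro has_bochner_integral_nn_integral) (auto simp: \<omega>_nonneg S_nonneg)
  then show ?A ?B by (auto simp: has_bochner_integral_iff)
qed

lemma integrable_gw_g: "integrable lborel (\<lambda>u. gw \<beta> u * norm (g u))"
  by (rule Bochner_Integration.integrable_bound[OF integrable_floor])
     (use bound in \<open>auto simp: \<omega>_nonneg\<close>)

lemma integral_gw_g: "(LINT u|lborel. gw \<beta> u * norm (g u)) \<le> S"
  unfolding integral_floor[symmetric]
  by (rule integral_mono[OF integrable_gw_g integrable_floor]) (rule bound)

lemma integrable_g: "integrable lborel g"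
proof (rule Bochner_Integration.integrable_bound[OF integrable_gw_g])
  show "AE x in lborel. norm (g x) \<le> norm (gw \<beta> x * norm (g x))"
    using gw_ge_1[OF \<beta>] by (intro AE_I2) (simp add: mult_le_cancel_right1 abs_mult)
qed simp

lemma integrable_shift: "integrable lborel (\<lambda>u. gw \<beta> (u - a) * norm (g (u - a)))" (is ?A)
  and integral_shift: "(LINT u|lborel. gw \<beta> (u - a) * norm (g (u - a))) \<le> S" (is ?B)
proof -
  show ?A using lborel_integrable_real_affine[OF integrable_gw_g, of 1 "-a"] by simp
  show ?B using lborel_integral_real_affine[of 1 "\<lambda>u. gw \<beta> u * norm (g u)" "-a"] integral_gw_g by simp
qed

text \<open>The growth of \<open>f\<close> at \<open>u\<close> is distributed between the centre
  \<open>a\<close> of the translate and the offset \<open>u - a\<close>, where the weighted decay of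
  \<open>g\<close> absorbs it. The lemma \<open>term_bound\<close> uses the same device in the
  lattice variable.\<close>

lemma growth_mult_bound:
  assumes "norm (f u) \<le> C * gw \<beta> u"
  shows "norm (f u * cnj (g (u - a))) \<le> C * gw \<beta> a * (gw \<beta> (u - a) * norm (g (u - a)))"
proof -
  have C: "0 \<le> C" using order_trans[OF norm_ge_zero assms] gw_pos[of \<beta> u] by (simp add: zero_le_mult_iff)
  have "norm (f u) \<le> C * (gw \<beta> a * gw \<beta> (u - a))"
    using assms gw_submult[OF \<beta>, of a "u - a"] C by (auto intro: order_trans mult_left_mono)
  then have "norm (f u) * norm (g (u - a)) \<le> C * (gw \<beta> a * gw \<beta> (u - a)) * norm (g (u - a))"
    by (rule mult_right_mono) simp
  then show ?thesis by (simp add: norm_mult mult_ac)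
qed

lemma integrable_growth:
  assumes "f \<in> borel_measurable borel" "\<And>u. norm (f u) \<le> C * gw \<beta> u"
  shows "integrable lborel (\<lambda>u. f u * cnj (g (u - a)))"
proof (rule Bochner_Integration.integrable_bound)
  show "integrable lborel (\<lambda>u. C * gw \<beta> a * (gw \<beta> (u - a) * norm (g (u - a))))"
    by (intro integrable_mult_right integrable_shift)
  show "AE u in lborel. norm (f u * cnj (g (u - a))) \<le> norm (C * gw \<beta> a * (gw \<beta> (u - a) * norm (g (u - a))))"
    using growth_mult_bound[of f _ C a, OF assms(2)] by (auto intro!: AE_I2 intro: order_trans[OF _ abs_ge_self])
qed (use assms(1) in measurable)

lemma integral_growth:
  assumes "f \<in> borel_measurable borel" "\<And>u. norm (f u) \<le> C * gw \<beta> u"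
  shows "norm (LINT u|lborel. f u * cnj (g (u - a))) \<le> C * gw \<beta> a * S"
proof -
  have C: "0 \<le> C" using order_trans[OF norm_ge_zero assms(2)[of 0]] gw_pos[of \<beta> 0] by (simp add: zero_le_mult_iff)
  have "norm (LINT u|lborel. f u * cnj (g (u - a))) \<le> (LINT u|lborel. C * gw \<beta> a * (gw \<beta> (u - a) * norm (g (u - a))))"
    by (intro Bochner_Integration.integral_norm_bound_integral integrable_mult_right integrable_shift growth_mult_bound assms
        integrable_growth[OF assms])
  also have "\<dots> = C * gw \<beta> a * (LINT u|lborel. gw \<beta> (u - a) * norm (g (u - a)))" by simp
  also have "\<dots> \<le> C * gw \<beta> a * S"
    using integral_shift[of a] C by (intro mult_left_mono) auto
  finally show ?thesis .
qed

lemma wcoef_bound: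
  assumes "f \<in> borel_measurable borel" "\<And>u. norm (f u) \<le> C * gw \<beta> u"
  shows "norm (wcoef g f k) \<le> C * S * gw \<beta> (of_int k)"
  using integral_growth[OF assms, of "of_int k"] by (simp add: wcoef_def mult_ac)

lemma integrable_IZ_\<omega>: "integrable IZ (\<lambda>k. \<omega> (a - k))"
  by (simp add: IZ_shift summ)

lemma integral_IZ_\<omega>: "(LINT k|IZ. \<omega> (a - k)) = S"
  by (simp add: IZ_shift S_def)

lemma term_bound:
  assumes "norm (a k) \<le> C * gw \<beta> (of_int k)"
  shows "norm (a k * g (x - of_int k)) \<le> C * gw \<beta> x * \<omega> (\<lfloor>x\<rfloor> - k)"
proof -
  have C: "0 \<le> C" using order_trans[OF norm_ge_zero assms] gw_pos[of \<beta> "of_int k"] by (simp add: zero_le_mult_iff)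
  have "gw \<beta> (of_int k) \<le> gw \<beta> x * gw \<beta> (x - of_int k)"
    using gw_submult[OF \<beta>, of x "- (x - of_int k)"] by (simp only: gw_minus) simp
  then have "norm (a k) \<le> C * (gw \<beta> x * gw \<beta> (x - of_int k))"
    using assms C by (auto intro: order_trans mult_left_mono)
  then have "norm (a k * g (x - of_int k)) \<le> C * (gw \<beta> x * gw \<beta> (x - of_int k)) * norm (g (x - of_int k))"
    by (simp add: norm_mult mult_right_mono)
  also have "\<dots> = C * gw \<beta> x * (gw \<beta> (x - of_int k) * norm (g (x - of_int k)))" by (simp add: mult_ac)
  also have "\<dots> \<le> C * gw \<beta> x * \<omega> (\<lfloor>x\<rfloor> - k)"
    using bound[of "x - of_int k"] C by (intro mult_left_mono) auto
  finally show ?thesis .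
qed

lemma integrable_terms:
  assumes "\<And>k. norm (a k) \<le> C * gw \<beta> (of_int k)"
  shows "integrable IZ (\<lambda>k. a k * g (x - of_int k))"
proof (rule Bochner_Integration.integrable_bound)
  show "integrable IZ (\<lambda>k. C * gw \<beta> x * \<omega> (\<lfloor>x\<rfloor> - k))"
    by (intro integrable_mult_right integrable_IZ_\<omega>)
qed (use term_bound[of a _ C x, OF assms] in \<open>auto intro!: AE_I2 intro: order_trans[OF _ abs_ge_self]\<close>)

lemma integrable_proj:
  assumes "f \<in> borel_measurable borel" "\<And>u. norm (f u) \<le> C * gw \<beta> u"
  shows "integrable IZ (\<lambda>k. wcoef g f k * g (x - of_int k))"
  by (rule integrable_terms[OF wcoef_bound[OF assms]])

lemma proj_add:
  assumes "f \<in> borel_measurable borel" "\<And>u. norm (f u) \<le> C * gw \<beta> u"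
    and "f' \<in> borel_measurable borel" "\<And>u. norm (f' u) \<le> C' * gw \<beta> u"
  shows "proj g (\<lambda>u. f u + f' u) x = proj g f x + proj g f' x"
proof -
  have "wcoef g (\<lambda>u. f u + f' u) k = wcoef g f k + wcoef g f' k" for k
    unfolding wcoef_def using integrable_growth[OF assms(1,2)] integrable_growth[OF assms(3,4)]
    by (simp add: distrib_right)
  then show ?thesis
    unfolding proj_def using integrable_proj[OF assms(1,2)] integrable_proj[OF assms(3,4)]
    by (simp add: distrib_right)
qed

lemma proj_scale: "proj g (\<lambda>u. c * f u) x = c * proj g f x"
  unfolding proj_def wcoef_def by (simp add: mult.assoc)

text \<open>A growth constant common to all \<open>f i\<close> supplies one majorant for the
  coefficient integrals and one for the lattice sum, so dominated convergence applies twice.\<close>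

lemma proj_tendsto:
  assumes m: "\<And>i. f i \<in> borel_measurable borel" and m': "f' \<in> borel_measurable borel"
    and b: "\<And>i u. norm (f i u) \<le> C * gw \<beta> u"
    and l: "\<And>u. (\<lambda>i. f i u) \<longlonglongrightarrow> f' u"
  shows "(\<lambda>i. proj g (f i) x) \<longlonglongrightarrow> proj g f' x"
  unfolding proj_def
proof (rule integral_dominated_convergence[where w = "\<lambda>k. C * S * gw \<beta> x * \<omega> (\<lfloor>x\<rfloor> - k)"])
  show "integrable IZ (\<lambda>k. C * S * gw \<beta> x * \<omega> (\<lfloor>x\<rfloor> - k))"
    by (intro integrable_mult_right integrable_IZ_\<omega>)
  show "AE k in IZ. norm (wcoef g (f i) k * g (x - of_int k)) \<le> C * S * gw \<beta> x * \<omega> (\<lfloor>x\<rfloor> - k)" for i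
    by (intro AE_I2 term_bound wcoef_bound m b)
  have "(\<lambda>i. wcoef g (f i) k) \<longlonglongrightarrow> wcoef g f' k" for k
    unfolding wcoef_def
  proof (rule integral_dominated_convergence
      [where w = "\<lambda>u. C * gw \<beta> (of_int k) * (gw \<beta> (u - of_int k) * norm (g (u - of_int k)))"])
    show "integrable lborel (\<lambda>u. C * gw \<beta> (of_int k) * (gw \<beta> (u - of_int k) * norm (g (u - of_int k))))"
      by (intro integrable_mult_right integrable_shift)
    show "AE u in lborel. norm (f i u * cnj (g (u - of_int k)))
        \<le> C * gw \<beta> (of_int k) * (gw \<beta> (u - of_int k) * norm (g (u - of_int k)))" for i
      by (intro AE_I2 growth_mult_bound b)
    show "AE u in lborel. (\<lambda>i. f i u * cnj (g (u - of_int k))) \<longlonglongrightarrow> f' u * cnj (g (u - of_int k))"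
      by (intro AE_I2 tendsto_intros l)
  next
    have sh: "(\<lambda>u. g (u - of_int k)) \<in> borel_measurable borel" by measurable
    show "(\<lambda>u. f i u * cnj (g (u - of_int k))) \<in> borel_measurable lborel" for i
      using m[of i] sh by simp
    show "(\<lambda>u. f' u * cnj (g (u - of_int k))) \<in> borel_measurable lborel"
      using m' sh by simp
  qed
  then show "AE k in IZ. (\<lambda>i. wcoef g (f i) k * g (x - of_int k)) \<longlonglongrightarrow> wcoef g f' k * g (x - of_int k)"
    by (intro AE_I2 tendsto_intros)
qed simp_all

lemma fourier_continuous: "continuous_on UNIV (fourier g)"
  unfolding continuous_on_sequentially
proof safe
  fix x :: real and y :: "nat \<Rightarrow> real" assume "y \<longlonglongrightarrow> x"
  then show "(fourier g \<circ> y) \<longlonglongrightarrow> fourier g x"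
    unfolding fourier_cis[abs_def] comp_def
    by (intro integral_dominated_convergence[where w = "\<lambda>u. norm (g u)"])
       (auto simp: norm_mult cis_conv_exp intro!: integrable_norm integrable_g tendsto_intros)
qed

lemma periodization_continuous: "continuous_on UNIV (\<lambda>x. LINT k|IZ. g (x - of_int k))"
  unfolding continuous_on_sequentially
proof safe
  fix x :: real and y :: "nat \<Rightarrow> real" assume y: "y \<longlonglongrightarrow> x"
  then obtain N where N: "\<And>n. n \<ge> N \<Longrightarrow> \<bar>y n - x\<bar> < 1"
    unfolding LIMSEQ_def by (metis dist_real_def zero_less_one)
  \<comment> \<open>A point at distance less than 1 from \<open>x\<close> lies in the cell of
    \<open>x\<close> or in one of its two neighbours.\<close>
  let ?w = "\<lambda>k. \<omega> (\<lfloor>x\<rfloor> - 1 - k) + \<omega> (\<lfloor>x\<rfloor> - k) + \<omega> (\<lfloor>x\<rfloor> + 1 - k)"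
  have "(\<lambda>n. LINT k|IZ. g (y (n + N) - of_int k)) \<longlonglongrightarrow> (LINT k|IZ. g (x - of_int k))"
  proof (rule integral_dominated_convergence[where w = ?w])
    show "integrable IZ ?w" by (intro Bochner_Integration.integrable_add integrable_IZ_\<omega>)
    have y': "(\<lambda>n. y (n + N)) \<longlonglongrightarrow> x" using y by (rule LIMSEQ_ignore_initial_segment)
    have "(\<lambda>n. g (y (n + N) - of_int k)) \<longlonglongrightarrow> g (x - of_int k)" for k :: int
      by (rule continuous_on_tendsto_compose[OF cont]) (auto intro!: tendsto_intros y')
    then show "AE k in IZ. (\<lambda>n. g (y (n + N) - of_int k)) \<longlonglongrightarrow> g (x - of_int k)" by simp
    show "AE k in IZ. norm (g (y (n + N) - of_int k)) \<le> ?w k" for n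
    proof (rule AE_I2)
      fix k
      have "norm (g (y (n + N) - of_int k)) \<le> \<omega> (\<lfloor>y (n + N)\<rfloor> - k)"
        using norm_le[of "y (n + N) - of_int k"] by simp
      moreover have "\<lfloor>y (n + N)\<rfloor> \<in> {\<lfloor>x\<rfloor> - 1, \<lfloor>x\<rfloor>, \<lfloor>x\<rfloor> + 1}"
        using N[of "n + N"] by (simp add: floor_eq_iff abs_less_iff) linarith
      ultimately show "norm (g (y (n + N) - of_int k)) \<le> ?w k"
        using \<omega>_nonneg[of "\<lfloor>x\<rfloor> - 1 - k"] \<omega>_nonneg[of "\<lfloor>x\<rfloor> - k"] \<omega>_nonneg[of "\<lfloor>x\<rfloor> + 1 - k"] by auto
    qed
  qed simp_all
  then show "((\<lambda>x. LINT k|IZ. g (x - of_int k)) \<circ> y) \<longlonglongrightarrow> (LINT k|IZ. g (x - of_int k))"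
    unfolding comp_def by (rule LIMSEQ_offset)
qed

lemma modulate: "amalgam \<beta> \<omega> (\<lambda>u. cis (a * u) * g u)"
  by unfold_locales
     (use \<beta> cont summ bound in \<open>auto intro!: continuous_intros simp: cis_conv_exp norm_mult\<close>)

text \<open>The coefficient form of Poisson summation: the unit interval together with the sum over
  translates unfolds to an integral over the line, that is, to a sample of the transform.\<close>

lemma periodization_coeff:
  "(LINT v:{-1/2..1/2}|lborel. (LINT k|IZ. g (x + v - of_int k)) * cis (2 * pi * of_int l * v))
    = cis (- (2 * pi * of_int l * x)) * fourier g (- (2 * pi * of_int l))"
proof -
  define h where "h y = g (x + y) * cis (2 * pi * of_int l * y)" for y
  have hx: "h (- x + 1 * z) = cis (- (2 * pi * of_int l * x)) * (cis (- (- (2 * pi * of_int l) * z)) * g z)" for z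
    unfolding h_def by (simp add: cis_mult mult_ac ring_distribs; simp add: algebra_simps)
  have ih: "integrable lborel h"
    using lborel_integrable_real_affine[OF amalgam.integrable_g[OF modulate[of "2 * pi * of_int l"]], of 1 x]
      integrable_mult_right[of "cis (- (2 * pi * of_int l * x))"]
    by (subst lborel_integrable_real_affine_iff[of 1 h "-x", symmetric], simp)
       (simp only: hx, intro integrable_mult_right,
        use amalgam.integrable_g[OF modulate[of "2 * pi * of_int l"]] in \<open>simp add: mult_ac\<close>)
  \<comment> \<open>The exponential has period 1 in \<open>v\<close>, so it is a common factor of
    all terms of the lattice sum.\<close>
  have hk: "h (v - of_int k) = g (x + v - of_int k) * cis (2 * pi * of_int l * v)" for v k
  proof -
    have "cis (2 * pi * of_int l * (v - of_int k)) =
        cis (2 * pi * of_int l * v) * cis (- (2 * pi * of_int (l * k)))"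
      by (simp add: cis_mult right_diff_distrib mult_ac)
    also have "cis (- (2 * pi * of_int (l * k))) = 1"
      by (simp add: complex_eq_iff del: of_int_mult)
    finally show ?thesis by (simp add: h_def algebra_simps)
  qed
  have "(LINT y|lborel. h y) = (LINT z|lborel. h (- x + 1 * z))"
    using lborel_integral_real_affine[of 1 h "- x"] by simp
  also have "\<dots> = cis (- (2 * pi * of_int l * x)) * fourier g (- (2 * pi * of_int l))"
    unfolding hx fourier_cis by simp
  finally show ?thesis
    using integral_periodization[OF ih] by (simp add: hk)
qed

lemma wcoef_cis: "wcoef g (\<lambda>u. cis (a * u)) k = cis (a * of_int k) * cnj (fourier g a)"
proof -
  have "wcoef g (\<lambda>u. cis (a * u)) k = (LINT z|lborel. cis (a * (of_int k + 1 * z)) * cnj (g z))"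
    unfolding wcoef_def
    using lborel_integral_real_affine[of 1 "\<lambda>u. cis (a * u) * cnj (g (u - of_int k))" "of_int k"] by simp
  also have "\<dots> = (LINT z|lborel. cis (a * of_int k) * cnj (cis (- (a * z)) * g z))"
    by (simp add: cis_mult[symmetric] distrib_left cis_cnj mult_ac)
  also have "\<dots> = cis (a * of_int k) * cnj (fourier g a)"
    unfolding fourier_cis by (simp del: complex_cnj_mult)
  finally show ?thesis .
qed

end

subsection \<open>The two-scale relation\<close>

text \<open>The transforms of the truncations tend to \<open>h\<close> in mean square and to
  \<open>fourier f\<close> pointwise, by dominated convergence. Fatou's lemma for the squared
  distance to \<open>h\<close> identifies the two limits.\<close>

lemma L2_fourier_eq_fourier:
  assumes h: "L2_fourier f h" and f: "integrable lborel f"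
  shows "AE y in lborel. h y = fourier f y"
proof -
  define FN where "FN N y = (LINT x:{-N..N}|lborel. exp (- (\<i> * of_real y * of_real x)) * f x)" for N y
  have mf: "f \<in> borel_measurable borel" and mh: "h \<in> borel_measurable borel"
    using h by (auto simp: L2_fourier_def L2_def)
  have FN_alt: "FN N y = (LINT x|lborel. indicator {-N..N} x *\<^sub>R (exp (- (\<i> * of_real y * of_real x)) * f x))" for N y
    by (simp add: FN_def set_lebesgue_integral_def)
  have mFN: "FN N \<in> borel_measurable borel" for N
  proof -
    have "(\<lambda>(y, x). indicator {-N..N} x *\<^sub>R (exp (- (\<i> * of_real y * of_real x)) * f x))
        \<in> borel_measurable (borel \<Otimes>\<^sub>M lborel)"
      using mf by measurable
    from lborel.borel_measurable_lebesgue_integral[OF this] show ?thesis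
      unfolding FN_alt[abs_def] by simp
  qed
  have conv: "(\<lambda>n. FN (real n) y) \<longlonglongrightarrow> fourier f y" for y
    unfolding FN_alt fourier_def
  proof (rule integral_dominated_convergence[where w = "\<lambda>x. norm (f x)"])
    show "AE x in lborel. (\<lambda>n. indicat_real {- real n..real n} x *\<^sub>R (exp (- (\<i> * of_real y * of_real x)) * f x))
        \<longlonglongrightarrow> exp (- (\<i> * of_real y * of_real x)) * f x"
    proof (rule AE_I2)
      fix x :: real
      obtain N where N: "\<bar>x\<bar> \<le> real N" using real_arch_simple by blast
      have "\<forall>\<^sub>F n in sequentially. indicat_real {- real n..real n} x *\<^sub>R (exp (- (\<i> * of_real y * of_real x)) * f x)
          = exp (- (\<i> * of_real y * of_real x)) * f x"
        using eventually_ge_at_top[of N] by eventually_elim (use N in \<open>auto simp: indicator_def\<close>)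
      then show "(\<lambda>n. indicat_real {- real n..real n} x *\<^sub>R (exp (- (\<i> * of_real y * of_real x)) * f x))
        \<longlonglongrightarrow> exp (- (\<i> * of_real y * of_real x)) * f x"
        by (rule tendsto_eventually)
    qed
    show "AE x in lborel. norm (indicat_real {- real n..real n} x *\<^sub>R (exp (- (\<i> * of_real y * of_real x)) * f x))
        \<le> norm (f x)" for n
      by (auto simp: indicator_def norm_mult)
  qed (use f mf in \<open>auto\<close>)
  have "((\<lambda>N. \<integral>\<^sup>+ y. ennreal ((cmod (h y - FN N y))\<^sup>2) \<partial>lborel) \<longlongrightarrow> 0) at_top"
    using h unfolding L2_fourier_def FN_def by simp
  then have lim0: "(\<lambda>n. \<integral>\<^sup>+ y. ennreal ((cmod (h y - FN (real n) y))\<^sup>2) \<partial>lborel) \<longlonglongrightarrow> 0"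
    by (rule filterlim_compose[OF _ filterlim_real_sequentially])
  have "(\<integral>\<^sup>+ y. ennreal ((cmod (h y - fourier f y))\<^sup>2) \<partial>lborel)
      = (\<integral>\<^sup>+ y. liminf (\<lambda>n. ennreal ((cmod (h y - FN (real n) y))\<^sup>2)) \<partial>lborel)"
  proof (rule nn_integral_cong)
    fix y
    have "(\<lambda>n. ennreal ((cmod (h y - FN (real n) y))\<^sup>2)) \<longlonglongrightarrow> ennreal ((cmod (h y - fourier f y))\<^sup>2)"
      by (intro tendsto_ennrealI tendsto_intros conv)
    then show "ennreal ((cmod (h y - fourier f y))\<^sup>2) = liminf (\<lambda>n. ennreal ((cmod (h y - FN (real n) y))\<^sup>2))"
      by (rule lim_imp_Liminf[OF sequentially_bot, symmetric])
  qed
  also have "\<dots> \<le> liminf (\<lambda>n. \<integral>\<^sup>+ y. ennreal ((cmod (h y - FN (real n) y))\<^sup>2) \<partial>lborel)"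
    by (rule nn_integral_liminf) (use mh mFN in measurable)
  also have "\<dots> = 0" using lim0 by (simp add: lim_imp_Liminf)
  finally have z: "(\<integral>\<^sup>+ y. ennreal ((cmod (h y - fourier f y))\<^sup>2) \<partial>lborel) = 0" by simp
  have mF: "fourier f \<in> borel_measurable borel"
    by (rule borel_measurable_LIMSEQ_metric[OF mFN[of "real _"]]) (use conv in auto)
  have "AE y in lborel. ennreal ((cmod (h y - fourier f y))\<^sup>2) = 0"
    using z by (subst (asm) nn_integral_0_iff_AE) (use mh mF in \<open>auto\<close>)
  then show ?thesis by eventually_elim simp
qed

lemma IZ_even_odd:
  fixes a :: "int \<Rightarrow> complex"
  assumes "integrable IZ a"
  shows "integrable IZ (\<lambda>j. a (2 * j))" "integrable IZ (\<lambda>j. a (2 * j + 1))"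
    and "(LINT k|IZ. a k) = (LINT j|IZ. a (2 * j) + a (2 * j + 1))"
proof -
  let ?E = "{k::int. even k}" and ?O = "{k::int. odd k}"
  have bE: "bij_betw (\<lambda>j. 2 * j) UNIV ?E" by (rule bij_betwI[where g = "\<lambda>k. k div 2"]) auto
  have bO: "bij_betw (\<lambda>j. 2 * j + 1) UNIV ?O" by (rule bij_betwI[where g = "\<lambda>k. k div 2"]) auto
  have s: "Infinite_Set_Sum.abs_summable_on a UNIV" using assms by (simp add: Infinite_Set_Sum.abs_summable_on_def)
  have sE: "Infinite_Set_Sum.abs_summable_on a ?E" and sO: "Infinite_Set_Sum.abs_summable_on a ?O"
    by (rule Infinite_Set_Sum.abs_summable_on_subset[OF s]; simp)+
  show i1: "integrable IZ (\<lambda>j. a (2 * j))" and i2: "integrable IZ (\<lambda>j. a (2 * j + 1))"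
    using sE sO Infinite_Set_Sum.abs_summable_on_reindex_bij_betw[OF bE, of a] Infinite_Set_Sum.abs_summable_on_reindex_bij_betw[OF bO, of a]
    by (simp_all add: Infinite_Set_Sum.abs_summable_on_def)
  have "?E \<union> ?O = UNIV" by auto
  then have "infsetsum a UNIV = infsetsum a ?E + infsetsum a ?O"
    using infsetsum_Un_disjoint[OF sE sO] by auto
  also have "infsetsum a ?E = infsetsum (\<lambda>j. a (2 * j)) UNIV"
    by (rule infsetsum_reindex_bij_betw[OF bE, symmetric])
  also have "infsetsum a ?O = infsetsum (\<lambda>j. a (2 * j + 1)) UNIV"
    by (rule infsetsum_reindex_bij_betw[OF bO, symmetric])
  finally show "(LINT k|IZ. a k) = (LINT j|IZ. a (2 * j) + a (2 * j + 1))"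
    using i1 i2 by (simp add: infsetsum_def)
qed

lemma cis_int_2pi: "cis (2 * pi * of_int k) = 1"
  by (simp add: complex_eq_iff)

lemma cis_int_pi: "cis (pi * of_int l) = (if even l then 1 else -1)"
proof (cases "even l")
  case True
  then obtain k where "l = 2 * k" by auto
  then show ?thesis using cis_int_2pi[of k] by (simp add: mult_ac)
next
  case False
  then obtain k where l: "l = 2 * k + 1" by (auto elim: oddE)
  have "cis (pi * of_int l) = cis (2 * pi * of_int k) * cis pi"
    unfolding cis_mult l by (simp add: algebra_simps)
  then show ?thesis using False by (simp add: cis_int_2pi)
qed

text \<open>Both wavelets share one cell majorant \<open>\<omega>\<close>, hence one constant
  \<open>S\<close>. The integrable derivative \<open>F'\<close> serves to prove that the transform
  of \<open>\<phi>\<close> has modulus 1 at 0.\<close>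

locale wavelet_pair = phi: amalgam \<beta> \<omega> \<phi> + psi: amalgam \<beta> \<omega> \<psi>
  for \<beta> :: real and \<omega> \<phi> \<psi> +
  fixes F' :: "real \<Rightarrow> complex"
  assumes fw: "f_wavelet \<phi>" and mw: "m_wavelet \<phi> \<psi>"
    and deriv: "\<And>z. (fourier \<phi> has_vector_derivative F' z) (at z)"
    and deriv_cont: "continuous_on UNIV F'"
    and deriv_int: "integrable lborel (\<lambda>u. cmod (F' u))"
begin

abbreviation F where "F \<equiv> fourier \<phi>"
abbreviation G where "G \<equiv> fourier \<psi>"

lemma sum_F: "AE y in lborel. ((\<lambda>k::int. (cmod (F (y + 2 * pi * of_int k)))\<^sup>2) has_sum 1) UNIV"
proof -
  obtain h where h: "L2_fourier \<phi> h"
    "AE y in lborel. ((\<lambda>k::int. (cmod (h (y + 2 * pi * of_int k)))\<^sup>2) has_sum 1) UNIV"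
    using fw by (auto simp: f_wavelet_def)
  have "AE y in lborel. h y = F y" by (rule L2_fourier_eq_fourier[OF h(1) phi.integrable_g])
  then have "AE y in lborel. h (2 * pi * of_int k + 1 * y) = F (2 * pi * of_int k + 1 * y)" for k :: int
    by (rule AE_lborel_affine) simp
  then have "AE y in lborel. \<forall>k::int. h (2 * pi * of_int k + 1 * y) = F (2 * pi * of_int k + 1 * y)"
    by (simp add: AE_all_countable)
  with h(2) show ?thesis
  proof eventually_elim
    case (elim y)
    then have "h (y + 2 * pi * of_int k) = F (y + 2 * pi * of_int k)" for k :: int
      by (simp add: add.commute)
    then show ?case using elim(1) by simp
  qed
qed

lemma F0_nonzero: "F 0 \<noteq> 0"
proof -
  obtain h where h: "L2_fourier \<phi> h" "h 0 \<noteq> 0" "isCont h 0"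
    using fw by (auto simp: f_wavelet_def)
  have "h 0 = F 0"
    by (rule AE_lborel_eq_isCont[OF L2_fourier_eq_fourier[OF h(1) phi.integrable_g] h(3)])
       (use phi.fourier_continuous in \<open>simp add: continuous_on_eq_continuous_at\<close>)
  with h(2) show ?thesis by simp
qed

text \<open>The definitions allow different representatives of the transforms; all of them agree
  almost everywhere with the integrals \<open>F\<close> and \<open>G\<close>, so both relations hold
  with one and the same mask.\<close>

lemma mask_relations:
  obtains m0 where "\<And>y (k::int). m0 (y + pi * of_int (2 * k)) = m0 y"
    "AE y in lborel. F y = m0 (y / 2) * F (y / 2)"
    "AE y in lborel. G y = cnj (m0 (y / 2 + pi)) * cis (- (y / 2)) * F (y / 2)"
proof -
  obtain m0 h g where m: "refinement_mask \<phi> m0" "L2_fourier \<phi> h" "L2_fourier \<psi> g"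
    and ae: "AE y in lborel. g y = cnj (m0 (y / 2 + pi)) * exp (- (\<i> * of_real y / 2)) * h (y / 2)"
    using mw by (auto simp: m_wavelet_def)
  obtain h' where h': "L2_fourier \<phi> h'" "AE y in lborel. h' y = m0 (y / 2) * h' (y / 2)"
    using m(1) by (auto simp: refinement_mask_def)
  have per: "m0 (y + 2 * pi) = m0 y" for y using m(1) by (auto simp: refinement_mask_def)
  have perk: "m0 (y + pi * of_int (2 * k)) = m0 y" for y and k :: int
  proof (induction k arbitrary: y rule: int_induct[where k = 0])
    case (step1 k)
    have "m0 (y + pi * of_int (2 * (k + 1))) = m0 (y + pi * of_int (2 * k) + 2 * pi)"
      by (simp add: algebra_simps)
    then show ?case using step1 by (simp only: per)
  next
    case (step2 k)
    have "m0 (y + pi * of_int (2 * (k - 1))) = m0 (y + pi * of_int (2 * (k - 1)) + 2 * pi)"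
      by (simp only: per)
    also have "\<dots> = m0 (y + pi * of_int (2 * k))" by (simp add: algebra_simps)
    finally show ?case using step2 by simp
  qed simp
  have hF: "AE y in lborel. h y = F y" "AE y in lborel. h' y = F y" "AE y in lborel. g y = G y"
    using L2_fourier_eq_fourier m(2,3) h'(1) phi.integrable_g psi.integrable_g by auto
  have half: "AE y in lborel. h (y / 2) = F (y / 2)" "AE y in lborel. h' (y / 2) = F (y / 2)"
    using AE_lborel_affine[OF hF(1), of "1/2" 0] AE_lborel_affine[OF hF(2), of "1/2" 0] by simp_all
  have "AE y in lborel. F y = m0 (y / 2) * F (y / 2)"
    using h'(2) hF(2) half(2) by eventually_elim simp
  moreover have "AE y in lborel. G y = cnj (m0 (y / 2 + pi)) * cis (- (y / 2)) * F (y / 2)"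
    using ae hF(3) half(1) by eventually_elim (simp add: cis_conv_exp)
  ultimately show thesis using perk that by blast
qed

text \<open>The mask is eliminated here. For even \<open>l\<close> its values enter through
  \<open>|m0 z|^2 + |m0 (z + pi)|^2 = 1\<close>; for odd \<open>l\<close> the factor
  \<open>cis (pi l) = -1\<close> makes the two products cancel. The identity holds almost
  everywhere, hence everywhere by continuity.\<close>

lemma two_scale_fourier:
  "cnj (F (2 * z)) * F (2 * z + 2 * pi * of_int l) + cnj (G (2 * z)) * G (2 * z + 2 * pi * of_int l)
    = (if even l then cnj (F z) * F (z + pi * of_int l) else 0)"
proof -
  obtain m0 where per: "\<And>y (k::int). m0 (y + pi * of_int (2 * k)) = m0 y"
    and mF: "AE y in lborel. F y = m0 (y / 2) * F (y / 2)"
    and mG: "AE y in lborel. G y = cnj (m0 (y / 2 + pi)) * cis (- (y / 2)) * F (y / 2)"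
    by (rule mask_relations) blast
  have eF: "AE z in lborel. \<forall>k::int. F (2 * z + 2 * pi * of_int k) = m0 (z + pi * of_int k) * F (z + pi * of_int k)"
    unfolding AE_all_countable
  proof
    fix k :: int
    show "AE z in lborel. F (2 * z + 2 * pi * of_int k) = m0 (z + pi * of_int k) * F (z + pi * of_int k)"
      using AE_lborel_affine[OF mF, of 2 "2 * pi * of_int k"]
      by (simp add: add_divide_distrib add.commute)
  qed
  have eG: "AE z in lborel. \<forall>k::int. G (2 * z + 2 * pi * of_int k) =
      cnj (m0 (z + pi * of_int k + pi)) * cis (- (z + pi * of_int k)) * F (z + pi * of_int k)"
    unfolding AE_all_countable
  proof
    fix k :: int
    show "AE z in lborel. G (2 * z + 2 * pi * of_int k) =
      cnj (m0 (z + pi * of_int k + pi)) * cis (- (z + pi * of_int k)) * F (z + pi * of_int k)"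
      using AE_lborel_affine[OF mG, of 2 "2 * pi * of_int k"]
      by (simp add: add_divide_distrib add.commute add.left_commute)
  qed
  have s0: "AE z in lborel. ((\<lambda>k::int. (cmod (F (z + 2 * pi * of_int k)))\<^sup>2) has_sum 1) UNIV" by (rule sum_F)
  have s1: "AE z in lborel. ((\<lambda>k::int. (cmod (F (pi + 1 * z + 2 * pi * of_int k)))\<^sup>2) has_sum 1) UNIV"
    by (rule AE_lborel_affine[OF sum_F]) simp
  have s2: "AE z in lborel. ((\<lambda>k::int. (cmod (F (0 + 2 * z + 2 * pi * of_int k)))\<^sup>2) has_sum 1) UNIV"
    by (rule AE_lborel_affine[OF sum_F]) simp
  \<comment> \<open>The identity \<open>sum_F\<close> at \<open>2 * z\<close> is split into even and
    odd shifts. By periodicity the mask is constant on each class, and what remains of each class is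
    \<open>sum_F\<close> at \<open>z\<close> and at \<open>z + pi\<close>.\<close>
  have mask: "AE z in lborel. (cmod (m0 z))\<^sup>2 + (cmod (m0 (z + pi)))\<^sup>2 = 1"
    using s0 s1 s2 eF
  proof eventually_elim
    case (elim z)
    let ?f = "\<lambda>k::int. (cmod (F (2 * z + 2 * pi * of_int k)))\<^sup>2"
    have fk: "?f k = (cmod (m0 (z + pi * of_int k)))\<^sup>2 * (cmod (F (z + pi * of_int k)))\<^sup>2" for k
      using elim(4) by (simp add: norm_mult power_mult_distrib)
    have "?f (2 * j) = (cmod (m0 z))\<^sup>2 * (cmod (F (z + 2 * pi * of_int j)))\<^sup>2" for j
      using fk[of "2 * j"] per[of z j] by (simp add: mult_ac)
    then have "((\<lambda>j. ?f (2 * j)) has_sum ((cmod (m0 z))\<^sup>2 * 1)) UNIV"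
      using has_sum_cmult_right[OF elim(1)] by simp
    then have E: "(?f has_sum ((cmod (m0 z))\<^sup>2 * 1)) (range (\<lambda>j::int. 2 * j))"
      by (subst has_sum_reindex) (auto simp: inj_def comp_def)
    have "?f (2 * j + 1) = (cmod (m0 (z + pi)))\<^sup>2 * (cmod (F (pi + 1 * z + 2 * pi * of_int j)))\<^sup>2" for j
      using fk[of "2 * j + 1"] per[of "z + pi" j] by (simp add: algebra_simps)
    then have "((\<lambda>j. ?f (2 * j + 1)) has_sum ((cmod (m0 (z + pi)))\<^sup>2 * 1)) UNIV"
      using has_sum_cmult_right[OF elim(2)] by simp
    then have O: "(?f has_sum ((cmod (m0 (z + pi)))\<^sup>2 * 1)) (range (\<lambda>j::int. 2 * j + 1))"
      by (subst has_sum_reindex) (auto simp: inj_def comp_def)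
    have "range (\<lambda>j::int. 2 * j) \<inter> range (\<lambda>j. 2 * j + 1) = {}" by auto presburger
    moreover have "range (\<lambda>j::int. 2 * j) \<union> range (\<lambda>j. 2 * j + 1) = UNIV"
      by (auto simp: image_def) presburger
    ultimately have "(?f has_sum ((cmod (m0 z))\<^sup>2 * 1 + (cmod (m0 (z + pi)))\<^sup>2 * 1)) UNIV"
      using has_sum_Un_disjoint[OF E O] by simp
    with elim(3) show ?case using has_sum_unique by fastforce
  qed
  show ?thesis
  proof (rule AE_lborel_eq_continuous[of "\<lambda>z. cnj (F (2 * z)) * F (2 * z + 2 * pi * of_int l) + cnj (G (2 * z)) * G (2 * z + 2 * pi * of_int l)"
        "\<lambda>z. if even l then cnj (F z) * F (z + pi * of_int l) else 0" z])
    have c: "continuous_on UNIV (\<lambda>z. H (a * z + b))" if "continuous_on UNIV H" for H :: "real \<Rightarrow> complex" and a b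
      by (rule continuous_on_compose2[OF that]) (auto intro!: continuous_intros)
    note cF = phi.fourier_continuous and cG = psi.fourier_continuous
    show "continuous_on UNIV (\<lambda>z. cnj (F (2 * z)) * F (2 * z + 2 * pi * of_int l) + cnj (G (2 * z)) * G (2 * z + 2 * pi * of_int l))"
      using c[OF cF, of 2 0] c[OF cG, of 2 0] c[OF cF, of 2 "2 * pi * of_int l"] c[OF cG, of 2 "2 * pi * of_int l"]
      by (intro continuous_on_add continuous_on_mult continuous_on_cnj) simp_all
    show "continuous_on UNIV (\<lambda>z. if even l then cnj (F z) * F (z + pi * of_int l) else 0)"
      using cF c[OF cF, of 1 "pi * of_int l"] by (cases "even l") (simp_all add: continuous_on_mult continuous_on_cnj)
    show "AE z in lborel. cnj (F (2 * z)) * F (2 * z + 2 * pi * of_int l) + cnj (G (2 * z)) * G (2 * z + 2 * pi * of_int l)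
       = (if even l then cnj (F z) * F (z + pi * of_int l) else 0)"
      using eF eG mask
    proof eventually_elim
      case (elim z)
      have F0: "F (2 * z) = m0 z * F z" using elim(1)[rule_format, of 0] by simp
      have Fl: "F (2 * z + 2 * pi * of_int l) = m0 (z + pi * of_int l) * F (z + pi * of_int l)"
        using elim(1) by blast
      have G0: "G (2 * z) = cnj (m0 (z + pi)) * cis (- z) * F z" using elim(2)[rule_format, of 0] by simp
      have Gl: "G (2 * z + 2 * pi * of_int l) = cnj (m0 (z + pi * of_int l + pi)) * cis (- (z + pi * of_int l)) * F (z + pi * of_int l)"
        using elim(2) by blast
      have cc: "cis z * cis (- (z + pi * of_int l)) = (if even l then 1 else -1)"
        using cis_int_pi[of "- l"] by (simp add: cis_mult)
      have m1: "m0 z * cnj (m0 z) + m0 (z + pi) * cnj (m0 (z + pi)) = 1"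
      proof -
        have "complex_of_real ((cmod (m0 z))\<^sup>2 + (cmod (m0 (z + pi)))\<^sup>2) = 1"
          unfolding elim(3) by simp
        then show ?thesis by (simp only: of_real_add complex_norm_square)
      qed
      show ?case
      proof (cases "even l")
        case True
        then obtain k where k: "l = 2 * k" by auto
        have "m0 (z + pi * of_int l) = m0 z" "m0 (z + pi * of_int l + pi) = m0 (z + pi)"
          using per[of z k] per[of "z + pi" k] k by (simp_all add: algebra_simps)
        then have "cnj (F (2 * z)) * F (2 * z + 2 * pi * of_int l) + cnj (G (2 * z)) * G (2 * z + 2 * pi * of_int l)
            = cnj (F z) * F (z + pi * of_int l) * (m0 z * cnj (m0 z) + m0 (z + pi) * cnj (m0 (z + pi)) * (cis z * cis (- (z + pi * of_int l))))"
          unfolding F0 Fl G0 Gl by (simp add: cis_cnj algebra_simps)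
        then show ?thesis using True m1 cc by simp
      next
        case False
        then obtain k where k: "l = 2 * k + 1" by (auto elim: oddE)
        have "m0 (z + pi * of_int l) = m0 (z + pi)" "m0 (z + pi * of_int l + pi) = m0 z"
          using per[of "z + pi" k] per[of z "k + 1"] k by (simp_all add: algebra_simps)
        then have "cnj (F (2 * z)) * F (2 * z + 2 * pi * of_int l) + cnj (G (2 * z)) * G (2 * z + 2 * pi * of_int l)
            = cnj (F z) * F (z + pi * of_int l) * (cnj (m0 z) * m0 (z + pi)) * (1 + cis z * cis (- (z + pi * of_int l)))"
          unfolding F0 Fl G0 Gl by (simp add: cis_cnj algebra_simps)
        then show ?thesis using False cc by simp
      qed
    qed
  qed
qed

lemma G_0: "G 0 = 0"
  using two_scale_fourier[of 0 0] by simp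

text \<open>At \<open>z = 0\<close> the two-scale identity, with \<open>G 0 = 0\<close> and
  \<open>F 0 \<noteq> 0\<close>, gives the claim for odd \<open>l\<close> and reduces
  \<open>l = 2 * m\<close> to \<open>m\<close>.\<close>

lemma F_2pi: "l \<noteq> 0 \<Longrightarrow> F (2 * pi * of_int l) = 0"
proof (induction "nat \<bar>l\<bar>" arbitrary: l rule: less_induct)
  case less
  show ?case
  proof (cases "even l")
    case True
    then obtain m where m: "l = 2 * m" by auto
    then have "F (2 * pi * of_int m) = 0" using less by simp
    then show ?thesis
      using two_scale_fourier[of 0 l] True F0_nonzero m by (simp add: G_0 mult_ac)
  next
    case False
    then show ?thesis using two_scale_fourier[of 0 l] F0_nonzero by (simp add: G_0)
  qed
qed

end

section \<open>Reproduction of constants and the two-scale step for even functions\<close>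

lemma set_integrable_translate_cis:
  fixes Q :: "real \<Rightarrow> complex"
  assumes "continuous_on UNIV Q"
  shows "set_integrable lborel {-1/2..1/2} (\<lambda>v. c * (Q (x + v) * cis (b * v)))"
proof (rule set_integrable_compact_continuous)
  have "continuous_on {-1/2..1/2} (\<lambda>v. Q (x + v))"
    by (rule continuous_on_compose2[OF assms]) (auto intro!: continuous_intros)
  then show "continuous_on {-1/2..1/2} (\<lambda>v. c * (Q (x + v) * cis (b * v)))"
    unfolding cis_conv_exp by (intro continuous_intros)
qed simp

context wavelet_pair
begin

lemma F_increment:
  assumes "0 \<le> y"
  shows "cmod (F (a + y) - F a) \<le> (LINT u|lborel. indicator {a..a+y} u *\<^sub>R cmod (F' u))"
proof -
  have i: "set_integrable lborel {a..a+y} F'"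
    by (rule set_integrable_compact_continuous) (auto intro: continuous_on_subset[OF deriv_cont])
  have "F (a + y) - F a = (LINT u|lborel. indicator {a..a+y} u *\<^sub>R F' u)"
    by (rule integral_FTC_atLeastAtMost[symmetric])
       (use assms has_vector_derivative_at_within[OF deriv] continuous_on_subset[OF deriv_cont] in simp_all)
  also have "cmod \<dots> \<le> (LINT u|lborel. indicator {a..a+y} u *\<^sub>R cmod (F' u))"
  proof (rule Bochner_Integration.integral_norm_bound_integral)
    show "integrable lborel (\<lambda>u. indicator {a..a+y} u *\<^sub>R F' u)" using i by (simp add: set_integrable_def)
    show "integrable lborel (\<lambda>u. indicator {a..a+y} u *\<^sub>R cmod (F' u))"
      using deriv_int by (intro integrable_mult_indicator) auto
  qed (auto simp: indicator_def)
  finally show ?thesis .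
qed

text \<open>Since \<open>F\<close> vanishes at the points \<open>2 \<pi> k\<close>, \<open>k \<noteq> 0\<close>, the integrability of \<open>F'\<close> makes
  \<open>\<Sum>\<^sub>k\<^sub>\<noteq>\<^sub>0 |F (y + 2 \<pi> k)|\<^sup>2\<close> small for small \<open>y\<close>.\<close>

lemma cmod_F_0: "cmod (F 0) = 1"
proof -
  \<comment> \<open>\<open>r u\<close> is the distance from \<open>u\<close> down to the preceding
    multiple of \<open>2 * pi\<close>, so \<open>U y\<close> is, for
    \<open>0 \<le> y < 2 * pi\<close>, the union of the intervals
    \<open>[2 pi k, 2 pi k + y]\<close>. These shrink to a null set as \<open>y\<close> decreases to
    0, and \<open>d y\<close>, the mass of \<open>F'\<close> on them, tends to 0.\<close>
  define r where "r u = u - 2 * pi * of_int \<lfloor>u / (2 * pi)\<rfloor>" for u :: real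
  define U where "U y = {u. r u \<le> y}" for y
  define d where "d y = (LINT u|lborel. indicator (U y) u *\<^sub>R cmod (F' u))" for y
  have r0: "0 \<le> r u" for u
  proof -
    have "2 * pi * of_int \<lfloor>u / (2 * pi)\<rfloor> \<le> 2 * pi * (u / (2 * pi))"
      by (intro mult_left_mono of_int_floor_le) simp
    then show ?thesis by (simp add: r_def)
  qed
  have mU [measurable]: "U y \<in> sets borel" for y
    unfolding U_def r_def by measurable
  have mF' [measurable]: "F' \<in> borel_measurable borel"
    by (rule borel_measurable_continuous_onI[OF deriv_cont])
  have sub: "u \<in> U y \<and> \<lfloor>u / (2 * pi)\<rfloor> = k" if "2 * pi * of_int k \<le> u" "u \<le> 2 * pi * of_int k + y" "y < 2 * pi" for u y and k :: int
  proof -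
    have "\<lfloor>u / (2 * pi)\<rfloor> = k" unfolding floor_eq_iff using that by (simp add: field_simps)
    then show ?thesis using that by (simp add: U_def r_def)
  qed
  have fin: "(\<Sum>k\<in>B. cmod (F (y + 2 * pi * of_int k))) \<le> d y"
    if B: "finite B" "0 \<notin> B" and y: "0 \<le> y" "y < 2 * pi" for B :: "int set" and y
  proof -
    have ii: "integrable lborel (\<lambda>u. indicator {2 * pi * of_int k..2 * pi * of_int k + y} u *\<^sub>R cmod (F' u))" for k :: int
      using deriv_int by (intro integrable_mult_indicator) auto
    have "(\<Sum>k\<in>B. cmod (F (y + 2 * pi * of_int k)))
        \<le> (\<Sum>k\<in>B. LINT u|lborel. indicator {2 * pi * of_int k..2 * pi * of_int k + y} u *\<^sub>R cmod (F' u))"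
    proof (rule sum_mono)
      fix k assume "k \<in> B"
      then have "k \<noteq> 0" using B by auto
      then show "cmod (F (y + 2 * pi * of_int k)) \<le>
          (LINT u|lborel. indicator {2 * pi * of_int k..2 * pi * of_int k + y} u *\<^sub>R cmod (F' u))"
        using F_increment[OF y(1), of "2 * pi * of_int k"] F_2pi[of k] by (simp add: add.commute)
    qed
    also have "\<dots> = (LINT u|lborel. (\<Sum>k\<in>B. indicator {2 * pi * of_int k..2 * pi * of_int k + y} u *\<^sub>R cmod (F' u)))"
      by (rule Bochner_Integration.integral_sum[symmetric]) (rule ii)
    also have "\<dots> \<le> d y"
      unfolding d_def
    proof (rule integral_mono)
      show "integrable lborel (\<lambda>u. \<Sum>k\<in>B. indicator {2 * pi * of_int k..2 * pi * of_int k + y} u *\<^sub>R cmod (F' u))"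
        by (intro Bochner_Integration.integrable_sum ii)
      show "integrable lborel (\<lambda>u. indicator (U y) u *\<^sub>R cmod (F' u))"
        using deriv_int by (intro integrable_mult_indicator) auto
      fix u
      have "(\<Sum>k\<in>B. indicator {2 * pi * of_int k..2 * pi * of_int k + y} u *\<^sub>R cmod (F' u))
          \<le> (\<Sum>k\<in>B. if k = \<lfloor>u / (2 * pi)\<rfloor> then indicator (U y) u *\<^sub>R cmod (F' u) else 0)"
        using sub[of _ u y] y by (intro sum_mono) (auto simp: indicator_def)
      also have "\<dots> \<le> indicator (U y) u *\<^sub>R cmod (F' u)"
        using B by (simp add: sum.delta)
      finally show "(\<Sum>k\<in>B. indicator {2 * pi * of_int k..2 * pi * of_int k + y} u *\<^sub>R cmod (F' u))
          \<le> indicator (U y) u *\<^sub>R cmod (F' u)" .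
    qed
    finally show ?thesis .
  qed
  obtain y where y: "\<And>n. 0 < y n" "\<And>n. y n < 0 + 1 / real (Suc n)"
      "\<And>n. ((\<lambda>k::int. (cmod (F (y n + 2 * pi * of_int k)))\<^sup>2) has_sum 1) UNIV" and ylim: "y \<longlonglongrightarrow> 0"
    by (rule AE_lborel_sequence[OF sum_F, of 0]) blast
  have y1: "y n < 2 * pi" for n
  proof -
    have "1 / real (Suc n) \<le> 1" by simp
    then show ?thesis using y(2)[of n] pi_gt3 by linarith
  qed
  have d0: "0 \<le> d y" for y unfolding d_def by (intro integral_nonneg_AE) auto
  have dlim: "(\<lambda>n. d (y n)) \<longlonglongrightarrow> (LINT u|(lborel :: real measure). 0::real)"
    unfolding d_def
  proof (rule integral_dominated_convergence[where w = "\<lambda>u. cmod (F' u)"])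
    have "AE u in lborel. u \<notin> range (\<lambda>k::int. 2 * pi * of_int k)"
      by (rule AE_not_in) (intro countable_imp_null_set_lborel, simp)
    then show "AE u in lborel. (\<lambda>n. indicator (U (y n)) u *\<^sub>R cmod (F' u)) \<longlonglongrightarrow> 0"
    proof eventually_elim
      case (elim u)
      have "r u \<noteq> 0" using elim by (auto simp: r_def)
      then have "0 < r u" using r0[of u] by simp
      then have "\<forall>\<^sub>F n in sequentially. y n < r u" using ylim by (rule order_tendstoD(2)[rotated])
      then have "\<forall>\<^sub>F n in sequentially. indicator (U (y n)) u *\<^sub>R cmod (F' u) = 0"
        by eventually_elim (auto simp: U_def indicator_def)
      then show ?case by (rule tendsto_eventually)
    qed
    show "AE u in lborel. norm (indicator (U (y n)) u *\<^sub>R cmod (F' u)) \<le> cmod (F' u)" for n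
      by (auto simp: indicator_def)
    show "(\<lambda>u. indicator (U (y n)) u *\<^sub>R cmod (F' u)) \<in> borel_measurable lborel" for n
      by measurable
  qed (use deriv_int in auto)
  have upper: "(cmod (F (y n)))\<^sup>2 \<le> 1" for n
    using finite_sum_le_has_sum[OF y(3)[of n], of "{0}"] by simp
  \<comment> \<open>For \<open>k \<noteq> 0\<close> each modulus and also the sum of the moduli is
    at most \<open>d (y n)\<close>, so the sum of the squares is at most its square.\<close>
  have lower: "1 \<le> (cmod (F (y n)))\<^sup>2 + (d (y n))\<^sup>2" for n
  proof (rule has_sum_le_finite_sums[OF y(3)[of n]])
    fix B :: "int set" assume B: "finite B"
    let ?f = "\<lambda>k::int. cmod (F (y n + 2 * pi * of_int k))"
    have s: "(\<Sum>k\<in>B - {0}. ?f k) \<le> d (y n)"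
      by (rule fin) (use B y(1)[of n] y1[of n] in auto)
    have each: "?f k \<le> d (y n)" if "k \<in> B - {0}" for k
      using member_le_sum[OF that, of ?f] B s by auto
    have "(\<Sum>k\<in>B - {0}. (?f k)\<^sup>2) \<le> (\<Sum>k\<in>B - {0}. d (y n) * ?f k)"
      using each by (intro sum_mono) (simp add: power2_eq_square mult_right_mono)
    also have "\<dots> = d (y n) * (\<Sum>k\<in>B - {0}. ?f k)" by (simp add: sum_distrib_left)
    also have "\<dots> \<le> (d (y n))\<^sup>2"
      using s d0[of "y n"] by (simp add: power2_eq_square mult_left_mono)
    finally have "(\<Sum>k\<in>B - {0}. (?f k)\<^sup>2) \<le> (d (y n))\<^sup>2" .
    moreover have "(\<Sum>k\<in>B. (?f k)\<^sup>2) \<le> (?f 0)\<^sup>2 + (\<Sum>k\<in>B - {0}. (?f k)\<^sup>2)"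
    proof (cases "0 \<in> B")
      case True
      then show ?thesis using B by (simp add: sum.remove)
    next
      case False
      then show ?thesis by simp
    qed
    ultimately show "(\<Sum>k\<in>B. (?f k)\<^sup>2) \<le> (cmod (F (y n)))\<^sup>2 + (d (y n))\<^sup>2" by simp
  qed
  have "isCont F 0" using phi.fourier_continuous by (simp add: continuous_on_eq_continuous_at)
  from isCont_tendsto_compose[OF this ylim]
  have Fl: "(\<lambda>n. (cmod (F (y n)))\<^sup>2) \<longlonglongrightarrow> (cmod (F 0))\<^sup>2" by (intro tendsto_intros)
  then have "(cmod (F 0))\<^sup>2 \<le> 1" by (rule LIMSEQ_le_const2) (use upper in auto)
  moreover have "1 \<le> (cmod (F 0))\<^sup>2"
  proof -
    have "(\<lambda>n. (cmod (F (y n)))\<^sup>2 + (d (y n))\<^sup>2) \<longlonglongrightarrow> (cmod (F 0))\<^sup>2 + 0\<^sup>2"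
      using tendsto_add[OF Fl tendsto_power[OF dlim, of 2]] by simp
    then have "1 \<le> (cmod (F 0))\<^sup>2 + 0\<^sup>2" by (rule LIMSEQ_le_const) (use lower in auto)
    then show ?thesis by simp
  qed
  ultimately have "(cmod (F 0))\<^sup>2 = 1" by simp
  then show ?thesis by (simp add: power2_eq_1_iff) (use norm_ge_zero[of "F 0"] in linarith)
qed

text \<open>By \<open>F_2pi\<close> only the coefficient of index 0 of the periodization survives,
  whatever the base point. The difference of two translates therefore has no nonzero coefficient, so
  the periodization is constant and equal to its mean \<open>F 0\<close>.\<close>

lemma sum_translates: "(LINT k|IZ. \<phi> (x - of_int k)) = F 0"
proof -
  define P where "P x = (LINT k|IZ. \<phi> (x - of_int k))" for x
  have cP: "continuous_on UNIV P" unfolding P_def by (rule phi.periodization_continuous)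
  have coef: "(LINT v:{-1/2..1/2}|lborel. P (x + v) * cis (2 * pi * of_int l * v)) = (if l = 0 then F 0 else 0)" for x and l :: int
    using phi.periodization_coeff[of x l] F_2pi[of "- l"] by (simp add: P_def)
  have si: "set_integrable lborel {-1/2..1/2} (\<lambda>v. P (x + v) * cis (2 * pi * of_int l * v))" for x and l :: int
    using set_integrable_translate_cis[OF cP, of 1 x] by simp
  have const: "P x = P y" for x y
  proof -
    have "P (x + 0) - P (y + 0) = 0"
    proof (rule fourier_coeff_unique[where q = "\<lambda>v. P (x + v) - P (y + v)"])
      show "continuous_on UNIV (\<lambda>v. P (x + v) - P (y + v))"
        by (rule continuous_on_diff; rule continuous_on_compose2[OF cP]) (auto intro!: continuous_intros)
      show "(LINT v:{-1/2..1/2}|lborel. (P (x + (z + v)) - P (y + (z + v))) * cis (2 * pi * of_int l * v)) = 0" for z and l :: int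
        unfolding left_diff_distrib add.assoc[symmetric]
        by (subst set_integral_diff(2)[OF si si]) (simp only: coef diff_self)
    qed
    then show ?thesis by simp
  qed
  have "F 0 = (LINT v:{-1/2..1/2}|lborel. P (x + v))" using coef[of x 0] by simp
  also have "\<dots> = (LINT v:{-1/2..1/2::real}|lborel. P x)" using const by (intro set_lebesgue_integral_cong) auto
  also have "\<dots> = P x" by (simp add: set_lebesgue_integral_def)
  finally show ?thesis by (simp add: P_def)
qed

text \<open>All coefficients of the constant 1 equal \<open>cnj (F 0)\<close> and the translates add
  up to \<open>F 0\<close>, so modulus 1 of \<open>F 0\<close> is exactly what reproduction of
  constants requires.\<close>

lemma proj_1: "proj \<phi> (\<lambda>_. c) x = c"
proof -
  have "proj \<phi> (\<lambda>_. 1) x = (LINT k|IZ. cnj (F 0) * \<phi> (x - of_int k))"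
    unfolding proj_def using phi.wcoef_cis[of 0] by simp
  also have "\<dots> = cnj (F 0) * F 0" by (simp add: sum_translates)
  also have "\<dots> = 1" using cmod_F_0 complex_norm_square[of "F 0"] by (simp add: mult.commute)
  finally show ?thesis using phi.proj_scale[of c "\<lambda>_. 1" x] by simp
qed

end

text \<open>The remaining sum is the periodization of \<open>u -> cis (- (a * u)) * g u\<close>.
  Taking out \<open>cis (a * x)\<close> reduces identities between projections of exponentials to
  identities between periodic functions.\<close>

lemma (in amalgam) proj_cis:
  "proj g (\<lambda>u. cis (a * u)) x = cnj (fourier g a) * cis (a * x) * (LINT k|IZ. cis (- (a * (x - of_int k))) * g (x - of_int k))"
proof -
  have eq: "wcoef g (\<lambda>u. cis (a * u)) k * g (x - of_int k) =
      cnj (fourier g a) * cis (a * x) * (cis (- (a * (x - of_int k))) * g (x - of_int k))" for k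
  proof -
    have "cis (a * x) * cis (- (a * (x - of_int k))) = cis (a * of_int k)"
      by (simp add: cis_mult algebra_simps)
    then show ?thesis unfolding wcoef_cis by (simp only: flip: \<open>_ = cis (a * of_int k)\<close>) (simp only: mult_ac)
  qed
  then show ?thesis unfolding proj_def eq by simp
qed

lemma (in amalgam) fourier_modulate: "fourier (\<lambda>u. cis (- (a * u)) * g u) y = fourier g (y + a)"
proof -
  have eq: "cis (- (y * x)) * (cis (- (a * x)) * g x) = cis (- ((y + a) * x)) * g x" for x
    unfolding mult.assoc[symmetric] cis_mult by (simp add: distrib_right)
  show ?thesis unfolding fourier_cis by (simp only: eq)
qed

text \<open>Sampling the periodization at \<open>2 x\<close> is a periodization of \<open>u \<mapsto> g (2 u) + g (2 u - 1)\<close>.\<close>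

lemma (in amalgam) periodization_coeff_double:
  "(LINT v:{-1/2..1/2}|lborel. (LINT k|IZ. g (2 * (x + v) - of_int k)) * cis (2 * pi * of_int l * v))
    = (if even l then cis (- (2 * pi * of_int l * x)) * fourier g (- (pi * of_int l)) else 0)"
proof -
  define h where "h y = (g (2 * (x + y)) + g (2 * (x + y) - 1)) * cis (2 * pi * of_int l * y)" for y
  have mod: "amalgam \<beta> \<omega> (\<lambda>u. cis (pi * of_int l * u) * g u)" by (rule modulate)
  define gm where "gm u = cis (pi * of_int l * u) * g u" for u
  have igm: "integrable lborel gm" unfolding gm_def by (rule amalgam.integrable_g[OF mod])
  have h_eq: "h y = cis (- (2 * pi * of_int l * x)) * gm (2 * x + 2 * y) + cis (pi * of_int l) * cis (- (2 * pi * of_int l * x)) * gm (2 * x - 1 + 2 * y)" for y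
  proof -
    have "cis (- (2 * pi * of_int l * x)) * cis (pi * of_int l * (2 * x + 2 * y)) = cis (2 * pi * of_int l * y)"
      "cis (pi * of_int l) * cis (- (2 * pi * of_int l * x)) * cis (pi * of_int l * (2 * x - 1 + 2 * y)) = cis (2 * pi * of_int l * y)"
      by (simp_all add: cis_mult algebra_simps)
    then show ?thesis unfolding h_def gm_def by (simp add: algebra_simps)
  qed
  have ia: "integrable lborel (\<lambda>y. gm (a + 2 * y))" for a
    by (rule lborel_integrable_real_affine[OF igm]) simp
  have inta: "(LINT y|lborel. gm (a + 2 * y)) = (1/2) * (LINT u|lborel. gm u)" for a
    using lborel_integral_real_affine[of 2 gm a] by (simp add: scaleR_conv_of_real)
  have ih: "integrable lborel h" unfolding h_eq by (intro Bochner_Integration.integrable_add integrable_mult_right ia)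
  have hk: "(LINT j|IZ. h (v - of_int j)) = (LINT k|IZ. g (2 * (x + v) - of_int k)) * cis (2 * pi * of_int l * v)" for v
  proof -
    have c: "cis (2 * pi * of_int l * (v - of_int j)) = cis (2 * pi * of_int l * v)" for j
    proof -
      have "cis (2 * pi * of_int l * (v - of_int j)) = cis (2 * pi * of_int l * v) * cis (2 * pi * of_int (- l * j))"
        by (simp add: cis_mult algebra_simps)
      then show ?thesis by (simp only: cis_int_2pi mult_1_right)
    qed
    have it: "integrable IZ (\<lambda>k. g (2 * (x + v) - of_int k))"
      using integrable_terms[of "\<lambda>_. 1" 1 "2 * (x + v)"] gw_ge_1[OF \<beta>] by simp
    have "h (v - of_int j) = (g (2 * (x + v) - of_int (2 * j)) + g (2 * (x + v) - of_int (2 * j + 1))) * cis (2 * pi * of_int l * v)" for j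
      unfolding h_def c by (simp add: algebra_simps)
    then have "(LINT j|IZ. h (v - of_int j)) =
        (LINT j|IZ. g (2 * (x + v) - of_int (2 * j)) + g (2 * (x + v) - of_int (2 * j + 1))) * cis (2 * pi * of_int l * v)"
      by (simp only: integral_mult_left_zero)
    then show ?thesis using IZ_even_odd(3)[OF it] by simp
  qed
  have gmF: "(LINT u|lborel. gm u) = fourier g (- (pi * of_int l))"
    unfolding fourier_cis gm_def by simp
  have "(LINT y|lborel. h y) = cis (- (2 * pi * of_int l * x)) * ((1/2) * fourier g (- (pi * of_int l)))
      + cis (pi * of_int l) * cis (- (2 * pi * of_int l * x)) * ((1/2) * fourier g (- (pi * of_int l)))"
    unfolding h_eq by (subst Bochner_Integration.integral_add) (auto intro!: integrable_mult_right ia simp: inta gmF)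
  also have "\<dots> = (if even l then cis (- (2 * pi * of_int l * x)) * fourier g (- (pi * of_int l)) else 0)"
    by (simp add: cis_int_pi)
  finally show ?thesis using integral_periodization[OF ih] by (simp add: hk)
qed

context wavelet_pair
begin

text \<open>After division by \<open>cis (a * x)\<close> both sides are combinations of
  periodizations. Their coefficients of index \<open>l\<close> agree by
  \<open>two_scale_fourier\<close> with \<open>z = a / 2\<close> and index \<open>- l\<close>, and
  continuous functions with equal coefficients coincide.\<close>

lemma step_cis:
  "proj \<phi> (\<lambda>u. cis (a * u)) x + proj \<psi> (\<lambda>u. cis (a * u)) x = proj \<phi> (\<lambda>u. cis (a / 2 * u)) (2 * x)"
proof -
  define p where "p u = cis (- (a * u)) * \<phi> u" for u
  define s where "s u = cis (- (a * u)) * \<psi> u" for u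
  define h where "h u = cis (- (a / 2 * u)) * \<phi> u" for u
  have ap: "amalgam \<beta> \<omega> p" and as: "amalgam \<beta> \<omega> s" and ah: "amalgam \<beta> \<omega> h"
    unfolding p_def[abs_def] s_def[abs_def] h_def[abs_def]
    using phi.modulate[of "- a"] psi.modulate[of "- a"] phi.modulate[of "- (a / 2)"] by simp_all
  interpret p: amalgam \<beta> \<omega> p by fact
  interpret s: amalgam \<beta> \<omega> s by fact
  interpret h: amalgam \<beta> \<omega> h by fact
  define Pp where "Pp x = (LINT k|IZ. p (x - of_int k))" for x
  define Ps where "Ps x = (LINT k|IZ. s (x - of_int k))" for x
  define Ph where "Ph x = (LINT k|IZ. h (2 * x - of_int k))" for x
  have cp: "continuous_on UNIV Pp" and cs: "continuous_on UNIV Ps"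
    unfolding Pp_def Ps_def by (rule p.periodization_continuous s.periodization_continuous)+
  have ch: "continuous_on UNIV Ph"
    unfolding Ph_def by (rule continuous_on_compose2[OF h.periodization_continuous]) (auto intro!: continuous_intros)
  have "cnj (F a) * Pp x + cnj (G a) * Ps x - cnj (F (a / 2)) * Ph x = 0"
  proof (rule fourier_coeff_unique)
    show "continuous_on UNIV (\<lambda>x. cnj (F a) * Pp x + cnj (G a) * Ps x - cnj (F (a / 2)) * Ph x)"
      by (intro continuous_intros cp cs ch)
    fix x and l :: int
    have si: "set_integrable lborel {-1/2..1/2} (\<lambda>v. c * (Q (x + v) * cis (2 * pi * of_int l * v)))"
      if "continuous_on UNIV Q" for Q c
      by (rule set_integrable_translate_cis[OF that])
    have "(LINT v:{-1/2..1/2}|lborel. (cnj (F a) * Pp (x + v) + cnj (G a) * Ps (x + v) - cnj (F (a / 2)) * Ph (x + v)) * cis (2 * pi * of_int l * v))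
        = (LINT v:{-1/2..1/2}|lborel. cnj (F a) * (Pp (x + v) * cis (2 * pi * of_int l * v)) + cnj (G a) * (Ps (x + v) * cis (2 * pi * of_int l * v))
            - cnj (F (a / 2)) * (Ph (x + v) * cis (2 * pi * of_int l * v)))"
      by (simp add: algebra_simps)
    also have "\<dots> = cnj (F a) * (cis (- (2 * pi * of_int l * x)) * fourier p (- (2 * pi * of_int l)))
        + cnj (G a) * (cis (- (2 * pi * of_int l * x)) * fourier s (- (2 * pi * of_int l)))
        - cnj (F (a / 2)) * (if even l then cis (- (2 * pi * of_int l * x)) * fourier h (- (pi * of_int l)) else 0)"
      using p.periodization_coeff[of x l] s.periodization_coeff[of x l] h.periodization_coeff_double[of x l]
      by (subst set_integral_diff(2)[OF set_integral_add(1)[OF si[OF cp] si[OF cs]] si[OF ch]],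
          subst set_integral_add(2)[OF si[OF cp] si[OF cs]])
         (simp only: set_integral_mult_right Pp_def Ps_def Ph_def)
    also have "\<dots> = cis (- (2 * pi * of_int l * x)) *
       (cnj (F a) * F (a - 2 * pi * of_int l) + cnj (G a) * G (a - 2 * pi * of_int l)
         - (if even l then cnj (F (a / 2)) * F (a / 2 - pi * of_int l) else 0))"
      unfolding p_def s_def h_def phi.fourier_modulate psi.fourier_modulate
      by (simp add: algebra_simps)
    also have "\<dots> = 0"
      using two_scale_fourier[of "a / 2" "- l"] by simp
    finally show "(LINT v:{-1/2..1/2}|lborel. (cnj (F a) * Pp (x + v) + cnj (G a) * Ps (x + v) - cnj (F (a / 2)) * Ph (x + v)) * cis (2 * pi * of_int l * v)) = 0" .
  qed
  then have "cis (a * x) * (cnj (F a) * Pp x + cnj (G a) * Ps x) = cis (a * x) * (cnj (F (a / 2)) * Ph x)"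
    by simp
  then show ?thesis
    unfolding phi.proj_cis psi.proj_cis Pp_def Ps_def Ph_def p_def s_def h_def
    by (simp add: algebra_simps)
qed

text \<open>The defect \<open>L\<close> of the two-scale step vanishes on exponentials by
  \<open>step_cis\<close>, hence on cosine polynomials. It then vanishes at \<open>f\<close>, the
  dominated limit of such polynomials with folding range \<open>m\<close> and accuracy
  \<open>1 / m\<close> for \<open>m = 1, 2, ...\<close>.\<close>

lemma step_even:
  fixes f :: "real \<Rightarrow> real"
  assumes cont: "continuous_on UNIV f" and even: "\<And>u. f (- u) = f u" and bd: "\<And>u. \<bar>f u\<bar> \<le> C * gw \<beta> u"
  shows "proj \<phi> (\<lambda>u. of_real (f u)) x + proj \<psi> (\<lambda>u. of_real (f u)) x = proj \<phi> (\<lambda>u. of_real (f (u / 2))) (2 * x)"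
proof -
  define L where "L h = proj \<phi> h x + proj \<psi> h x - proj \<phi> (\<lambda>u. h (u / 2)) (2 * x)" for h
  have half: "C' * gw \<beta> (u / 2) \<le> C' * gw \<beta> u" if "0 \<le> C'" for C' u
    using that by (intro mult_left_mono gw_mono phi.\<beta>) auto
  have gwb: "norm (h u) \<le> B * gw \<beta> u" if "norm (h u) \<le> B" for h :: "real \<Rightarrow> complex" and B u
  proof -
    have "0 \<le> B" using that norm_ge_zero order_trans by blast
    then have "B * 1 \<le> B * gw \<beta> u" by (intro mult_left_mono gw_ge_1 phi.\<beta>)
    then show ?thesis using that by simp
  qed
  have Lpoly: "L (\<lambda>u. of_real (\<Sum>i\<le>n. b i * cos (\<theta> * u) ^ i)) = 0" for b n \<theta>
  proof (rule linear_vanish_cos_poly)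
    fix h h' assume "bdd_fun h" "bdd_fun h'"
    then obtain B B' where m: "h \<in> borel_measurable borel" "h' \<in> borel_measurable borel"
      and b: "\<And>u. norm (h u) \<le> B" "\<And>u. norm (h' u) \<le> B'"
      by (auto simp: bdd_fun_def bounded_iff)
    have m2: "(\<lambda>u. h (u / 2)) \<in> borel_measurable borel" "(\<lambda>u. h' (u / 2)) \<in> borel_measurable borel"
      using m by measurable
    have g: "norm (h u) \<le> B * gw \<beta> u" "norm (h' u) \<le> B' * gw \<beta> u"
      "norm (h (u / 2)) \<le> B * gw \<beta> u" "norm (h' (u / 2)) \<le> B' * gw \<beta> u" for u
      using gwb[of h u B] gwb[of h' u B'] gwb[of "\<lambda>u. h (u / 2)" u B] gwb[of "\<lambda>u. h' (u / 2)" u B'] b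
      by simp_all
    show "L (\<lambda>u. h u + h' u) = L h + L h'"
      unfolding L_def
      using phi.proj_add[OF m(1) g(1) m(2) g(2), of x] psi.proj_add[OF m(1) g(1) m(2) g(2), of x]
        phi.proj_add[OF m2(1) g(3) m2(2) g(4), of "2 * x"] by simp
  next
    show "L (\<lambda>u. c * h u) = c * L h" for c h
      unfolding L_def phi.proj_scale psi.proj_scale by (simp add: algebra_simps)
    show "L (\<lambda>u. cis (\<theta> * of_int l * u)) = 0" for l :: int
      unfolding L_def using step_cis[of "\<theta> * of_int l" x] by simp
  qed
  have "\<exists>q. (\<forall>u. \<bar>f (real (Suc m) / pi * arccos (cos (pi / real (Suc m) * u))) - q u\<bar> < 1 / real (Suc m)) \<and>
      q \<in> borel_measurable borel \<and> L (\<lambda>u. of_real (q u)) = 0" for m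
  proof -
    obtain b n where bn: "\<And>u. \<bar>f (real (Suc m) / pi * arccos (cos (pi / real (Suc m) * u))) - (\<Sum>i\<le>n. b i * cos (pi / real (Suc m) * u) ^ i)\<bar> < 1 / real (Suc m)"
      by (rule even_approx_cos_poly[OF cont, of "real (Suc m)" "1 / real (Suc m)"]) auto
    show ?thesis
    proof (intro exI conjI allI)
      show "\<bar>f (real (Suc m) / pi * arccos (cos (pi / real (Suc m) * u))) - (\<Sum>i\<le>n. b i * cos (pi / real (Suc m) * u) ^ i)\<bar> < 1 / real (Suc m)" for u
        by (rule bn)
      show "(\<lambda>u. \<Sum>i\<le>n. b i * cos (pi / real (Suc m) * u) ^ i) \<in> borel_measurable borel"
        by (intro borel_measurable_continuous_onI continuous_intros)
    qed (rule Lpoly)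
  qed
  then obtain p where bn: "\<And>m u. \<bar>f (real (Suc m) / pi * arccos (cos (pi / real (Suc m) * u))) - p m u\<bar> < 1 / real (Suc m)"
    and mp: "\<And>m. p m \<in> borel_measurable borel" and Lp: "\<And>m. L (\<lambda>u. of_real (p m u)) = 0"
    by metis
  have mf: "f \<in> borel_measurable borel" by (rule borel_measurable_continuous_onI[OF cont])
  have C0: "0 \<le> C" using order_trans[OF abs_ge_zero bd[of 0]] gw_pos[of \<beta> 0] by (simp add: zero_le_mult_iff)
  \<comment> \<open>The folded point \<open>?v\<close> satisfies \<open>|?v| \<le> |u|\<close>, so
    the bound on \<open>f\<close> at \<open>?v\<close> is at most the one at \<open>u\<close>; the
    extra 1 covers the approximation error.\<close>
  have pb: "norm (complex_of_real (p m u)) \<le> (C + 1) * gw \<beta> u" for m u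
  proof -
    let ?v = "real (Suc m) / pi * arccos (cos (pi / real (Suc m) * u))"
    have "\<bar>?v\<bar> \<le> real (Suc m) / pi * \<bar>pi / real (Suc m) * u\<bar>"
      using arccos_cos_bounds(1,3)[of "pi / real (Suc m) * u"]
      by (simp only: abs_mult) (intro mult_mono, auto)
    then have "\<bar>?v\<bar> \<le> \<bar>u\<bar>" by (simp add: abs_mult)
    then have "C * gw \<beta> ?v \<le> C * gw \<beta> u" using C0 by (intro mult_left_mono gw_mono phi.\<beta>) auto
    then have "\<bar>f ?v\<bar> \<le> C * gw \<beta> u" using bd[of ?v] by linarith
    moreover have "1 / real (Suc m) \<le> 1" by simp
    moreover have "1 \<le> gw \<beta> u" by (rule gw_ge_1[OF phi.\<beta>])
    ultimately have "\<bar>p m u\<bar> \<le> C * gw \<beta> u + gw \<beta> u" using bn[where m = m and u = u] by linarith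
    then show ?thesis by (simp add: algebra_simps)
  qed
  have plim: "(\<lambda>m. complex_of_real (p m u)) \<longlonglongrightarrow> of_real (f u)" for u
  proof -
    obtain N where N: "\<bar>u\<bar> \<le> real N" using real_arch_simple by blast
    have close: "\<bar>p m u - f u\<bar> \<le> 1 / real (Suc m)" if "m \<ge> N" for m
    proof -
      have um: "\<bar>u\<bar> \<le> real (Suc m)" using N that by linarith
      have "arccos (cos (pi / real (Suc m) * u)) = \<bar>pi / real (Suc m) * u\<bar>"
      proof -
        have "\<bar>pi / real (Suc m) * u\<bar> \<le> pi" using mult_left_mono[OF um, of pi] by (simp add: abs_mult field_simps)
        then show ?thesis using arccos_cos[of "\<bar>pi / real (Suc m) * u\<bar>"] by (simp only: cos_abs_real abs_ge_zero)
      qed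
      then have "real (Suc m) / pi * arccos (cos (pi / real (Suc m) * u)) = \<bar>u\<bar>" by (simp add: abs_mult)
      moreover have "f \<bar>u\<bar> = f u" using even by (simp add: abs_if)
      ultimately show ?thesis using bn[where m = m and u = u] by (simp add: abs_minus_commute less_imp_le)
    qed
    have "(\<lambda>m. p m u - f u) \<longlonglongrightarrow> 0"
    proof (rule Lim_null_comparison)
      show "(\<lambda>m. 1 / real (Suc m)) \<longlonglongrightarrow> 0"
        by (rule inverse_Suc_tendsto)
      show "\<forall>\<^sub>F m in sequentially. norm (p m u - f u) \<le> 1 / real (Suc m)"
        using eventually_ge_at_top[of N] by eventually_elim (use close in simp)
    qed
    then have "(\<lambda>m. p m u) \<longlonglongrightarrow> f u" by (simp add: LIM_zero_iff)
    then show ?thesis by (rule tendsto_of_real)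
  qed
  have m1: "(\<lambda>u. complex_of_real (p m u)) \<in> borel_measurable borel" "(\<lambda>u. complex_of_real (f u)) \<in> borel_measurable borel"
    "(\<lambda>u. complex_of_real (p m (u / 2))) \<in> borel_measurable borel" "(\<lambda>u. complex_of_real (f (u / 2))) \<in> borel_measurable borel" for m
    using mp[of m] mf by measurable
  have pb2: "norm (complex_of_real (p m (u / 2))) \<le> (C + 1) * gw \<beta> u" for m u
    using pb[of m "u / 2"] half[of "C + 1" u] C0 by linarith
  have "(\<lambda>m. L (\<lambda>u. of_real (p m u))) \<longlonglongrightarrow> L (\<lambda>u. of_real (f u))"
    unfolding L_def
    by (intro tendsto_intros phi.proj_tendsto[where C = "C + 1"] psi.proj_tendsto[where C = "C + 1"] m1 pb pb2 plim)
  then have "L (\<lambda>u. of_real (f u)) = 0" by (simp add: Lp LIMSEQ_const_iff)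
  then show ?thesis by (simp add: L_def)
qed

end

subsection \<open>Approximation of Hoelder functions\<close>

lemma integral_norm_le:
  fixes f :: "'a \<Rightarrow> 'b :: {banach, second_countable_topology}"
  assumes "integrable M f" "integrable M g" "\<And>x. x \<in> space M \<Longrightarrow> norm (f x) \<le> g x"
  shows "norm (LINT x|M. f x) \<le> (LINT x|M. g x)"
proof -
  have "norm (LINT x|M. f x) \<le> (LINT x|M. norm (f x))" by (rule integral_norm_bound)
  also have "\<dots> \<le> (LINT x|M. g x)" by (intro integral_mono integrable_norm assms)
  finally show ?thesis .
qed

text \<open>Growth is measured from the evaluation point \<open>s\<close> instead of the origin. The
  weight of \<open>s - k\<close> produced by the coefficient is absorbed by
  \<open>g (s - k)\<close>, so the bound does not depend on \<open>s\<close>.\<close>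

lemma (in amalgam) proj_local_bound:
  assumes h: "h \<in> borel_measurable borel" and b: "\<And>u. norm (h u) \<le> C * gw \<beta> (u - s)"
  shows "norm (proj g h s) \<le> C * S * S"
proof -
  have C: "0 \<le> C" using order_trans[OF norm_ge_zero b[of 0]] gw_pos[of \<beta> "0 - s"] by (simp add: zero_le_mult_iff)
  have w: "norm (wcoef g h k) \<le> C * S * gw \<beta> (s - of_int k)" for k
  proof -
    have "norm (LINT u|lborel. (\<lambda>u. h (u + s)) u * cnj (g (u - (of_int k - s)))) \<le> C * gw \<beta> (of_int k - s) * S"
      by (rule integral_growth) (use h b[of "_ + s"] in \<open>auto\<close>)
    moreover have "(LINT u|lborel. h (u + s) * cnj (g (u - (of_int k - s)))) = wcoef g h k"
      unfolding wcoef_def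
      using lborel_integral_real_affine[of 1 "\<lambda>u. h u * cnj (g (u - of_int k))" s] by (simp add: algebra_simps)
    ultimately show ?thesis using gw_minus[of \<beta> "s - of_int k"] by (simp add: mult_ac)
  qed
  have t: "norm (wcoef g h k * g (s - of_int k)) \<le> C * S * \<omega> (\<lfloor>s\<rfloor> - k)" for k
  proof -
    have "norm (wcoef g h k * g (s - of_int k)) \<le> C * S * gw \<beta> (s - of_int k) * norm (g (s - of_int k))"
      unfolding norm_mult by (intro mult_right_mono w) simp
    also have "\<dots> = C * S * (gw \<beta> (s - of_int k) * norm (g (s - of_int k)))" by simp
    also have "\<dots> \<le> C * S * \<omega> (\<lfloor>s\<rfloor> - k)"
      using bound[of "s - of_int k"] C S_nonneg by (intro mult_left_mono) auto
    finally show ?thesis .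
  qed
  have i: "integrable IZ (\<lambda>k. C * S * \<omega> (\<lfloor>s\<rfloor> - k))" by (intro integrable_mult_right integrable_IZ_\<omega>)
  have "integrable IZ (\<lambda>k. wcoef g h k * g (s - of_int k))"
    by (rule Bochner_Integration.integrable_bound[OF i]) (use t in \<open>auto intro!: AE_I2 intro: order_trans[OF _ abs_ge_self]\<close>)
  then have "norm (proj g h s) \<le> (LINT k|IZ. C * S * \<omega> (\<lfloor>s\<rfloor> - k))"
    unfolding proj_def by (intro integral_norm_le i t)
  then show ?thesis by (simp add: integral_IZ_\<omega>)
qed

text \<open>The value 0 at the origin turns the Hoelder bound into a growth bound with the same
  constant, and evenness is what \<open>step_even\<close> requires.\<close>

definition holder :: "real \<Rightarrow> real \<Rightarrow> (real \<Rightarrow> real) \<Rightarrow> bool" where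
  "holder \<beta> H f \<longleftrightarrow> 0 \<le> H \<and> f 0 = 0 \<and> (\<forall>u. f (- u) = f u) \<and> (\<forall>u v. \<bar>f u - f v\<bar> \<le> H * \<bar>u - v\<bar> powr \<beta>)"

lemma holder_scale:
  assumes "holder \<beta> H f" shows "holder \<beta> (H * 2 powr (- \<beta> * real n)) (\<lambda>u. f (u / 2 ^ n))"
proof -
  have "\<bar>f (u / 2 ^ n) - f (v / 2 ^ n)\<bar> \<le> H * 2 powr (- \<beta> * real n) * \<bar>u - v\<bar> powr \<beta>" for u v
  proof -
    have "\<bar>u / 2 ^ n - v / 2 ^ n\<bar> = \<bar>u - v\<bar> * 2 powr (- real n)"
      by (simp add: powr_minus powr_realpow divide_inverse flip: left_diff_distrib) (simp add: abs_mult)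
    then have "\<bar>u / 2 ^ n - v / 2 ^ n\<bar> powr \<beta> = \<bar>u - v\<bar> powr \<beta> * 2 powr (- \<beta> * real n)"
      by (simp add: powr_mult powr_powr mult.commute)
    then show ?thesis using assms unfolding holder_def by (metis mult.assoc mult.commute)
  qed
  then show ?thesis using assms by (auto simp: holder_def)
qed

lemma powr_le_gw: "0 \<le> \<beta> \<Longrightarrow> \<bar>u\<bar> powr \<beta> \<le> gw \<beta> u"
  unfolding gw_def by (rule powr_mono2) auto

lemma holder_growth: "holder \<beta> H f \<Longrightarrow> 0 \<le> \<beta> \<Longrightarrow> \<bar>f u\<bar> \<le> H * gw \<beta> u"
proof -
  assume h: "holder \<beta> H f" and b: "0 \<le> \<beta>"
  have "\<bar>f u - f 0\<bar> \<le> H * \<bar>u - 0\<bar> powr \<beta>" using h unfolding holder_def by blast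
  also have "\<dots> \<le> H * gw \<beta> u" using h powr_le_gw[OF b, of u] by (intro mult_left_mono) (auto simp: holder_def)
  finally show ?thesis using h by (simp add: holder_def)
qed

lemma holder_continuous:
  assumes h: "holder \<beta> H f" and b: "0 < \<beta>" shows "continuous_on UNIV f"
  unfolding continuous_on_sequentially
proof safe
  fix x :: real and y :: "nat \<Rightarrow> real" assume y: "y \<longlonglongrightarrow> x"
  have "(\<lambda>n. \<bar>y n - x\<bar> powr \<beta>) \<longlonglongrightarrow> 0"
  proof (rule tendsto_zero_powrI[where b = \<beta>])
    show "(\<lambda>n. \<bar>y n - x\<bar>) \<longlonglongrightarrow> 0"
      using y by (simp add: tendsto_rabs_zero_iff LIM_zero_iff)
  qed (use b in auto)
  then have "(\<lambda>n. H * \<bar>y n - x\<bar> powr \<beta>) \<longlonglongrightarrow> 0" by (rule tendsto_mult_right_zero)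
  then have "(\<lambda>n. f (y n) - f x) \<longlonglongrightarrow> 0"
    by (rule Lim_null_comparison[rotated]) (use h in \<open>auto simp: holder_def intro!: eventuallyI\<close>)
  then show "(f \<circ> y) \<longlonglongrightarrow> f x" by (simp add: comp_def LIM_zero_iff)
qed

context wavelet_pair
begin

abbreviation S where "S \<equiv> phi.S"

text \<open>Level \<open>j\<close> is the basic step for \<open>u -> f (u / 2 ^ j)\<close> evaluated
  at \<open>2 ^ j * t\<close>, so the steps telescope.\<close>

lemma multiresolution_sum:
  assumes h: "holder \<beta> H f" and b: "0 < \<beta>"
  shows "proj \<phi> (\<lambda>u. of_real (f u)) t + (\<Sum>j<n. proj \<psi> (\<lambda>u. of_real (f (u / 2 ^ j))) (2 ^ j * t))
    = proj \<phi> (\<lambda>u. of_real (f (u / 2 ^ n))) (2 ^ n * t)"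
proof (induction n)
  case 0
  then show ?case by simp
next
  case (Suc n)
  let ?f = "\<lambda>u. f (u / 2 ^ n)"
  note hn = holder_scale[OF h, of n]
  have "proj \<phi> (\<lambda>u. of_real (?f u)) (2 ^ n * t) + proj \<psi> (\<lambda>u. of_real (?f u)) (2 ^ n * t)
      = proj \<phi> (\<lambda>u. of_real (?f (u / 2))) (2 * (2 ^ n * t))"
    by (rule step_even[OF holder_continuous[OF hn b] _ holder_growth[OF hn phi.\<beta>]])
       (use hn in \<open>simp add: holder_def\<close>)
  then show ?case unfolding sum.lessThan_Suc add.assoc[symmetric] Suc by (simp add: mult_ac)
qed

text \<open>At the finest level the rescaled function \<open>q\<close> has Hoelder constant
  \<open>H'\<close>. As constants are reproduced, the error at \<open>x\<close> is the projection of
  \<open>q - q x\<close>, which grows at most like \<open>H'\<close> times the weight centred at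
  \<open>x\<close>.\<close>

lemma multiresolution_error:
  assumes h: "holder \<beta> H f" and b: "0 < \<beta>"
  shows "norm (proj \<phi> (\<lambda>u. of_real (f u)) t + (\<Sum>j<n. proj \<psi> (\<lambda>u. of_real (f (u / 2 ^ j))) (2 ^ j * t)) - of_real (f t))
    \<le> H * 2 powr (- \<beta> * real n) * S * S"
proof -
  define H' where "H' = H * 2 powr (- \<beta> * real n)"
  define q where "q u = complex_of_real (f (u / 2 ^ n))" for u
  have hn: "holder \<beta> H' (\<lambda>u. f (u / 2 ^ n))" unfolding H'_def by (rule holder_scale[OF h])
  have mq: "q \<in> borel_measurable borel"
    unfolding q_def using borel_measurable_continuous_onI[OF holder_continuous[OF hn b]] by measurable
  define x where "x = 2 ^ n * t"
  have qx: "q x = of_real (f t)" by (simp add: q_def x_def)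
  have qb: "norm (q u) \<le> H' * gw \<beta> u" for u using holder_growth[OF hn phi.\<beta>, of u] by (simp add: q_def)
  have cb: "norm (- q x) \<le> norm (q x) * gw \<beta> u" for u
    using gw_ge_1[OF phi.\<beta>, of u] by (simp add: mult_le_cancel_left1)
  have loc: "norm (q u + - q x) \<le> H' * gw \<beta> (u - x)" for u
  proof -
    have "norm (q u + - q x) \<le> H' * \<bar>u - x\<bar> powr \<beta>"
      using hn unfolding q_def holder_def by (simp flip: of_real_diff)
    also have "\<dots> \<le> H' * gw \<beta> (u - x)"
      using hn powr_le_gw[OF phi.\<beta>] by (intro mult_left_mono) (auto simp: holder_def)
    finally show ?thesis .
  qed
  have "proj \<phi> q x - q x = proj \<phi> q x + proj \<phi> (\<lambda>_. - q x) x" by (simp add: proj_1)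
  also have "\<dots> = proj \<phi> (\<lambda>u. q u + - q x) x"
    by (rule phi.proj_add[OF mq qb _ cb, symmetric]) simp
  also have "norm \<dots> \<le> H' * S * S"
    by (rule phi.proj_local_bound[OF _ loc]) (use mq in measurable)
  finally have "norm (proj \<phi> q x - q x) \<le> H' * S * S" .
  then show ?thesis unfolding multiresolution_sum[OF h b] qx unfolding q_def x_def H'_def .
qed

lemma psi_coefficient_bound:
  assumes h: "holder \<beta> H f" and b: "0 < \<beta>"
  shows "norm (wcoef \<psi> (\<lambda>u. of_real (f (u / 2 ^ j))) k) \<le> H * 2 powr (- \<beta> * real j) * S"
proof -
  define H' where "H' = H * 2 powr (- \<beta> * real j)"
  define q where "q u = complex_of_real (f (u / 2 ^ j))" for u
  have hn: "holder \<beta> H' (\<lambda>u. f (u / 2 ^ j))" unfolding H'_def by (rule holder_scale[OF h])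
  have mq: "q \<in> borel_measurable borel"
    unfolding q_def using borel_measurable_continuous_onI[OF holder_continuous[OF hn b]] by measurable
  have qb: "norm (q u) \<le> H' * gw \<beta> u" for u using holder_growth[OF hn phi.\<beta>, of u] by (simp add: q_def)
  have cb: "norm (q (of_int k)) \<le> norm (q (of_int k)) * gw \<beta> u" for u
    using gw_ge_1[OF phi.\<beta>, of u] by (simp add: mult_le_cancel_left1)
  have loc: "norm (q (u + of_int k) - q (of_int k)) \<le> H' * gw \<beta> u" for u
  proof -
    have "norm (q (u + of_int k) - q (of_int k)) \<le> H' * \<bar>u + of_int k - of_int k\<bar> powr \<beta>"
      using hn unfolding q_def holder_def by (simp only: flip: of_real_diff) (simp only: norm_of_real)
    also have "\<dots> \<le> H' * gw \<beta> u"
      using hn powr_le_gw[OF phi.\<beta>] by (intro mult_left_mono) (auto simp: holder_def)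
    finally show ?thesis .
  qed
  have i1: "integrable lborel (\<lambda>u. q u * cnj (\<psi> (u - of_int k)))" by (rule psi.integrable_growth[OF mq qb])
  have i2: "integrable lborel (\<lambda>u. q (of_int k) * cnj (\<psi> (u - of_int k)))" by (rule psi.integrable_growth[OF _ cb]) simp
  \<comment> \<open>The integral of \<open>\<psi>\<close> is reached as the case of frequency 0,
    where the coefficient is a multiple of \<open>cnj (G 0)\<close>. This is why the value at
    \<open>k\<close> may be subtracted.\<close>
  have "(LINT u|lborel. q (of_int k) * cnj (\<psi> (u - of_int k))) = q (of_int k) * wcoef \<psi> (\<lambda>u. cis (0 * u)) k"
    by (simp add: wcoef_def)
  also have "\<dots> = 0" unfolding psi.wcoef_cis by (simp add: G_0)
  finally have "wcoef \<psi> q k = (LINT u|lborel. (q u - q (of_int k)) * cnj (\<psi> (u - of_int k)))"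
    unfolding wcoef_def left_diff_distrib by (simp add: i1 i2)
  also have "\<dots> = (LINT u|lborel. (q (u + of_int k) - q (of_int k)) * cnj (\<psi> (u - 0)))"
    using lborel_integral_real_affine[of 1 "\<lambda>u. (q u - q (of_int k)) * cnj (\<psi> (u - of_int k))" "of_int k"]
    by (simp add: add.commute)
  also have "norm \<dots> \<le> H' * gw \<beta> 0 * psi.S"
    by (rule psi.integral_growth[OF _ loc]) (use mq in measurable)
  finally show ?thesis by (simp add: q_def[abs_def] H'_def gw_def)
qed

lemma phi_coefficient_bound:
  assumes h: "holder \<beta> H f" and b: "0 < \<beta>"
  shows "norm (wcoef \<phi> (\<lambda>u. of_real (f u)) k) \<le> H * S * gw \<beta> (of_int k)"
proof (rule phi.wcoef_bound)
  show "(\<lambda>u. complex_of_real (f u)) \<in> borel_measurable borel"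
    using borel_measurable_continuous_onI[OF holder_continuous[OF h b]] by measurable
  show "norm (complex_of_real (f u)) \<le> H * gw \<beta> u" for u
    using holder_growth[OF h phi.\<beta>, of u] by simp
qed

end

section \<open>Truncation of lattice sums and the cell majorant\<close>

definition far :: "nat \<Rightarrow> int \<Rightarrow> real" where
  "far K = indicator (- {- int K..int K})"

lemma far_tendsto:
  fixes w :: "int \<Rightarrow> real"
  assumes "integrable IZ w"
  shows "(\<lambda>K. LINT k|IZ. far K k * w k) \<longlonglongrightarrow> 0"
proof -
  have "(\<lambda>K. LINT k|IZ. far K k * w k) \<longlonglongrightarrow> (LINT k|IZ. 0::real)"
  proof (rule integral_dominated_convergence[where w = "\<lambda>k. norm (w k)"])
    show "AE k in IZ. (\<lambda>K. far K k * w k) \<longlonglongrightarrow> 0"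
    proof (rule AE_I2)
      fix k :: int
      have "\<forall>\<^sub>F K in sequentially. far K k * w k = 0"
        using eventually_ge_at_top[of "nat \<bar>k\<bar>"] by eventually_elim (auto simp: far_def indicator_def)
      then show "(\<lambda>K. far K k * w k) \<longlonglongrightarrow> 0" by (rule tendsto_eventually)
    qed
  qed (use assms in \<open>auto simp: far_def indicator_def\<close>)
  then show ?thesis by simp
qed

lemma IZ_truncation_error:
  fixes f :: "int \<Rightarrow> complex"
  assumes "integrable IZ w" "\<And>k. norm (f k) \<le> w k"
  shows "norm ((LINT k|IZ. f k) - (\<Sum>k\<in>{- int K..int K}. f k)) \<le> (LINT k|IZ. far K k * w k)"
proof -
  let ?A = "{- int K..int K}"
  have i: "integrable IZ f"
    by (rule Bochner_Integration.integrable_bound[OF assms(1)]) (use assms(2) in \<open>auto intro!: AE_I2 intro: order_trans[OF _ abs_ge_self]\<close>)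
  have iA: "integrable IZ (\<lambda>k. indicator ?A k *\<^sub>R f k)" and iB: "integrable IZ (\<lambda>k. indicator (- ?A) k *\<^sub>R f k)"
    using i by (auto intro!: integrable_mult_indicator)
  have fs: "finite {k. indicator ?A k *\<^sub>R f k \<noteq> 0}"
    by (rule finite_subset[of _ ?A]) (auto simp: indicator_def)
  have "(LINT k|IZ. indicator ?A k *\<^sub>R f k) = (\<Sum>k | indicator ?A k *\<^sub>R f k \<noteq> 0. indicator ?A k *\<^sub>R f k)"
    using lebesgue_integral_count_space_finite_support[of UNIV "\<lambda>k. indicator ?A k *\<^sub>R f k"] fs by simp
  also have "\<dots> = (\<Sum>k\<in>?A. indicator ?A k *\<^sub>R f k)"
    by (rule sum.mono_neutral_left) (auto simp: indicator_def)
  also have "\<dots> = (\<Sum>k\<in>?A. f k)" by (intro sum.cong) auto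
  finally have sA: "(LINT k|IZ. indicator ?A k *\<^sub>R f k) = (\<Sum>k\<in>?A. f k)" .
  have "f k = indicator ?A k *\<^sub>R f k + indicator (- ?A) k *\<^sub>R f k" for k by (auto simp: indicator_def)
  then have "(LINT k|IZ. f k) = (LINT k|IZ. indicator ?A k *\<^sub>R f k + indicator (- ?A) k *\<^sub>R f k)" by simp
  also have "\<dots> = (\<Sum>k\<in>?A. f k) + (LINT k|IZ. indicator (- ?A) k *\<^sub>R f k)"
    using iA iB sA by simp
  finally have "(LINT k|IZ. f k) - (\<Sum>k\<in>?A. f k) = (LINT k|IZ. indicator (- ?A) k *\<^sub>R f k)" by simp
  also have "norm \<dots> \<le> (LINT k|IZ. far K k * w k)"
  proof (rule integral_norm_le[OF iB])
    show "integrable IZ (\<lambda>k. far K k * w k)"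
      unfolding far_def using integrable_mult_indicator[of "- ?A" IZ w] assms(1) by simp
    show "norm (indicator (- ?A) k *\<^sub>R f k) \<le> far K k * w k" for k
      using assms(2)[of k] by (auto simp: far_def indicator_def)
  qed
  finally show ?thesis .
qed

text \<open>The majorant \<open>\<Phi>\<close> controls suprema over unit cells because it is monotone.\<close>

lemma cell_majorant:
  fixes \<Phi> c :: "real \<Rightarrow> real"
  assumes \<beta>: "0 \<le> \<beta>"
    and \<Phi>0: "\<And>x. 0 \<le> x \<Longrightarrow> 0 \<le> \<Phi> x" and anti: "antimono_on {0..} \<Phi>"
    and c0: "0 < c 0" and cev: "\<And>x. c (- x) = c x" and cmono: "mono_on {0..} c" and cb: "\<And>x. \<bar>x\<bar> powr \<beta> \<le> c x"
    and int: "integrable lborel (\<lambda>x. c x * \<Phi> \<bar>x\<bar>)"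
  shows "integrable IZ (\<lambda>l. gw \<beta> (of_int (\<bar>l\<bar> + 1)) * \<Phi> (max 0 (of_int \<bar>l\<bar> - 2)))" (is "integrable IZ ?w")
proof -
  \<comment> \<open>The 5 covers the gap between \<open>|l| + 1\<close> and \<open>|y|\<close> when
    \<open>|l| - 4 \<le> |y|\<close>. The factor \<open>2 powr \<beta>\<close> compares
    \<open>1 + |y|\<close> with \<open>2 * max 1 |y|\<close>; for small \<open>y\<close> the weight
    is then compared with \<open>c y \<ge> c 0\<close>, for large \<open>y\<close> with
    \<open>c y \<ge> |y| powr \<beta>\<close>.\<close>
  define C where "C = (max (1 / c 0) 1) * gw \<beta> 5 * 2 powr \<beta>"
  have gwc: "gw \<beta> (of_int (\<bar>l\<bar> + 1)) \<le> C * c y" if "of_int \<bar>l\<bar> - 4 \<le> \<bar>y\<bar>" for l :: int and y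
  proof -
    have "\<bar>of_int (\<bar>l\<bar> + 1)\<bar> \<le> \<bar>\<bar>y\<bar> + 5\<bar>" using that by simp
    then have "gw \<beta> (of_int (\<bar>l\<bar> + 1)) \<le> gw \<beta> (\<bar>y\<bar> + 5)" by (rule gw_mono[OF \<beta>])
    also have "\<dots> \<le> gw \<beta> \<bar>y\<bar> * gw \<beta> 5" by (rule gw_submult[OF \<beta>])
    also have "gw \<beta> \<bar>y\<bar> \<le> max (1 / c 0) 1 * 2 powr \<beta> * c y"
    proof (cases "\<bar>y\<bar> \<le> 1")
      case True
      have "c 0 \<le> c y"
      proof -
        have "c \<bar>y\<bar> = c y" using cev by (simp add: abs_if)
        moreover have "c 0 \<le> c \<bar>y\<bar>" by (rule monotone_onD[OF cmono]) auto
        ultimately show ?thesis by simp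
      qed
      then have "1 \<le> 1 / c 0 * c y" using c0 by simp
      also have "\<dots> \<le> max (1 / c 0) 1 * c y" using c0 \<open>c 0 \<le> c y\<close> by (intro mult_right_mono) auto
      finally have 1: "1 \<le> max (1 / c 0) 1 * c y" .
      have "gw \<beta> \<bar>y\<bar> \<le> 2 powr \<beta>" unfolding gw_def using True \<beta> by (intro powr_mono2) auto
      also have "\<dots> \<le> 2 powr \<beta> * (max (1 / c 0) 1 * c y)" using 1 by (simp add: mult_le_cancel_left1)
      finally show ?thesis by (simp add: mult_ac)
    next
      case False
      have "gw \<beta> \<bar>y\<bar> \<le> (2 * \<bar>y\<bar>) powr \<beta>" unfolding gw_def using False \<beta> by (intro powr_mono2) auto
      also have "\<dots> = 2 powr \<beta> * \<bar>y\<bar> powr \<beta>" by (simp add: powr_mult)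
      also have "\<dots> \<le> 2 powr \<beta> * (max (1 / c 0) 1 * c y)"
      proof (rule mult_left_mono)
        have "0 \<le> c y" using cb[of y] by (meson order_trans powr_ge_zero)
        then have "1 * c y \<le> max (1 / c 0) 1 * c y" by (intro mult_right_mono) auto
        then show "\<bar>y\<bar> powr \<beta> \<le> max (1 / c 0) 1 * c y" using cb[of y] by simp
      qed simp
      finally show ?thesis by (simp add: mult_ac)
    qed
    then have "gw \<beta> \<bar>y\<bar> * gw \<beta> 5 \<le> max (1 / c 0) 1 * 2 powr \<beta> * c y * gw \<beta> 5" by (rule mult_right_mono) simp
    finally show ?thesis unfolding C_def by (simp add: mult_ac)
  qed
  have cpos: "0 \<le> c y" for y using cb[of y] by (meson order_trans powr_ge_zero)
  have C0: "0 \<le> C" unfolding C_def by simp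
  define h where "h y = c y * \<Phi> \<bar>y\<bar>" for y
  have h0: "0 \<le> h y" for y unfolding h_def using cpos \<Phi>0 by simp
  have ih: "integrable lborel h" using int by (simp add: h_def[abs_def])
  define I where "I k = (LINT y|lborel. indicator {of_int k - 1/2..<of_int k + 1/2} y *\<^sub>R h y)" for k :: int
  have iI: "integrable IZ I" unfolding I_def by (rule cell_decomposition(1)[OF ih])
  have I0: "0 \<le> I k" for k unfolding I_def by (rule integral_nonneg_AE) (use h0 in auto)
  have w0: "0 \<le> ?w l" for l by (simp add: \<Phi>0)
  \<comment> \<open>The weight at \<open>l\<close> is compared with the integral over a unit cell
    three steps nearer to the origin. There \<open>|y| \<le> |l| - 5/2\<close>, so monotonicity
    gives \<open>\<Phi> (|l| - 2) \<le> \<Phi> |y|\<close>; the bound 4 keeps the cell on the same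
    side of 0.\<close>
  have far: "?w l \<le> C * I (if l > 0 then l - 3 else l + 3)" if l: "\<bar>l\<bar> \<ge> 4" for l
  proof -
    define k where "k = (if l > 0 then l - 3 else l + 3)"
    have near: "of_int \<bar>l\<bar> - 7/2 \<le> \<bar>y\<bar>" "\<bar>y\<bar> \<le> of_int \<bar>l\<bar> - 5/2" if "y \<in> {of_int k - 1/2..<of_int k + 1/2}" for y :: real
      using that l unfolding k_def by (auto split: if_splits)
    let ?J = "{of_int k - 1/2..<of_int k + 1/2 :: real}"
    have pt: "?w l \<le> C * h y" if y: "y \<in> ?J" for y
    proof -
      have "\<Phi> (max 0 (of_int \<bar>l\<bar> - 2)) \<le> \<Phi> \<bar>y\<bar>"
        by (rule monotone_onD[OF anti]) (use near[OF y] in auto)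
      moreover have "gw \<beta> (of_int (\<bar>l\<bar> + 1)) \<le> C * c y" by (rule gwc) (use near[OF y] in auto)
      ultimately have "?w l \<le> C * c y * \<Phi> \<bar>y\<bar>"
        by (intro mult_mono) (use C0 cpos \<Phi>0 in auto)
      then show ?thesis by (simp add: h_def mult.assoc)
    qed
    have "?w l = (LINT y|lborel. indicator ?J y *\<^sub>R ?w l)" by simp
    also have "\<dots> \<le> (LINT y|lborel. indicator ?J y *\<^sub>R (C * h y))"
    proof (rule integral_mono)
      have "integrable lborel (indicator ?J :: real \<Rightarrow> real)" by (rule integrable_real_indicator) auto
      then show "integrable lborel (\<lambda>y. indicator ?J y *\<^sub>R ?w l)" by (intro integrable_scaleR_left)
      show "integrable lborel (\<lambda>y. indicator ?J y *\<^sub>R (C * h y))"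
        by (intro integrable_mult_indicator integrable_mult_right ih) simp
      show "indicator ?J y *\<^sub>R ?w l \<le> indicator ?J y *\<^sub>R (C * h y)" for y
        using pt[of y] by (cases "y \<in> ?J") auto
    qed
    also have "\<dots> = (LINT y|lborel. C * (indicator ?J y *\<^sub>R h y))" by (simp add: mult_ac)
    also have "\<dots> = C * I k" unfolding I_def by simp
    finally show ?thesis by (simp add: k_def)
  qed
  \<comment> \<open>The direction of the shift depends on the sign of \<open>l\<close>, so both
    shifts are included; the seven indices with \<open>|l| \<le> 3\<close> are added one by
    one.\<close>
  define B where "B l = C * I (- 3 + l) + C * I (3 + l) + (\<Sum>k\<in>{-3..3}. if l = k then ?w k else 0)" for l
  have single: "integrable IZ (\<lambda>l. if l = k then ?w k else 0)" for k
    by (rule IZ_single(1)[of k]) simp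
  have "integrable IZ (\<lambda>l. I (- 3 + l))" "integrable IZ (\<lambda>l. I (3 + l))"
    using iI IZ_shift(3)[of I "-3"] IZ_shift(3)[of I 3] by simp_all
  then have iB: "integrable IZ B"
    unfolding B_def
    by (intro Bochner_Integration.integrable_add integrable_mult_right Bochner_Integration.integrable_sum single)
  have le: "?w l \<le> B l" for l
  proof (cases "\<bar>l\<bar> \<ge> 4")
    case True
    have "0 \<le> C * I (- 3 + l)" "0 \<le> C * I (3 + l)" using C0 I0 by simp_all
    moreover have "0 \<le> (\<Sum>k\<in>{-3..3}. if l = k then ?w k else 0)" by (intro sum_nonneg) (simp add: \<Phi>0)
    moreover have "?w l \<le> C * I (- 3 + l) \<or> ?w l \<le> C * I (3 + l)"
    proof (cases "0 < l")
      case True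
      then have "l - 3 = - 3 + l" by simp
      then show ?thesis using far[OF \<open>\<bar>l\<bar> \<ge> 4\<close>] True by metis
    next
      case False
      have "l + 3 = 3 + l" by simp
      then show ?thesis using far[OF \<open>\<bar>l\<bar> \<ge> 4\<close>] False by metis
    qed
    ultimately show ?thesis unfolding B_def by linarith
  next
    case False
    then have "l \<in> {-3..3}" by auto
    then have "(\<Sum>k\<in>{-3..3}. if l = k then ?w k else 0) = ?w l" by (subst sum.delta') auto
    then show ?thesis unfolding B_def using C0 I0 by simp
  qed
  show ?thesis
  proof (rule Bochner_Integration.integrable_bound[OF iB])
    show "AE l in IZ. norm (?w l) \<le> norm (B l)"
    proof (rule AE_I2)
      fix l
      have "norm (?w l) = ?w l" using w0[of l] by (rule real_norm_def[THEN trans, OF abs_of_nonneg])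
      also have "\<dots> \<le> norm (B l)" using le[of l] by simp
      finally show "norm (?w l) \<le> norm (B l)" .
    qed
  qed simp
qed

text \<open>The bound by \<open>\<Phi>\<close> holds almost everywhere; continuity extends it to
  every \<open>x\<close> through nearby points, at the cost of one unit in the argument. A second
  unit is lost in passing from \<open>x\<close> to its floor, whence the 2 in the cell
  weight.\<close>

lemma amalgam_of_majorant:
  fixes \<Phi> c :: "real \<Rightarrow> real" and g :: "real \<Rightarrow> complex"
  assumes \<beta>: "0 \<le> \<beta>"
    and \<Phi>0: "\<And>x. 0 \<le> x \<Longrightarrow> 0 \<le> \<Phi> x" and anti: "antimono_on {0..} \<Phi>"
    and int: "integrable IZ (\<lambda>l. gw \<beta> (of_int (\<bar>l\<bar> + 1)) * \<Phi> (max 0 (of_int \<bar>l\<bar> - 2)))"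
    and cont: "continuous_on UNIV g" and ae: "AE x in lborel. cmod (g x) \<le> \<Phi> \<bar>x\<bar>"
  shows "amalgam \<beta> (\<lambda>l. gw \<beta> (of_int (\<bar>l\<bar> + 1)) * \<Phi> (max 0 (of_int \<bar>l\<bar> - 2))) g"
proof
  fix x :: real
  have gx: "cmod (g x) \<le> \<Phi> (max 0 (\<bar>x\<bar> - 1))"
  proof -
    obtain y where y: "\<And>n. x < y n" "\<And>n. y n < x + 1 / real (Suc n)" "\<And>n. cmod (g (y n)) \<le> \<Phi> \<bar>y n\<bar>"
      and lim: "y \<longlonglongrightarrow> x"
      by (rule AE_lborel_sequence[OF ae, of x]) blast
    have "isCont g x" using cont by (simp add: continuous_on_eq_continuous_at)
    from isCont_tendsto_compose[OF this lim]
    have "(\<lambda>n. cmod (g (y n))) \<longlonglongrightarrow> cmod (g x)" by (rule tendsto_norm)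
    moreover have "cmod (g (y n)) \<le> \<Phi> (max 0 (\<bar>x\<bar> - 1))" for n
    proof -
      have "1 / real (Suc n) \<le> 1" by simp
      then have "\<bar>x\<bar> - 1 \<le> \<bar>y n\<bar>" using y(1)[of n] y(2)[of n] by linarith
      then have "\<Phi> \<bar>y n\<bar> \<le> \<Phi> (max 0 (\<bar>x\<bar> - 1))" by (intro monotone_onD[OF anti]) auto
      then show ?thesis using y(3)[of n] by simp
    qed
    ultimately show ?thesis by (intro LIMSEQ_le_const2) auto
  qed
  have ab: "of_int \<bar>\<lfloor>x\<rfloor>\<bar> - 2 \<le> \<bar>x\<bar> - 1" "\<bar>x\<bar> \<le> of_int (\<bar>\<lfloor>x\<rfloor>\<bar> + 1)"
    unfolding of_int_abs of_int_add
    using of_int_floor_le[of x] real_of_int_floor_add_one_gt[of x] by linarith+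
  have "\<Phi> (max 0 (\<bar>x\<bar> - 1)) \<le> \<Phi> (max 0 (of_int \<bar>\<lfloor>x\<rfloor>\<bar> - 2))"
    by (rule monotone_onD[OF anti]) (use ab in auto)
  with gx have "cmod (g x) \<le> \<Phi> (max 0 (of_int \<bar>\<lfloor>x\<rfloor>\<bar> - 2))" by simp
  moreover have "gw \<beta> x \<le> gw \<beta> (of_int (\<bar>\<lfloor>x\<rfloor>\<bar> + 1))" by (rule gw_mono[OF \<beta>]) (use ab in auto)
  ultimately show "gw \<beta> x * cmod (g x) \<le> gw \<beta> (of_int (\<bar>\<lfloor>x\<rfloor>\<bar> + 1)) * \<Phi> (max 0 (of_int \<bar>\<lfloor>x\<rfloor>\<bar> - 2))"
    by (intro mult_mono) auto
qed (use assms in auto)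

subsection \<open>Square integrable random variables\<close>

definition sq_int :: "'a measure \<Rightarrow> ('a \<Rightarrow> 'b :: {banach, second_countable_topology}) \<Rightarrow> bool" where
  "sq_int M Y \<longleftrightarrow> Y \<in> borel_measurable M \<and> integrable M (\<lambda>\<omega>. (norm (Y \<omega>))\<^sup>2)"

definition E2 :: "'a measure \<Rightarrow> ('a \<Rightarrow> 'b :: {banach, second_countable_topology}) \<Rightarrow> real" where
  "E2 M Y = (LINT \<omega>|M. (norm (Y \<omega>))\<^sup>2)"

lemma sq_intD [dest]: "sq_int M Y \<Longrightarrow> Y \<in> borel_measurable M" "sq_int M Y \<Longrightarrow> integrable M (\<lambda>\<omega>. (norm (Y \<omega>))\<^sup>2)"
  by (auto simp: sq_int_def)

lemma E2_nonneg: "0 \<le> E2 M Y"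
  unfolding E2_def by (rule integral_nonneg_AE) simp

lemma sum_square_bound: "(a + b)\<^sup>2 \<le> 2 * a\<^sup>2 + 2 * (b::real)\<^sup>2"
  using sum_squares_bound[of a b] by (simp add: power2_sum)

lemma norm_add_square: "(norm (x + y))\<^sup>2 \<le> 2 * (norm x)\<^sup>2 + 2 * (norm (y :: 'b :: real_normed_vector))\<^sup>2"
proof -
  have "(norm (x + y))\<^sup>2 \<le> (norm x + norm y)\<^sup>2" by (intro power_mono norm_triangle_ineq) simp
  then show ?thesis using sum_square_bound order_trans by blast
qed

lemma sq_int_add:
  assumes "sq_int M X" "sq_int M Y"
  shows "sq_int M (\<lambda>\<omega>. X \<omega> + Y \<omega>)" and "E2 M (\<lambda>\<omega>. X \<omega> + Y \<omega>) \<le> 2 * E2 M X + 2 * E2 M Y"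
proof -
  have i: "integrable M (\<lambda>\<omega>. 2 * (norm (X \<omega>))\<^sup>2 + 2 * (norm (Y \<omega>))\<^sup>2)"
    using assms by (intro Bochner_Integration.integrable_add integrable_mult_right) auto
  have m: "(\<lambda>\<omega>. X \<omega> + Y \<omega>) \<in> borel_measurable M" using assms by (intro borel_measurable_add) auto
  have i2: "integrable M (\<lambda>\<omega>. (norm (X \<omega> + Y \<omega>))\<^sup>2)"
  proof (rule Bochner_Integration.integrable_bound[OF i])
    show "AE \<omega> in M. norm ((norm (X \<omega> + Y \<omega>))\<^sup>2) \<le> norm (2 * (norm (X \<omega>))\<^sup>2 + 2 * (norm (Y \<omega>))\<^sup>2)"
      using norm_add_square by (intro AE_I2) simp
  qed (use m in measurable)
  then show "sq_int M (\<lambda>\<omega>. X \<omega> + Y \<omega>)" using m by (simp add: sq_int_def)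
  have "E2 M (\<lambda>\<omega>. X \<omega> + Y \<omega>) \<le> (LINT \<omega>|M. 2 * (norm (X \<omega>))\<^sup>2 + 2 * (norm (Y \<omega>))\<^sup>2)"
    unfolding E2_def by (rule integral_mono[OF i2 i]) (rule norm_add_square)
  also have "\<dots> = 2 * E2 M X + 2 * E2 M Y"
    unfolding E2_def using assms by (subst Bochner_Integration.integral_add) (auto simp: sq_int_def)
  finally show "E2 M (\<lambda>\<omega>. X \<omega> + Y \<omega>) \<le> 2 * E2 M X + 2 * E2 M Y" .
qed

lemma sq_int_minus: "sq_int M X \<Longrightarrow> sq_int M (\<lambda>\<omega>. - X \<omega>)"
  by (auto simp: sq_int_def)

lemma E2_minus: "E2 M (\<lambda>\<omega>. X \<omega> - Y \<omega>) = E2 M (\<lambda>\<omega>. Y \<omega> - X \<omega>)"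
  by (simp add: E2_def norm_minus_commute)

lemma sq_int_diff:
  assumes "sq_int M X" "sq_int M Y"
  shows "sq_int M (\<lambda>\<omega>. X \<omega> - Y \<omega>)" and "E2 M (\<lambda>\<omega>. X \<omega> - Y \<omega>) \<le> 2 * E2 M X + 2 * E2 M Y"
  using sq_int_add[OF assms(1) sq_int_minus[OF assms(2)]] by (simp_all add: E2_def)

lemma sq_int_scale:
  fixes X :: "'a \<Rightarrow> 'b :: {banach, second_countable_topology, real_normed_div_algebra}"
  shows "sq_int M X \<Longrightarrow> sq_int M (\<lambda>\<omega>. c * X \<omega>)" "E2 M (\<lambda>\<omega>. c * X \<omega>) = (norm c)\<^sup>2 * E2 M X"
  by (auto simp: sq_int_def E2_def norm_mult power_mult_distrib)

lemma sq_int_sum: "(\<And>i. i \<in> I \<Longrightarrow> sq_int M (X i)) \<Longrightarrow> sq_int M (\<lambda>\<omega>. \<Sum>i\<in>I. X i \<omega>)"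
proof (induction I rule: infinite_finite_induct)
  case (insert i I)
  then show ?case using sq_int_add(1)[of M "X i" "\<lambda>\<omega>. \<Sum>i\<in>I. X i \<omega>"] by simp
qed (simp_all add: sq_int_def)

lemma sq_int_of_real: "sq_int M a \<Longrightarrow> sq_int M (\<lambda>\<omega>. complex_of_real (a \<omega>))"
  by (auto simp: sq_int_def)

lemma sq_int_Re_Im:
  fixes Y :: "'a \<Rightarrow> complex"
  assumes "sq_int M Y"
  shows "sq_int M (\<lambda>\<omega>. Re (Y \<omega>))" "sq_int M (\<lambda>\<omega>. Im (Y \<omega>))"
    and "E2 M Y = E2 M (\<lambda>\<omega>. Re (Y \<omega>)) + E2 M (\<lambda>\<omega>. Im (Y \<omega>))"
proof -
  have m [measurable]: "Y \<in> borel_measurable M" and i: "integrable M (\<lambda>\<omega>. (norm (Y \<omega>))\<^sup>2)" using assms by auto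
  have iR: "integrable M (\<lambda>\<omega>. (Re (Y \<omega>))\<^sup>2)"
    by (rule Bochner_Integration.integrable_bound[OF i]) (auto simp: cmod_power2)
  have iI: "integrable M (\<lambda>\<omega>. (Im (Y \<omega>))\<^sup>2)"
    by (rule Bochner_Integration.integrable_bound[OF i]) (auto simp: cmod_power2)
  show "sq_int M (\<lambda>\<omega>. Re (Y \<omega>))" "sq_int M (\<lambda>\<omega>. Im (Y \<omega>))" using iR iI by (auto simp: sq_int_def)
  show "E2 M Y = E2 M (\<lambda>\<omega>. Re (Y \<omega>)) + E2 M (\<lambda>\<omega>. Im (Y \<omega>))"
    using iR iI by (simp add: E2_def cmod_power2)
qed

abbreviation pairing :: "'a measure \<Rightarrow> ('a \<Rightarrow> complex) \<Rightarrow> ('a \<Rightarrow> real) \<Rightarrow> complex" where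
  "pairing M Y a \<equiv> LINT \<omega>|M. Y \<omega> * of_real (a \<omega>)"

lemma sq_int_mult:
  fixes X :: "'a \<Rightarrow> complex" and a :: "'a \<Rightarrow> real"
  assumes "sq_int M X" "sq_int M a"
  shows "integrable M (\<lambda>\<omega>. X \<omega> * of_real (a \<omega>))"
    and "cmod (pairing M X a) \<le> sqrt (E2 M X) * sqrt (E2 M a)"
proof -
  have m [measurable]: "X \<in> borel_measurable M" "a \<in> borel_measurable M" using assms by auto
  have iX: "integrable M (\<lambda>\<omega>. (cmod (X \<omega>))\<^sup>2)" and ia: "integrable M (\<lambda>\<omega>. (a \<omega>)\<^sup>2)"
    using assms by (auto simp: sq_int_def)
  show i: "integrable M (\<lambda>\<omega>. X \<omega> * of_real (a \<omega>))"
  proof (rule Bochner_Integration.integrable_bound)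
    show "integrable M (\<lambda>\<omega>. (cmod (X \<omega>))\<^sup>2 + (a \<omega>)\<^sup>2)" by (intro Bochner_Integration.integrable_add iX ia)
    show "AE \<omega> in M. norm (X \<omega> * of_real (a \<omega>)) \<le> norm ((cmod (X \<omega>))\<^sup>2 + (a \<omega>)\<^sup>2)"
    proof (rule AE_I2)
      fix \<omega>
      have "2 * (cmod (X \<omega>) * \<bar>a \<omega>\<bar>) \<le> (cmod (X \<omega>))\<^sup>2 + (a \<omega>)\<^sup>2"
        using sum_squares_bound[of "cmod (X \<omega>)" "\<bar>a \<omega>\<bar>"] by (simp only: mult.assoc power2_abs)
      moreover have "0 \<le> cmod (X \<omega>) * \<bar>a \<omega>\<bar>" by simp
      ultimately have "cmod (X \<omega>) * \<bar>a \<omega>\<bar> \<le> (cmod (X \<omega>))\<^sup>2 + (a \<omega>)\<^sup>2" by linarith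
      then show "norm (X \<omega> * of_real (a \<omega>)) \<le> norm ((cmod (X \<omega>))\<^sup>2 + (a \<omega>)\<^sup>2)" by (simp add: norm_mult)
    qed
  qed measurable
  define A where "A = E2 M X"
  define B where "B = (LINT \<omega>|M. cmod (X \<omega>) * \<bar>a \<omega>\<bar>)"
  define C where "C = E2 M a"
  have iB: "integrable M (\<lambda>\<omega>. cmod (X \<omega>) * \<bar>a \<omega>\<bar>)" using integrable_norm[OF i] by (simp add: norm_mult)
  \<comment> \<open>Cauchy-Schwarz by a quadratic: \<open>t = B / C\<close> is its minimizer, and
    for \<open>C = 0\<close> the value \<open>-1\<close> at \<open>t = (A + 1) / (2 * B)\<close>
    excludes \<open>B \<noteq> 0\<close>.\<close>
  have quad: "0 \<le> A - 2 * t * B + t\<^sup>2 * C" for t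
  proof -
    have "0 \<le> (LINT \<omega>|M. (cmod (X \<omega>) - t * \<bar>a \<omega>\<bar>)\<^sup>2)" by (rule integral_nonneg_AE) simp
    also have "\<dots> = (LINT \<omega>|M. (cmod (X \<omega>))\<^sup>2 - 2 * t * (cmod (X \<omega>) * \<bar>a \<omega>\<bar>) + t\<^sup>2 * (a \<omega>)\<^sup>2)"
      by (intro Bochner_Integration.integral_cong) (auto simp: power2_diff power_mult_distrib)
    also have "\<dots> = A - 2 * t * B + t\<^sup>2 * C"
      unfolding A_def B_def C_def E2_def using iX ia iB by simp
    finally show ?thesis .
  qed
  have B0: "0 \<le> B" unfolding B_def by (rule integral_nonneg_AE) simp
  have C0: "0 \<le> C" "0 \<le> A" unfolding C_def A_def by (rule E2_nonneg)+
  have "B\<^sup>2 \<le> A * C"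
  proof (cases "C = 0")
    case True
    have "B = 0"
    proof (rule ccontr)
      assume "B \<noteq> 0"
      then show False using quad[of "(A + 1) / (2 * B)"] True by simp
    qed
    then show ?thesis using True by simp
  next
    case False
    then show ?thesis using quad[of "B / C"] C0 by (simp add: field_simps power2_eq_square)
  qed
  then have "B \<le> sqrt (A * C)" using B0 by (simp add: real_le_rsqrt)
  moreover have "cmod (pairing M X a) \<le> B"
    unfolding B_def by (rule integral_norm_le[OF i iB]) (simp add: norm_mult)
  ultimately show "cmod (pairing M X a) \<le> sqrt (E2 M X) * sqrt (E2 M a)"
    by (simp add: A_def C_def real_sqrt_mult)
qed

text \<open>Test variables are real, so \<open>Y\<close> is tested against its real and its
  imaginary part separately. Each contributes \<open>D\<^sup>2\<close>, which explains the factor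
  2.\<close>

lemma sq_int_duality:
  fixes Y :: "'a \<Rightarrow> complex"
  assumes Y: "sq_int M Y" and D: "0 \<le> D"
    and d: "\<And>a :: 'a \<Rightarrow> real. sq_int M a \<Longrightarrow> cmod (pairing M Y a) \<le> D * sqrt (E2 M a)"
  shows "E2 M Y \<le> 2 * D\<^sup>2"
proof -
  note ri = sq_int_Re_Im[OF Y]
  have half: "E2 M a \<le> D\<^sup>2" if a: "sq_int M a" and e: "E2 M a \<le> cmod (pairing M Y a)" for a :: "'a \<Rightarrow> real"
  proof (cases "E2 M a = 0")
    case True
    then show ?thesis by simp
  next
    case False
    then have pos: "0 < sqrt (E2 M a)" using E2_nonneg[of M a] by simp
    have "sqrt (E2 M a) * sqrt (E2 M a) \<le> D * sqrt (E2 M a)"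
      using e d[OF a] E2_nonneg[of M a] by simp
    then have "sqrt (E2 M a) \<le> D" using pos by (rule mult_right_le_imp_le)
    then show ?thesis using E2_nonneg[of M a] by (simp add: sqrt_le_D)
  qed
  have "E2 M (\<lambda>\<omega>. Re (Y \<omega>)) \<le> D\<^sup>2"
  proof (rule half[OF ri(1)])
    have "Re (LINT \<omega>|M. Y \<omega> * of_real (Re (Y \<omega>))) = (LINT \<omega>|M. Re (Y \<omega> * of_real (Re (Y \<omega>))))"
      by (rule integral_Re[symmetric]) (rule sq_int_mult(1)[OF Y ri(1)])
    also have "\<dots> = E2 M (\<lambda>\<omega>. Re (Y \<omega>))" by (simp add: E2_def power2_eq_square)
    finally show "E2 M (\<lambda>\<omega>. Re (Y \<omega>)) \<le> cmod (LINT \<omega>|M. Y \<omega> * of_real (Re (Y \<omega>)))"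
      using complex_Re_le_cmod by metis
  qed
  moreover have "E2 M (\<lambda>\<omega>. Im (Y \<omega>)) \<le> D\<^sup>2"
  proof (rule half[OF ri(2)])
    have "Im (LINT \<omega>|M. Y \<omega> * of_real (Im (Y \<omega>))) = (LINT \<omega>|M. Im (Y \<omega> * of_real (Im (Y \<omega>))))"
      by (rule integral_Im[symmetric]) (rule sq_int_mult(1)[OF Y ri(2)])
    also have "\<dots> = E2 M (\<lambda>\<omega>. Im (Y \<omega>))" by (simp add: E2_def power2_eq_square)
    finally show "E2 M (\<lambda>\<omega>. Im (Y \<omega>)) \<le> cmod (LINT \<omega>|M. Y \<omega> * of_real (Im (Y \<omega>)))"
      using abs_Im_le_cmod abs_ge_self order_trans by metis
  qed
  ultimately show ?thesis using ri(3) by simp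
qed

lemma sq_int_tendsto:
  fixes Y :: "nat \<Rightarrow> 'a \<Rightarrow> complex" and a :: "'a \<Rightarrow> real"
  assumes Y: "\<And>n. sq_int M (Y n)" and Z: "sq_int M Z" and a: "sq_int M a"
    and l: "(\<lambda>n. E2 M (\<lambda>\<omega>. Y n \<omega> - Z \<omega>)) \<longlonglongrightarrow> 0"
  shows "(\<lambda>n. LINT \<omega>|M. Y n \<omega> * of_real (a \<omega>)) \<longlonglongrightarrow> pairing M Z a"
proof -
  have "(\<lambda>n. sqrt (E2 M (\<lambda>\<omega>. Y n \<omega> - Z \<omega>)) * sqrt (E2 M a)) \<longlonglongrightarrow> sqrt 0 * sqrt (E2 M a)"
    by (intro tendsto_mult tendsto_real_sqrt l tendsto_const)
  then have "(\<lambda>n. sqrt (E2 M (\<lambda>\<omega>. Y n \<omega> - Z \<omega>)) * sqrt (E2 M a)) \<longlonglongrightarrow> 0" by simp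
  moreover have "norm (pairing M (Y n) a - pairing M Z a)
      \<le> sqrt (E2 M (\<lambda>\<omega>. Y n \<omega> - Z \<omega>)) * sqrt (E2 M a)" for n
    using sq_int_mult(2)[OF sq_int_diff(1)[OF Y[of n] Z] a] sq_int_mult(1)[OF Y[of n] a] sq_int_mult(1)[OF Z a]
    by (simp add: left_diff_distrib)
  ultimately have "(\<lambda>n. pairing M (Y n) a - pairing M Z a) \<longlonglongrightarrow> 0"
    by (rule Lim_null_comparison[OF always_eventually[OF allI], rotated])
  then show ?thesis by (simp add: LIM_zero_iff)
qed

lemma ms_dist_E2: "sq_int M (\<lambda>\<omega>. Y \<omega> - Z \<omega>) \<Longrightarrow> ms_dist M Y Z = ennreal (E2 M (\<lambda>\<omega>. Y \<omega> - Z \<omega>))"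
  unfolding ms_dist_def E2_def by (intro nn_integral_eq_integral) auto

lemma sq_int_of_ms_dist:
  assumes Y: "sq_int M Y" and Z: "Z \<in> borel_measurable M" and f: "ms_dist M Y Z < \<infinity>"
  shows "sq_int M Z"
proof -
  have "sq_int M (\<lambda>\<omega>. Y \<omega> - Z \<omega>)"
    unfolding sq_int_def
  proof
    show m: "(\<lambda>\<omega>. Y \<omega> - Z \<omega>) \<in> borel_measurable M" using Y Z by (intro borel_measurable_diff) auto
    show "integrable M (\<lambda>\<omega>. (cmod (Y \<omega> - Z \<omega>))\<^sup>2)"
      unfolding integrable_iff_bounded using f m unfolding ms_dist_def by simp
  qed
  from sq_int_diff(1)[OF Y this] show ?thesis by simp
qed

lemma L2_Fatou:
  fixes Y :: "nat \<Rightarrow> 'a \<Rightarrow> complex"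
  assumes Y: "\<And>n. sq_int M (Y n)" and Z: "Z \<in> borel_measurable M"
    and ae: "AE \<omega> in M. (\<lambda>n. Y n \<omega>) \<longlonglongrightarrow> Z \<omega>"
    and b: "\<And>n. E2 M (Y n) \<le> b n" and l: "b \<longlonglongrightarrow> B"
  shows "sq_int M Z" "E2 M Z \<le> B"
proof -
  have m [measurable]: "Y n \<in> borel_measurable M" for n using Y[of n] by auto
  have B: "0 \<le> B" by (rule LIMSEQ_le_const[OF l]) (use b E2_nonneg order_trans in blast)
  have "(\<integral>\<^sup>+ \<omega>. ennreal ((cmod (Z \<omega>))\<^sup>2) \<partial>M) = (\<integral>\<^sup>+ \<omega>. liminf (\<lambda>n. ennreal ((cmod (Y n \<omega>))\<^sup>2)) \<partial>M)"
  proof (rule nn_integral_cong_AE)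
    show "AE \<omega> in M. ennreal ((cmod (Z \<omega>))\<^sup>2) = liminf (\<lambda>n. ennreal ((cmod (Y n \<omega>))\<^sup>2))"
      using ae
    proof eventually_elim
      case (elim \<omega>)
      have "(\<lambda>n. ennreal ((cmod (Y n \<omega>))\<^sup>2)) \<longlonglongrightarrow> ennreal ((cmod (Z \<omega>))\<^sup>2)"
        by (intro tendsto_ennrealI tendsto_intros elim)
      then show ?case by (rule lim_imp_Liminf[OF sequentially_bot, symmetric])
    qed
  qed
  also have "\<dots> \<le> liminf (\<lambda>n. \<integral>\<^sup>+ \<omega>. ennreal ((cmod (Y n \<omega>))\<^sup>2) \<partial>M)"
    by (rule nn_integral_liminf) measurable
  also have "\<dots> \<le> liminf (\<lambda>n. ennreal (b n))"
  proof (rule Liminf_mono, rule always_eventually, rule allI)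
    fix n
    have "(\<integral>\<^sup>+ \<omega>. ennreal ((cmod (Y n \<omega>))\<^sup>2) \<partial>M) = ennreal (E2 M (Y n))"
      unfolding E2_def using Y[of n] by (intro nn_integral_eq_integral) auto
    then show "(\<integral>\<^sup>+ \<omega>. ennreal ((cmod (Y n \<omega>))\<^sup>2) \<partial>M) \<le> ennreal (b n)" using b[of n] by (simp add: ennreal_leI)
  qed
  also have "\<dots> = ennreal B"
    by (rule lim_imp_Liminf[OF sequentially_bot]) (intro tendsto_ennrealI l)
  finally have le: "(\<integral>\<^sup>+ \<omega>. ennreal ((cmod (Z \<omega>))\<^sup>2) \<partial>M) \<le> ennreal B" .
  have "integrable M (\<lambda>\<omega>. (cmod (Z \<omega>))\<^sup>2)"
    unfolding integrable_iff_bounded using le Z by (auto simp: top_unique less_top[symmetric])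
  then show s: "sq_int M Z" using Z by (simp add: sq_int_def)
  have "(\<integral>\<^sup>+ \<omega>. ennreal ((cmod (Z \<omega>))\<^sup>2) \<partial>M) = ennreal (E2 M Z)"
    unfolding E2_def using s by (intro nn_integral_eq_integral) auto
  then show "E2 M Z \<le> B" using le B by simp
qed

text \<open>The geometric rate makes the first moments of the increments at most
  \<open>(1/2) ^ n\<close>. The increments are therefore almost surely summable, and Fatou's lemma
  transfers the rate to the pointwise limit.\<close>

lemma (in prob_space) L2_complete:
  fixes Y :: "nat \<Rightarrow> 'a \<Rightarrow> complex"
  assumes Y: "\<And>n. sq_int M (Y n)" and c: "\<And>n m. n \<le> m \<Longrightarrow> E2 M (\<lambda>\<omega>. Y m \<omega> - Y n \<omega>) \<le> (1/4) ^ n"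
  obtains Z where "sq_int M Z" "\<And>n. E2 M (\<lambda>\<omega>. Y n \<omega> - Z \<omega>) \<le> (1/4) ^ n"
proof -
  have m [measurable]: "Y n \<in> borel_measurable M" for n using Y[of n] by auto
  have one: "sq_int M (\<lambda>_. 1 :: real)" "E2 M (\<lambda>_. 1 :: real) = 1" by (auto simp: sq_int_def E2_def prob_space)
  define u where "u n \<omega> = cmod (Y (Suc n) \<omega> - Y n \<omega>)" for n \<omega>
  have su: "sq_int M (\<lambda>\<omega>. complex_of_real (u n \<omega>))" and Eu: "E2 M (\<lambda>\<omega>. complex_of_real (u n \<omega>)) \<le> (1/4) ^ n" for n
    using sq_int_diff(1)[OF Y[of "Suc n"] Y[of n]] c[of n "Suc n"] by (auto simp: u_def sq_int_def E2_def)
  have iu: "integrable M (u n)" for n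
    using sq_int_mult(1)[OF su[of n] one(1)] by (simp add: complex_of_real_integrable_eq)
  have bu: "(LINT \<omega>|M. u n \<omega>) \<le> (1/2) ^ n" for n
  proof -
    have "(LINT \<omega>|M. u n \<omega>) \<le> cmod (LINT \<omega>|M. complex_of_real (u n \<omega>) * of_real 1)"
      by (simp add: integral_complex_of_real)
    also have "\<dots> \<le> sqrt (E2 M (\<lambda>\<omega>. complex_of_real (u n \<omega>)))"
      using sq_int_mult(2)[OF su[of n] one(1)] one(2) by simp
    also have "\<dots> \<le> sqrt (((1/2) ^ n)\<^sup>2)"
    proof -
      have "((1/2) ^ n)\<^sup>2 = ((1/2::real)\<^sup>2) ^ n" by (simp only: power_mult[symmetric] mult.commute)
      also have "(1/2::real)\<^sup>2 = 1/4" by (simp add: power2_eq_square)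
      finally show ?thesis using Eu[of n] by (simp only: real_sqrt_le_iff)
    qed
    finally show ?thesis by simp
  qed
  have "AE \<omega> in M. summable (\<lambda>n. u n \<omega>)"
  proof -
    have "(\<integral>\<^sup>+ \<omega>. (\<Sum>n. ennreal (u n \<omega>)) \<partial>M) = (\<Sum>n. \<integral>\<^sup>+ \<omega>. ennreal (u n \<omega>) \<partial>M)"
      by (rule nn_integral_suminf) (auto simp: u_def)
    also have "\<dots> = (\<Sum>n. ennreal (LINT \<omega>|M. u n \<omega>))"
      by (intro suminf_cong nn_integral_eq_integral iu) (auto simp: u_def)
    also have "\<dots> \<le> (\<Sum>n. ennreal ((1/2) ^ n))"
      by (rule suminf_le) (rule ennreal_leI, rule bu, simp_all)
    also have "\<dots> = ennreal (\<Sum>n. (1/2) ^ n)"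
      by (rule suminf_ennreal2) (simp_all add: summable_geometric)
    also have "\<dots> < \<infinity>" by simp
    finally have "(\<integral>\<^sup>+ \<omega>. (\<Sum>n. ennreal (u n \<omega>)) \<partial>M) \<noteq> \<infinity>" by simp
    then have "AE \<omega> in M. (\<Sum>n. ennreal (u n \<omega>)) \<noteq> \<infinity>"
      by (intro nn_integral_PInf_AE) (auto simp: u_def)
    then show ?thesis
    proof eventually_elim
      case (elim \<omega>)
      show ?case by (rule summable_suminf_not_top) (use elim in \<open>simp_all add: u_def\<close>)
    qed
  qed
  then have conv: "AE \<omega> in M. convergent (\<lambda>n. Y n \<omega>)"
  proof eventually_elim
    case (elim \<omega>)
    then have "summable (\<lambda>n. Y (Suc n) \<omega> - Y n \<omega>)" unfolding u_def by (rule summable_norm_cancel)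
    then have "convergent (\<lambda>n. \<Sum>i<n. Y (Suc i) \<omega> - Y i \<omega>)" by (simp add: summable_iff_convergent)
    then have "convergent (\<lambda>n. Y n \<omega> - Y 0 \<omega>)" by (simp only: sum_lessThan_telescope[where f = "\<lambda>i. Y i \<omega>"])
    then obtain l where "(\<lambda>n. Y n \<omega> - Y 0 \<omega>) \<longlonglongrightarrow> l" by (auto simp: convergent_def)
    from tendsto_add[OF this tendsto_const[of "Y 0 \<omega>"]] show ?case by (auto simp: convergent_def)
  qed
  define Z where "Z \<omega> = lim (\<lambda>n. Y n \<omega>)" for \<omega>
  have mZ [measurable]: "Z \<in> borel_measurable M" unfolding Z_def by measurable
  have lim: "AE \<omega> in M. (\<lambda>n. Y n \<omega>) \<longlonglongrightarrow> Z \<omega>"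
    using conv by eventually_elim (auto simp: Z_def dest: convergent_LIMSEQ_iff[THEN iffD1])
  have d: "sq_int M (\<lambda>\<omega>. Z \<omega> - Y n \<omega>)" "E2 M (\<lambda>\<omega>. Z \<omega> - Y n \<omega>) \<le> (1/4) ^ n" for n
  proof -
    have s: "sq_int M (\<lambda>\<omega>. Y (k + n) \<omega> - Y n \<omega>)" for k by (rule sq_int_diff(1)[OF Y Y])
    have ae: "AE \<omega> in M. (\<lambda>k. Y (k + n) \<omega> - Y n \<omega>) \<longlonglongrightarrow> Z \<omega> - Y n \<omega>"
      using lim by eventually_elim (intro tendsto_intros LIMSEQ_ignore_initial_segment)
    show "sq_int M (\<lambda>\<omega>. Z \<omega> - Y n \<omega>)" "E2 M (\<lambda>\<omega>. Z \<omega> - Y n \<omega>) \<le> (1/4) ^ n"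
    proof -
      have mm: "(\<lambda>\<omega>. Z \<omega> - Y n \<omega>) \<in> borel_measurable M" by measurable
      have bb: "E2 M (\<lambda>\<omega>. Y (k + n) \<omega> - Y n \<omega>) \<le> (1/4) ^ n" for k by (rule c) simp
      show "sq_int M (\<lambda>\<omega>. Z \<omega> - Y n \<omega>)" "E2 M (\<lambda>\<omega>. Z \<omega> - Y n \<omega>) \<le> (1/4) ^ n"
        using L2_Fatou[OF s mm ae bb tendsto_const] by auto
    qed
  qed
  show thesis
  proof (rule that)
    show "sq_int M Z" using sq_int_add(1)[OF d(1)[of 0] Y[of 0]] by simp
    show "E2 M (\<lambda>\<omega>. Y n \<omega> - Z \<omega>) \<le> (1/4) ^ n" for n using d(2)[of n] by (simp add: E2_minus)
  qed
qed

section \<open>Moments of Gaussian variables and of their mean-square limits\<close>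

definition c16 :: real where "c16 = fact 16 / (2 ^ 8 * fact 8)"

text \<open>The constant \<open>c16\<close> is the moment of order 16 of a standard normal variable.
  In the degenerate case mean 0 forces the variable to vanish almost surely.\<close>

lemma (in prob_space) gaussian_moments:
  assumes g: "gaussian_rv M X" and mean: "expectation X = 0"
  shows "sq_int M X" and "(\<integral>\<^sup>+ \<omega>. ennreal (X \<omega> ^ 16) \<partial>M) \<le> ennreal (c16 * E2 M X ^ 8)"
proof -
  have m [measurable]: "X \<in> borel_measurable M" using g by (simp add: gaussian_rv_def)
  obtain \<mu> \<sigma> where alt: "(0 < \<sigma> \<and> distributed M lborel X (\<lambda>x. ennreal (normal_density \<mu> \<sigma> x))) \<or> (AE \<omega> in M. X \<omega> = \<mu>)"
    using g by (auto simp: gaussian_rv_def)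
  have "sq_int M X \<and> (\<integral>\<^sup>+ \<omega>. ennreal (X \<omega> ^ 16) \<partial>M) \<le> ennreal (c16 * E2 M X ^ 8)"
    using alt
  proof
    assume a: "AE \<omega> in M. X \<omega> = \<mu>"
    then have "expectation X = (LINT \<omega>|M. \<mu>)" by (intro integral_cong_AE) auto
    then have "\<mu> = 0" using mean by (simp add: prob_space)
    with a have a0: "AE \<omega> in M. X \<omega> = 0" by simp
    have "integrable M (\<lambda>\<omega>. (norm (X \<omega>))\<^sup>2) \<longleftrightarrow> integrable M (\<lambda>\<omega>. 0 :: real)"
      by (rule integrable_cong_AE) (use a0 in \<open>auto elim: eventually_mono\<close>)
    moreover have "(\<integral>\<^sup>+ \<omega>. ennreal (X \<omega> ^ 16) \<partial>M) = (\<integral>\<^sup>+ \<omega>. 0 \<partial>M)"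
      by (rule nn_integral_cong_AE) (use a0 in \<open>auto elim: eventually_mono\<close>)
    ultimately show ?thesis by (simp add: sq_int_def)
  next
    assume "0 < \<sigma> \<and> distributed M lborel X (\<lambda>x. ennreal (normal_density \<mu> \<sigma> x))"
    then have \<sigma>: "0 < \<sigma>" and D: "distributed M lborel X (\<lambda>x. ennreal (normal_density \<mu> \<sigma> x))" by auto
    have \<mu>: "\<mu> = 0" using normal_distributed_expectation[OF \<sigma> D] mean by simp
    have mom: "has_bochner_integral M (\<lambda>\<omega>. X \<omega> ^ (2 * k)) (fact (2 * k) / ((2 / \<sigma>\<^sup>2) ^ k * fact k))" for k
    proof -
      have h: "has_bochner_integral lborel (\<lambda>x. normal_density \<mu> \<sigma> x * x ^ (2 * k)) (fact (2 * k) / ((2 / \<sigma>\<^sup>2) ^ k * fact k))"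
        using normal_moment_even[OF \<sigma>, of \<mu> k] by (simp add: \<mu>)
      show ?thesis
        using h distributed_integrable[OF D, of "\<lambda>x. x ^ (2 * k)"] distributed_integral[OF D, of "\<lambda>x. x ^ (2 * k)"]
        by (auto simp: has_bochner_integral_iff)
    qed
    have i2: "integrable M (\<lambda>\<omega>. X \<omega> ^ 2)" and e2: "(LINT \<omega>|M. X \<omega> ^ 2) = \<sigma>\<^sup>2"
      using mom[of 1] by (auto simp: has_bochner_integral_iff)
    have "(\<integral>\<^sup>+ \<omega>. ennreal (X \<omega> ^ 16) \<partial>M) = ennreal (LINT \<omega>|M. X \<omega> ^ 16)"
      using mom[of 8] by (intro nn_integral_eq_integral) (auto simp: has_bochner_integral_iff)
    also have "(LINT \<omega>|M. X \<omega> ^ 16) = c16 * (\<sigma>\<^sup>2) ^ 8"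
      using mom[of 8] unfolding has_bochner_integral_iff c16_def by (simp add: power_divide del: fact_numeral)
    also have "\<sigma>\<^sup>2 = E2 M X" using e2 by (simp add: E2_def)
    finally show ?thesis using i2 by (simp add: sq_int_def)
  qed
  then show "sq_int M X" "(\<integral>\<^sup>+ \<omega>. ennreal (X \<omega> ^ 16) \<partial>M) \<le> ennreal (c16 * E2 M X ^ 8)" by auto
qed

lemma sum_power8_bound:
  fixes u v :: real assumes "0 \<le> u" "0 \<le> v"
  shows "(u + v) ^ 8 \<le> 2 ^ 8 * (u ^ 8 + v ^ 8)"
proof -
  have "(u + v) ^ 8 \<le> (2 * max u v) ^ 8" using assms by (intro power_mono) auto
  also have "\<dots> = 2 ^ 8 * (max u v) ^ 8" by (rule power_mult_distrib)
  also have "(max u v) ^ 8 \<le> u ^ 8 + v ^ 8" using assms by (auto simp: max_def)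
  finally show ?thesis by simp
qed

text \<open>The factor \<open>2 ^ 8\<close> is the price of splitting the eighth power of
  \<open>|Re X|^2 + |Im X|^2\<close> by \<open>sum_power8_bound\<close>.\<close>

definition C16 :: real where "C16 = 2 ^ 8 * c16"

text \<open>The moment comparison for complex linear combinations passes to \<open>L\<^sub>2\<close>-limits by Fatou's
  lemma along an almost everywhere convergent subsequence.\<close>

lemma (in prob_space) complex_gaussian_moment:
  fixes X :: "'a \<Rightarrow> complex"
  assumes g: "gaussian_rv M (\<lambda>\<omega>. Re (X \<omega>))" "gaussian_rv M (\<lambda>\<omega>. Im (X \<omega>))"
    and mean: "expectation (\<lambda>\<omega>. Re (X \<omega>)) = 0" "expectation (\<lambda>\<omega>. Im (X \<omega>)) = 0"
    and s: "sq_int M X"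
  shows "(\<integral>\<^sup>+ \<omega>. ennreal (cmod (X \<omega>) ^ 16) \<partial>M) \<le> ennreal (C16 * E2 M X ^ 8)"
proof -
  have m [measurable]: "X \<in> borel_measurable M" using s by auto
  define a where "a = E2 M (\<lambda>\<omega>. Re (X \<omega>))"
  define b where "b = E2 M (\<lambda>\<omega>. Im (X \<omega>))"
  have ab: "0 \<le> a" "0 \<le> b" "E2 M X = a + b"
    unfolding a_def b_def by (rule E2_nonneg, rule E2_nonneg, rule sq_int_Re_Im(3)[OF s])
  have c: "0 \<le> c16" by (simp add: c16_def)
  have "(\<integral>\<^sup>+ \<omega>. ennreal (cmod (X \<omega>) ^ 16) \<partial>M) \<le> (\<integral>\<^sup>+ \<omega>. ennreal (2 ^ 8) * (ennreal (Re (X \<omega>) ^ 16) + ennreal (Im (X \<omega>) ^ 16)) \<partial>M)"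
  proof (rule nn_integral_mono)
    fix \<omega>
    have "cmod (X \<omega>) ^ 16 = ((cmod (X \<omega>))\<^sup>2) ^ 8" by (simp flip: power_mult)
    also have "\<dots> \<le> 2 ^ 8 * (((Re (X \<omega>))\<^sup>2) ^ 8 + ((Im (X \<omega>))\<^sup>2) ^ 8)"
      unfolding cmod_power2 by (rule sum_power8_bound) auto
    also have "\<dots> = 2 ^ 8 * (Re (X \<omega>) ^ 16 + Im (X \<omega>) ^ 16)" by (simp flip: power_mult)
    finally have "ennreal (cmod (X \<omega>) ^ 16) \<le> ennreal (2 ^ 8 * (Re (X \<omega>) ^ 16 + Im (X \<omega>) ^ 16))" by (rule ennreal_leI)
    also have "\<dots> = ennreal (2 ^ 8) * (ennreal (Re (X \<omega>) ^ 16) + ennreal (Im (X \<omega>) ^ 16))"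
      by (subst ennreal_mult) (auto simp del: ennreal_numeral)
    finally show "ennreal (cmod (X \<omega>) ^ 16) \<le> ennreal (2 ^ 8) * (ennreal (Re (X \<omega>) ^ 16) + ennreal (Im (X \<omega>) ^ 16))" .
  qed
  also have "\<dots> = ennreal (2 ^ 8) * ((\<integral>\<^sup>+ \<omega>. ennreal (Re (X \<omega>) ^ 16) \<partial>M) + (\<integral>\<^sup>+ \<omega>. ennreal (Im (X \<omega>) ^ 16) \<partial>M))"
    by (subst nn_integral_cmult) (auto simp: nn_integral_add simp del: ennreal_power)
  also have "\<dots> \<le> ennreal (2 ^ 8) * (ennreal (c16 * a ^ 8) + ennreal (c16 * b ^ 8))"
    unfolding a_def b_def by (intro mult_left_mono add_mono gaussian_moments g mean) auto
  also have "\<dots> = ennreal (2 ^ 8 * (c16 * a ^ 8 + c16 * b ^ 8))"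
    using ab c by (subst ennreal_mult) (auto simp del: ennreal_numeral)
  also have "\<dots> \<le> ennreal (C16 * E2 M X ^ 8)"
  proof (rule ennreal_leI)
    have "a * a ^ 7 + b * b ^ 7 \<le> a * (a + b) ^ 7 + b * (a + b) ^ 7"
      using ab(1,2) by (intro add_mono mult_left_mono power_mono) auto
    moreover have "x * x ^ 7 = x ^ 8" for x :: real using power_add[of x 1 7] by simp
    ultimately have "a ^ 8 + b ^ 8 \<le> (a + b) ^ 8" by (simp only: distrib_right[symmetric])
    then have "2 ^ 8 * c16 * (a ^ 8 + b ^ 8) \<le> 2 ^ 8 * c16 * (a + b) ^ 8" using c by (intro mult_left_mono) auto
    then show "2 ^ 8 * (c16 * a ^ 8 + c16 * b ^ 8) \<le> C16 * E2 M X ^ 8"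
      unfolding C16_def ab(3) by (simp add: distrib_left mult.assoc)
  qed
  finally show ?thesis .
qed

lemma (in prob_space) moment_L2_limit:
  fixes Y :: "nat \<Rightarrow> 'a \<Rightarrow> complex"
  assumes Y: "\<And>n. sq_int M (Y n)" and Z: "sq_int M Z"
    and b: "\<And>n. (\<integral>\<^sup>+ \<omega>. ennreal (cmod (Y n \<omega>) ^ 16) \<partial>M) \<le> ennreal (C * E2 M (Y n) ^ 8)" and C: "0 \<le> C"
    and l: "(\<lambda>n. E2 M (\<lambda>\<omega>. Y n \<omega> - Z \<omega>)) \<longlonglongrightarrow> 0"
  shows "(\<integral>\<^sup>+ \<omega>. ennreal (cmod (Z \<omega>) ^ 16) \<partial>M) \<le> ennreal (C * (2 * E2 M Z) ^ 8)"
proof -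
  have m [measurable]: "Y n \<in> borel_measurable M" "Z \<in> borel_measurable M" for n using Y[of n] Z by auto
  let ?u = "\<lambda>n \<omega>. (cmod (Y n \<omega> - Z \<omega>))\<^sup>2"
  have "integrable M (?u n)" for n using sq_int_diff(1)[OF Y[of n] Z] by auto
  moreover have "(\<lambda>n. LINT \<omega>|M. norm (?u n \<omega>)) \<longlonglongrightarrow> 0" using l by (simp add: E2_def)
  ultimately obtain r where r: "strict_mono r" "AE \<omega> in M. (\<lambda>n. ?u (r n) \<omega>) \<longlonglongrightarrow> 0"
    using tendsto_L1_AE_subseq[of M ?u] by blast
  have ae: "AE \<omega> in M. (\<lambda>n. Y (r n) \<omega>) \<longlonglongrightarrow> Z \<omega>"
    using r(2)
  proof eventually_elim
    case (elim \<omega>)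
    have "(\<lambda>n. sqrt (?u (r n) \<omega>)) \<longlonglongrightarrow> sqrt 0" by (rule tendsto_real_sqrt[OF elim])
    then have "(\<lambda>n. Y (r n) \<omega> - Z \<omega>) \<longlonglongrightarrow> 0" by (simp add: tendsto_norm_zero_iff)
    then show ?case by (simp add: LIM_zero_iff)
  qed
  \<comment> \<open>\<open>e n\<close> bounds the moment through
    \<open>E2 Y \<le> 2 * E2 (Y - Z) + 2 * E2 Z\<close>; this inequality is the source of the factor
    2 in the conclusion.\<close>
  define e where "e n = C * (2 * E2 M (\<lambda>\<omega>. Y (r n) \<omega> - Z \<omega>) + 2 * E2 M Z) ^ 8" for n
  have "(\<lambda>n. E2 M (\<lambda>\<omega>. Y (r n) \<omega> - Z \<omega>)) \<longlonglongrightarrow> 0"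
    using LIMSEQ_subseq_LIMSEQ[OF l r(1)] by (simp add: comp_def)
  then have el: "e \<longlonglongrightarrow> C * (2 * 0 + 2 * E2 M Z) ^ 8"
    unfolding e_def by (intro tendsto_intros)
  have be: "(\<integral>\<^sup>+ \<omega>. ennreal (cmod (Y (r n) \<omega>) ^ 16) \<partial>M) \<le> ennreal (e n)" for n
  proof (rule order_trans[OF b[of "r n"] ennreal_leI])
    have "E2 M (Y (r n)) \<le> 2 * E2 M (\<lambda>\<omega>. Y (r n) \<omega> - Z \<omega>) + 2 * E2 M Z"
      using sq_int_add(2)[OF sq_int_diff(1)[OF Y[of "r n"] Z] Z] by simp
    then show "C * E2 M (Y (r n)) ^ 8 \<le> e n"
      unfolding e_def using C E2_nonneg by (intro mult_left_mono power_mono) auto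
  qed
  have "(\<integral>\<^sup>+ \<omega>. ennreal (cmod (Z \<omega>) ^ 16) \<partial>M) = (\<integral>\<^sup>+ \<omega>. liminf (\<lambda>n. ennreal (cmod (Y (r n) \<omega>) ^ 16)) \<partial>M)"
  proof (rule nn_integral_cong_AE)
    show "AE \<omega> in M. ennreal (cmod (Z \<omega>) ^ 16) = liminf (\<lambda>n. ennreal (cmod (Y (r n) \<omega>) ^ 16))"
      using ae
    proof eventually_elim
      case (elim \<omega>)
      have "(\<lambda>n. ennreal (cmod (Y (r n) \<omega>) ^ 16)) \<longlonglongrightarrow> ennreal (cmod (Z \<omega>) ^ 16)"
        by (intro tendsto_ennrealI tendsto_intros elim)
      then show ?case by (rule lim_imp_Liminf[OF sequentially_bot, symmetric])
    qed
  qed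
  also have "\<dots> \<le> liminf (\<lambda>n. \<integral>\<^sup>+ \<omega>. ennreal (cmod (Y (r n) \<omega>) ^ 16) \<partial>M)"
    by (rule nn_integral_liminf) measurable
  also have "\<dots> \<le> liminf (\<lambda>n. ennreal (e n))" by (intro Liminf_mono always_eventually allI be)
  also have "\<dots> = ennreal (C * (2 * 0 + 2 * E2 M Z) ^ 8)"
    by (rule lim_imp_Liminf[OF sequentially_bot]) (intro tendsto_ennrealI el)
  finally show ?thesis by simp
qed

subsection \<open>Mean-square integrals of the process\<close>

text \<open>The approximating variables form a Cauchy sequence in \<open>L\<^sub>2\<close> by duality.\<close>

lemma (in prob_space) dual_representation:
  fixes lf :: "('a \<Rightarrow> real) \<Rightarrow> complex"
  assumes ap: "\<And>\<eta>. 0 < \<eta> \<Longrightarrow> \<exists>Y. sq_int M Y \<and> (\<forall>a. sq_int M a \<longrightarrow> cmod (pairing M Y a - lf a) \<le> \<eta> * sqrt (E2 M a))"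
  obtains Z where "sq_int M Z" "\<And>a. sq_int M a \<Longrightarrow> pairing M Z a = lf a"
proof -
  \<comment> \<open>With this accuracy two approximations differ as functionals by at most
    \<open>(1/2) ^ n / 2\<close>. Duality turns this into the rate \<open>(1/4) ^ n\<close> for the
    squared distances, as completeness requires.\<close>
  have "\<exists>Y. sq_int M Y \<and> (\<forall>a. sq_int M a \<longrightarrow> cmod (pairing M Y a - lf a) \<le> (1/2) ^ n / 4 * sqrt (E2 M a))" for n
    by (rule ap) simp
  then obtain Y where Y: "\<And>n. sq_int M (Y n)"
    "\<And>n a. sq_int M a \<Longrightarrow> cmod (pairing M (Y n) a - lf a) \<le> (1/2) ^ n / 4 * sqrt (E2 M a)"
    by metis
  have c: "E2 M (\<lambda>\<omega>. Y m \<omega> - Y n \<omega>) \<le> (1/4) ^ n" if "n \<le> m" for n m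
  proof -
    have "E2 M (\<lambda>\<omega>. Y m \<omega> - Y n \<omega>) \<le> 2 * ((1/2) ^ n / 2)\<^sup>2"
    proof (rule sq_int_duality)
      show "sq_int M (\<lambda>\<omega>. Y m \<omega> - Y n \<omega>)" by (rule sq_int_diff(1)[OF Y(1) Y(1)])
      fix a :: "'a \<Rightarrow> real" assume a: "sq_int M a"
      have "(LINT \<omega>|M. (Y m \<omega> - Y n \<omega>) * of_real (a \<omega>)) = (pairing M (Y m) a - lf a) - (pairing M (Y n) a - lf a)"
        using sq_int_mult(1)[OF Y(1)[of m] a] sq_int_mult(1)[OF Y(1)[of n] a] by (simp add: left_diff_distrib)
      also have "cmod \<dots> \<le> (1/2) ^ m / 4 * sqrt (E2 M a) + (1/2) ^ n / 4 * sqrt (E2 M a)"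
        by (rule order_trans[OF norm_triangle_ineq4 add_mono]) (rule Y(2)[OF a])+
      also have "\<dots> \<le> (1/2) ^ n / 4 * sqrt (E2 M a) + (1/2) ^ n / 4 * sqrt (E2 M a)"
        using that by (intro add_mono mult_right_mono divide_right_mono power_decreasing) (auto simp: E2_nonneg)
      finally show "cmod (LINT \<omega>|M. (Y m \<omega> - Y n \<omega>) * of_real (a \<omega>)) \<le> (1/2) ^ n / 2 * sqrt (E2 M a)" by (simp add: mult.commute)
    qed simp
    also have "\<dots> = ((1/2) ^ n)\<^sup>2 / 2" by (simp add: power_divide)
    also have "((1/2::real) ^ n)\<^sup>2 = ((1/2)\<^sup>2) ^ n" by (simp only: power_mult[symmetric] mult.commute)
    also have "(1/2::real)\<^sup>2 = 1/4" by (simp add: power2_eq_square)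
    finally show ?thesis by (rule order_trans) simp
  qed
  obtain Z where Z: "sq_int M Z" "\<And>n. E2 M (\<lambda>\<omega>. Y n \<omega> - Z \<omega>) \<le> (1/4) ^ n"
    using L2_complete[OF Y(1) c] by blast
  have "(\<lambda>n. E2 M (\<lambda>\<omega>. Y n \<omega> - Z \<omega>)) \<longlonglongrightarrow> 0"
    by (rule tendsto_sandwich[OF _ _ tendsto_const LIMSEQ_power_zero[of "1/4"]])
       (use Z(2) E2_nonneg in \<open>auto intro!: eventuallyI\<close>)
  note conv = sq_int_tendsto[OF Y(1) Z(1) _ this]
  have "pairing M Z a = lf a" if a: "sq_int M a" for a
  proof -
    have "(\<lambda>n. (1/2) ^ n / 4 * sqrt (E2 M a)) \<longlonglongrightarrow> 0 / 4 * sqrt (E2 M a)"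
      by (intro tendsto_intros LIMSEQ_power_zero) simp_all
    then have "(\<lambda>n. (1/2) ^ n / 4 * sqrt (E2 M a)) \<longlonglongrightarrow> 0" by simp
    then have "(\<lambda>n. pairing M (Y n) a - lf a) \<longlonglongrightarrow> 0"
      by (rule Lim_null_comparison[rotated]) (use Y(2)[OF a] in \<open>auto intro!: eventuallyI\<close>)
    then have "(\<lambda>n. LINT \<omega>|M. Y n \<omega> * of_real (a \<omega>)) \<longlonglongrightarrow> lf a" by (simp add: LIM_zero_iff)
    then show ?thesis using conv[OF a] LIMSEQ_unique by blast
  qed
  with Z(1) show thesis using that by blast
qed

lemma (in prob_space) dual_distance:
  assumes "sq_int M X" "sq_int M Z" "0 \<le> D"
    and "\<And>a. sq_int M a \<Longrightarrow> pairing M Z a = lf a"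
    and "\<And>a. sq_int M a \<Longrightarrow> cmod (pairing M X a - lf a) \<le> D * sqrt (E2 M a)"
  shows "E2 M (\<lambda>\<omega>. X \<omega> - Z \<omega>) \<le> 2 * D\<^sup>2"
proof (rule sq_int_duality[OF sq_int_diff(1)[OF assms(1,2)] assms(3)])
  fix a :: "'a \<Rightarrow> real" assume a: "sq_int M a"
  have "(LINT \<omega>|M. (X \<omega> - Z \<omega>) * of_real (a \<omega>)) = pairing M X a - lf a"
    using sq_int_mult(1)[OF assms(1) a] sq_int_mult(1)[OF assms(2) a] assms(4)[OF a] by (simp add: left_diff_distrib)
  then show "cmod (LINT \<omega>|M. (X \<omega> - Z \<omega>) * of_real (a \<omega>)) \<le> D * sqrt (E2 M a)"
    using assms(5)[OF a] by simp
qed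

lemma riemann_sum_error:
  fixes q :: "real \<Rightarrow> complex"
  assumes cont: "continuous_on {a..b} q" and p: "p tagged_division_of {a..b}" and fine: "(\<lambda>x. ball x \<delta>) fine p"
    and ab: "a \<le> b"
    and mod: "\<And>x y. x \<in> {a..b} \<Longrightarrow> y \<in> {a..b} \<Longrightarrow> \<bar>x - y\<bar> < \<delta> \<Longrightarrow> cmod (q x - q y) \<le> \<eta>"
  shows "cmod ((\<Sum>(x, K)\<in>p. measure lborel K *\<^sub>R q x) - (LINT t:{a..b}|lborel. q t)) \<le> \<eta> * (b - a)"
proof -
  have int: "q integrable_on {a..b}" by (rule integrable_continuous_real[OF cont])
  have "(LINT t:{a..b}|lborel. q t) = integral {a..b} q"
    by (rule set_borel_integral_eq_integral(2)) (rule set_integrable_compact_continuous[OF _ cont], simp)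
  also have "\<dots> = (\<Sum>(x, K)\<in>p. integral K q)"
    using integral_combine_tagged_division_topdown[of q a b p] int p by simp
  finally have eq: "(LINT t:{a..b}|lborel. q t) = (\<Sum>(x, K)\<in>p. integral K q)" .
  have each: "cmod (measure lborel K *\<^sub>R q x - integral K q) \<le> \<eta> * measure lborel K" if xK: "(x, K) \<in> p" for x K
  proof -
    obtain c d where K: "K = cbox c d" using tagged_division_ofD(4)[OF p xK] by blast
    have xin: "x \<in> K" and sub: "K \<subseteq> {a..b}" using tagged_division_ofD(2,3)[OF p xK] by auto
    have Kb: "K \<subseteq> ball x \<delta>" using fineD[OF fine xK] .
    have iK: "q integrable_on K" unfolding K by (rule integrable_on_subcbox[OF int sub[unfolded K]])
    have "((\<lambda>y. q x - q y) has_integral (measure lborel K *\<^sub>R q x - integral K q)) K"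
      unfolding K by (intro has_integral_diff has_integral_const integrable_integral iK[unfolded K])
    then show ?thesis unfolding K
    proof (rule has_integral_bound[rotated])
      have "x \<in> {a..b}" "0 < \<delta>" using subsetD[OF sub xin] subsetD[OF Kb xin] by simp_all
      then show "0 \<le> \<eta>" using mod[of x x] by simp
      fix y assume "y \<in> cbox c d"
      then show "cmod (q x - q y) \<le> \<eta>" using mod[of x y] xin sub Kb K by (auto simp: dist_real_def)
    qed
  qed
  have "cmod ((\<Sum>(x, K)\<in>p. measure lborel K *\<^sub>R q x) - (\<Sum>(x, K)\<in>p. integral K q))
      = cmod (\<Sum>(x, K)\<in>p. measure lborel K *\<^sub>R q x - integral K q)"
    by (simp add: sum_subtractf split_def)
  also have "\<dots> \<le> (\<Sum>(x, K)\<in>p. \<eta> * measure lborel K)"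
    by (rule sum_norm_le) (use each in auto)
  also have "\<dots> = \<eta> * (\<Sum>(x, K)\<in>p. measure lborel K)" by (simp add: sum_distrib_left split_def)
  also have "(\<Sum>(x, K)\<in>p. measure lborel K) = b - a"
    using additive_content_tagged_division[of p a b] p ab by simp
  finally show ?thesis unfolding eq .
qed

text \<open>The number \<open>\<delta>\<close> is chosen before \<open>H\<close> and
  \<open>f\<close>, and the error is proportional to \<open>H\<close>. This uniformity is what later
  allows estimates of pairings to become mean-square estimates.\<close>

lemma holder_product_modulus:
  fixes g :: "real \<Rightarrow> complex"
  assumes g: "continuous_on {a..b} g" and \<beta>: "0 < \<beta>" and \<eta>: "0 < \<eta>"
  obtains \<delta> where "0 < \<delta>"
    "\<And>H f x y. holder \<beta> H f \<Longrightarrow> x \<in> {a..b} \<Longrightarrow> y \<in> {a..b} \<Longrightarrow> \<bar>x - y\<bar> < \<delta> \<Longrightarrow>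
      cmod (of_real (f x) * cnj (g x) - of_real (f y) * cnj (g y)) \<le> H * \<eta>"
proof -
  have "bounded (g ` {a..b})" by (rule compact_imp_bounded[OF compact_continuous_image[OF g]]) simp
  then obtain B where B: "0 < B" "\<And>x. x \<in> {a..b} \<Longrightarrow> cmod (g x) \<le> B" by (auto simp: bounded_pos)
  define A where "A = gw \<beta> (\<bar>a\<bar> + \<bar>b\<bar>)"
  have A: "0 < A" unfolding A_def by (rule gw_pos)
  have "uniformly_continuous_on {a..b} g" by (rule compact_uniformly_continuous[OF g]) simp
  then obtain d1 where d1: "0 < d1" "\<And>x y. x \<in> {a..b} \<Longrightarrow> y \<in> {a..b} \<Longrightarrow> \<bar>x - y\<bar> < d1 \<Longrightarrow> cmod (g x - g y) < \<eta> / (2 * A)"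
    unfolding uniformly_continuous_on_def using \<eta> A
    by (metis dist_commute dist_norm dist_real_def divide_pos_pos mult_pos_pos zero_less_numeral)
  define d2 where "d2 = (\<eta> / (2 * B)) powr (1 / \<beta>)"
  have d2: "0 < d2" unfolding d2_def using \<eta> B by simp
  show thesis
  proof (rule that[of "min d1 d2"])
    show "0 < min d1 d2" using d1 d2 by simp
    fix H f x y assume h: "holder \<beta> H f" and xy: "x \<in> {a..b}" "y \<in> {a..b}" "\<bar>x - y\<bar> < min d1 d2"
    have H: "0 \<le> H" using h by (simp add: holder_def)
    have "\<bar>f x\<bar> \<le> H * gw \<beta> x" using holder_growth[OF h] \<beta> by simp
    also have "\<dots> \<le> H * A" unfolding A_def using H \<beta> xy by (intro mult_left_mono gw_mono) auto
    finally have fx: "\<bar>f x\<bar> \<le> H * A" .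
    have "\<bar>x - y\<bar> powr \<beta> \<le> d2 powr \<beta>" using xy \<beta> by (intro powr_mono2) auto
    also have "d2 powr \<beta> = \<eta> / (2 * B)" unfolding d2_def powr_powr using \<beta> \<eta> B by simp
    finally have "H * \<bar>x - y\<bar> powr \<beta> \<le> H * (\<eta> / (2 * B))" using H by (rule mult_left_mono)
    then have fxy: "\<bar>f x - f y\<bar> \<le> H * (\<eta> / (2 * B))" using h unfolding holder_def by (meson order_trans)
    have "of_real (f x) * cnj (g x) - of_real (f y) * cnj (g y) = of_real (f x) * cnj (g x - g y) + of_real (f x - f y) * cnj (g y)"
      by (simp add: algebra_simps)
    also have "cmod \<dots> \<le> cmod (of_real (f x) * cnj (g x - g y)) + cmod (of_real (f x - f y) * cnj (g y))"
      by (rule norm_triangle_ineq)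
    also have "\<dots> = \<bar>f x\<bar> * cmod (g x - g y) + \<bar>f x - f y\<bar> * cmod (g y)"
      by (simp only: norm_mult norm_of_real complex_mod_cnj)
    also have "\<dots> \<le> (H * A) * (\<eta> / (2 * A)) + (H * (\<eta> / (2 * B))) * B"
      using d1(2)[of x y] xy B H A fx fxy \<eta> by (intro add_mono mult_mono) (auto simp: less_imp_le)
    also have "\<dots> = H * \<eta>" using A B by (simp add: field_simps)
    finally show "cmod (of_real (f x) * cnj (g x) - of_real (f y) * cnj (g y)) \<le> H * \<eta>" .
  qed
qed

section \<open>The process, its pairings and its mean-square integrals over bounded
  intervals\<close>

locale abs_fbm = prob_space M for M :: "'a measure" +
  fixes W :: "real \<Rightarrow> 'a \<Rightarrow> real" and \<beta> :: real
  assumes \<beta>: "0 < \<beta>"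
    and gauss: "gaussian_process M W" and centered: "centered_process M W"
    and even: "\<And>t. AE \<omega> in M. W (- t) \<omega> = W t \<omega>"
    and cov: "\<And>t s. (LINT \<omega>|M. W t \<omega> * W s \<omega>) = W_cov (2 * \<beta>) t s"
begin

lemma W_measurable [measurable]: "W t \<in> borel_measurable M"
  using centered by (auto simp: centered_process_def)

text \<open>\<open>gaussian_process\<close> speaks of sums over sets of times, whereas the times
  \<open>\<tau> i\<close> may repeat, as tags of a division do; coefficients at equal times are
  collected first.\<close>

lemma real_combination:
  fixes d :: "'i \<Rightarrow> real"
  assumes "finite P"
  shows "gaussian_rv M (\<lambda>\<omega>. \<Sum>i\<in>P. d i * W (\<tau> i) \<omega>)" "expectation (\<lambda>\<omega>. \<Sum>i\<in>P. d i * W (\<tau> i) \<omega>) = 0"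
proof -
  have "(\<Sum>i\<in>P. d i * W (\<tau> i) \<omega>) = (\<Sum>t\<in>\<tau> ` P. (\<Sum>i | i \<in> P \<and> \<tau> i = t. d i) * W t \<omega>)" for \<omega>
  proof -
    have "(\<Sum>i\<in>P. d i * W (\<tau> i) \<omega>) = (\<Sum>t\<in>\<tau> ` P. \<Sum>i | i \<in> P \<and> \<tau> i = t. d i * W (\<tau> i) \<omega>)"
      by (rule sum.image_gen[OF assms])
    also have "\<dots> = (\<Sum>t\<in>\<tau> ` P. (\<Sum>i | i \<in> P \<and> \<tau> i = t. d i) * W t \<omega>)"
      by (rule sum.cong[OF refl]) (simp add: sum_distrib_right)
    finally show ?thesis .
  qed
  moreover have "gaussian_rv M (\<lambda>\<omega>. \<Sum>t\<in>\<tau> ` P. (\<Sum>i | i \<in> P \<and> \<tau> i = t. d i) * W t \<omega>)"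
    using gauss[unfolded gaussian_process_def, rule_format, of "\<tau> ` P" "\<lambda>t. \<Sum>i | i \<in> P \<and> \<tau> i = t. d i"]
      finite_imageI[OF assms, of \<tau>] by (simp only:)
  ultimately show "gaussian_rv M (\<lambda>\<omega>. \<Sum>i\<in>P. d i * W (\<tau> i) \<omega>)" by (simp only:)
  show "expectation (\<lambda>\<omega>. \<Sum>i\<in>P. d i * W (\<tau> i) \<omega>) = 0"
  proof -
    have i: "integrable M (\<lambda>\<omega>. d i * W (\<tau> i) \<omega>)" and e: "(LINT \<omega>|M. W (\<tau> i) \<omega>) = 0" for i
      using centered unfolding centered_process_def by simp_all
    have "expectation (\<lambda>\<omega>. \<Sum>i\<in>P. d i * W (\<tau> i) \<omega>) = (\<Sum>i\<in>P. LINT \<omega>|M. d i * W (\<tau> i) \<omega>)"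
      by (rule Bochner_Integration.integral_sum) (rule i)
    then show ?thesis by (simp add: e)
  qed
qed

lemma W_sq_int: "sq_int M (W t)"
  using gaussian_moments(1)[OF real_combination[of "{()}" "\<lambda>_. 1" "\<lambda>_. t"]] by simp

lemma complex_combination:
  fixes c :: "'i \<Rightarrow> complex" and \<tau> :: "'i \<Rightarrow> real"
  assumes P: "finite P"
  defines "X \<equiv> \<lambda>\<omega>. \<Sum>i\<in>P. c i * of_real (W (\<tau> i) \<omega>)"
  shows "sq_int M X" "(\<integral>\<^sup>+ \<omega>. ennreal (cmod (X \<omega>) ^ 16) \<partial>M) \<le> ennreal (C16 * E2 M X ^ 8)"
proof -
  show s: "sq_int M X" unfolding X_def by (intro sq_int_sum sq_int_scale(1) sq_int_of_real W_sq_int)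
  have R: "(\<lambda>\<omega>. Re (X \<omega>)) = (\<lambda>\<omega>. \<Sum>i\<in>P. Re (c i) * W (\<tau> i) \<omega>)"
    and I: "(\<lambda>\<omega>. Im (X \<omega>)) = (\<lambda>\<omega>. \<Sum>i\<in>P. Im (c i) * W (\<tau> i) \<omega>)"
    by (simp_all add: X_def)
  show "(\<integral>\<^sup>+ \<omega>. ennreal (cmod (X \<omega>) ^ 16) \<partial>M) \<le> ennreal (C16 * E2 M X ^ 8)"
    by (rule complex_gaussian_moment) (simp_all only: R I real_combination[OF P] s)
qed

text \<open>This is the function \<open>f\<^sub>a\<close> of the overview.\<close>

definition pf :: "('a \<Rightarrow> real) \<Rightarrow> real \<Rightarrow> real" where
  "pf a u = (LINT \<omega>|M. W u \<omega> * a \<omega>)"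

lemma real_Cauchy_Schwarz:
  fixes X a :: "'a \<Rightarrow> real"
  assumes "sq_int M X" "sq_int M a"
  shows "integrable M (\<lambda>\<omega>. X \<omega> * a \<omega>)" "\<bar>LINT \<omega>|M. X \<omega> * a \<omega>\<bar> \<le> sqrt (E2 M X) * sqrt (E2 M a)"
proof -
  note sq = sq_int_mult[OF sq_int_of_real[OF assms(1)] assms(2)]
  have i: "integrable M (\<lambda>\<omega>. complex_of_real (X \<omega> * a \<omega>))" using sq(1) by simp
  then show "integrable M (\<lambda>\<omega>. X \<omega> * a \<omega>)" by (simp only: complex_of_real_integrable_eq)
  have "\<bar>LINT \<omega>|M. X \<omega> * a \<omega>\<bar> = cmod (LINT \<omega>|M. complex_of_real (X \<omega> * a \<omega>))"
    by (simp only: integral_complex_of_real norm_of_real)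
  then show "\<bar>LINT \<omega>|M. X \<omega> * a \<omega>\<bar> \<le> sqrt (E2 M X) * sqrt (E2 M a)"
    using sq(2) by (simp add: E2_def)
qed

lemma E2_W_diff: "E2 M (\<lambda>\<omega>. W u \<omega> - W v \<omega>) = \<bar>\<bar>u\<bar> - \<bar>v\<bar>\<bar> powr (2 * \<beta>)"
proof -
  note i = real_Cauchy_Schwarz(1)[OF W_sq_int W_sq_int]
  have "E2 M (\<lambda>\<omega>. W u \<omega> - W v \<omega>) = (LINT \<omega>|M. W u \<omega> * W u \<omega> - 2 * (W u \<omega> * W v \<omega>) + W v \<omega> * W v \<omega>)"
    unfolding E2_def by (intro Bochner_Integration.integral_cong) (auto simp: power2_eq_square algebra_simps)
  also have "\<dots> = W_cov (2 * \<beta>) u u - 2 * W_cov (2 * \<beta>) u v + W_cov (2 * \<beta>) v v"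
    using i[of u u] i[of u v] i[of v v] by (simp add: cov)
  also have "\<dots> = \<bar>\<bar>u\<bar> - \<bar>v\<bar>\<bar> powr (2 * \<beta>)" by (simp add: W_cov_def field_simps)
  finally show ?thesis .
qed

lemma E2_W_0: "E2 M (W 0) = 0"
  using cov[of 0 0] by (simp add: E2_def W_cov_def power2_eq_square)

text \<open>Cauchy-Schwarz for the increments of the process, together with
  \<open>||u| - |v|| \<le> |u - v|\<close>. The constant is the norm of \<open>a\<close>, so bounds
  linear in the Hoelder constant are bounds for functionals.\<close>

lemma pf_holder: assumes a: "sq_int M a" shows "holder \<beta> (sqrt (E2 M a)) (pf a)"
  unfolding holder_def
proof (intro conjI allI)
  show "0 \<le> sqrt (E2 M a)" by (simp add: E2_nonneg)
  show "pf a 0 = 0" using real_Cauchy_Schwarz(2)[OF W_sq_int a, of 0] by (simp add: E2_W_0 pf_def)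
  show "pf a (- u) = pf a u" for u
    unfolding pf_def
  proof (rule integral_cong_AE)
    have [measurable]: "a \<in> borel_measurable M" using a by auto
    show "(\<lambda>\<omega>. W (- u) \<omega> * a \<omega>) \<in> borel_measurable M" "(\<lambda>\<omega>. W u \<omega> * a \<omega>) \<in> borel_measurable M" by measurable
    show "AE \<omega> in M. W (- u) \<omega> * a \<omega> = W u \<omega> * a \<omega>" using even[of u] by eventually_elim simp
  qed
  fix u v
  have "pf a u - pf a v = (LINT \<omega>|M. (W u \<omega> - W v \<omega>) * a \<omega>)"
    unfolding pf_def left_diff_distrib using real_Cauchy_Schwarz(1)[OF W_sq_int a] by simp
  also have "\<bar>\<dots>\<bar> \<le> sqrt (E2 M (\<lambda>\<omega>. W u \<omega> - W v \<omega>)) * sqrt (E2 M a)"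
    by (rule real_Cauchy_Schwarz(2)[OF sq_int_diff(1)[OF W_sq_int W_sq_int] a])
  also have "sqrt (E2 M (\<lambda>\<omega>. W u \<omega> - W v \<omega>)) = \<bar>\<bar>u\<bar> - \<bar>v\<bar>\<bar> powr \<beta>"
    unfolding E2_W_diff by (simp add: powr_half_sqrt[symmetric] powr_powr)
  also have "\<bar>\<bar>u\<bar> - \<bar>v\<bar>\<bar> powr \<beta> * sqrt (E2 M a) \<le> \<bar>u - v\<bar> powr \<beta> * sqrt (E2 M a)"
    using \<beta> by (intro mult_right_mono powr_mono2) (auto simp: E2_nonneg)
  finally show "\<bar>pf a u - pf a v\<bar> \<le> sqrt (E2 M a) * \<bar>u - v\<bar> powr \<beta>" by (simp add: mult.commute)
qed

lemma combination_pairing: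
  fixes c :: "'i \<Rightarrow> complex"
  assumes a: "sq_int M a"
  shows "(LINT \<omega>|M. (\<Sum>i\<in>P. c i * of_real (W (\<tau> i) \<omega>)) * of_real (a \<omega>)) = (\<Sum>i\<in>P. c i * of_real (pf a (\<tau> i)))"
proof -
  have i: "integrable M (\<lambda>\<omega>. c i * (complex_of_real (W (\<tau> i) \<omega>) * of_real (a \<omega>)))" for i
    by (intro integrable_mult_right sq_int_mult(1) sq_int_of_real W_sq_int a)
  have "(LINT \<omega>|M. (\<Sum>i\<in>P. c i * of_real (W (\<tau> i) \<omega>)) * of_real (a \<omega>))
      = (LINT \<omega>|M. (\<Sum>i\<in>P. c i * (of_real (W (\<tau> i) \<omega>) * of_real (a \<omega>))))"
    by (simp only: sum_distrib_right mult.assoc)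
  also have "\<dots> = (\<Sum>i\<in>P. LINT \<omega>|M. c i * (of_real (W (\<tau> i) \<omega>) * of_real (a \<omega>)))"
    by (rule Bochner_Integration.integral_sum) (rule i)
  also have "\<dots> = (\<Sum>i\<in>P. c i * of_real (pf a (\<tau> i)))"
    unfolding pf_def by (simp only: integral_mult_right_zero of_real_mult[symmetric] integral_complex_of_real)
  finally show ?thesis .
qed

definition integrand :: "(real \<Rightarrow> complex) \<Rightarrow> real \<Rightarrow> 'a \<Rightarrow> complex" where
  "integrand g t \<omega> = of_real (W t \<omega>) * cnj (g t)"

definition RS :: "(real \<Rightarrow> complex) \<Rightarrow> (real \<times> real set) set \<Rightarrow> 'a \<Rightarrow> complex" where
  "RS g p \<omega> = (\<Sum>(x, K)\<in>p. measure lborel K *\<^sub>R integrand g x \<omega>)"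

lemma RS_combination: "RS g p = (\<lambda>\<omega>. \<Sum>i\<in>p. (of_real (measure lborel (snd i)) * cnj (g (fst i))) * of_real (W (fst i) \<omega>))"
  by (rule ext) (simp add: RS_def integrand_def split_def scaleR_conv_of_real mult_ac)

lemma RS_props:
  assumes "p tagged_division_of {a..b}"
  shows "sq_int M (RS g p)" "(\<integral>\<^sup>+ \<omega>. ennreal (cmod (RS g p \<omega>) ^ 16) \<partial>M) \<le> ennreal (C16 * E2 M (RS g p) ^ 8)"
  unfolding RS_combination by (rule complex_combination, rule tagged_division_ofD(1)[OF assms])+

lemma RS_pairing:
  "sq_int M \<alpha> \<Longrightarrow> pairing M (RS g p) \<alpha> = (\<Sum>(x, K)\<in>p. measure lborel K *\<^sub>R (of_real (pf \<alpha> x) * cnj (g x)))"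
  unfolding RS_combination combination_pairing by (simp add: split_def scaleR_conv_of_real mult_ac)

definition IP :: "(real \<Rightarrow> complex) \<Rightarrow> real \<Rightarrow> real \<Rightarrow> ('a \<Rightarrow> real) \<Rightarrow> complex" where
  "IP g a b \<alpha> = (LINT t:{a..b}|lborel. of_real (pf \<alpha> t) * cnj (g t))"

text \<open>One mesh serves all test variables: the Hoelder constant of \<open>pf \<alpha>\<close>
  is the norm of \<open>\<alpha>\<close> and \<open>holder_product_modulus\<close> is uniform in the
  function.\<close>

lemma riemann_pairing:
  assumes g: "continuous_on UNIV g" and ab: "a \<le> b" and \<eta>: "0 < \<eta>"
  obtains \<delta> where "0 < \<delta>"
    "\<And>p \<alpha>. p tagged_division_of {a..b} \<Longrightarrow> (\<lambda>x. ball x \<delta>) fine p \<Longrightarrow> sq_int M \<alpha> \<Longrightarrow>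
      cmod (pairing M (RS g p) \<alpha> - IP g a b \<alpha>) \<le> \<eta> * sqrt (E2 M \<alpha>)"
proof -
  define \<eta>' where "\<eta>' = \<eta> / (b - a + 1)"
  have \<eta>': "0 < \<eta>'" using ab \<eta> by (simp add: \<eta>'_def)
  have g': "continuous_on {a..b} g" using g by (rule continuous_on_subset) simp
  obtain \<delta> where \<delta>: "0 < \<delta>"
    "\<And>H f x y. holder \<beta> H f \<Longrightarrow> x \<in> {a..b} \<Longrightarrow> y \<in> {a..b} \<Longrightarrow> \<bar>x - y\<bar> < \<delta> \<Longrightarrow>
      cmod (of_real (f x) * cnj (g x) - of_real (f y) * cnj (g y)) \<le> H * \<eta>'"
    using holder_product_modulus[OF g' \<beta> \<eta>'] by blast
  show thesis
  proof (rule that[OF \<delta>(1)])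
    fix p and \<alpha> :: "'a \<Rightarrow> real" assume p: "p tagged_division_of {a..b}" "(\<lambda>x. ball x \<delta>) fine p" and \<alpha>: "sq_int M \<alpha>"
    note h = pf_holder[OF \<alpha>]
    have c: "continuous_on {a..b} (\<lambda>t. complex_of_real (pf \<alpha> t) * cnj (g t))"
      by (intro continuous_intros continuous_on_subset[OF holder_continuous[OF h \<beta>]] g') simp
    have "cmod (pairing M (RS g p) \<alpha> - IP g a b \<alpha>) \<le> sqrt (E2 M \<alpha>) * \<eta>' * (b - a)"
      unfolding RS_pairing[OF \<alpha>] IP_def by (rule riemann_sum_error[OF c p ab]) (rule \<delta>(2)[OF h])
    also have "\<dots> = (\<eta>' * (b - a)) * sqrt (E2 M \<alpha>)" by simp
    also have "\<dots> \<le> \<eta> * sqrt (E2 M \<alpha>)"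
    proof (rule mult_right_mono)
      show "\<eta>' * (b - a) \<le> \<eta>" unfolding \<eta>'_def using ab \<eta> by (simp add: field_simps)
    qed (simp add: E2_nonneg)
    finally show "cmod (pairing M (RS g p) \<alpha> - IP g a b \<alpha>) \<le> \<eta> * sqrt (E2 M \<alpha>)" .
  qed
qed

lemma fine_tagged_division:
  fixes a b \<delta> :: real
  assumes "0 < \<delta>"
  obtains p where "p tagged_division_of {a..b}" "(\<lambda>x. ball x \<delta>) fine p"
  by (rule fine_division_exists_real[of "\<lambda>x. ball x \<delta>" a b]) (use assms in \<open>auto intro: gauge_ball\<close>)

text \<open>The functional \<open>IP g a b\<close> is a uniform limit, on bounded sets of test
  variables, of pairings with Riemann sums; it is thus represented by a variable, and the distance
  of the Riemann sums to it is estimated by duality.\<close>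

lemma ms_integral_on_exists:
  assumes g: "continuous_on UNIV g" and ab: "a \<le> b"
  shows "\<exists>J. has_ms_integral_on M (integrand g) a b J"
proof -
  have "\<exists>Y. sq_int M Y \<and> (\<forall>\<alpha>. sq_int M \<alpha> \<longrightarrow> cmod (pairing M Y \<alpha> - IP g a b \<alpha>) \<le> \<eta> * sqrt (E2 M \<alpha>))"
    if \<eta>: "0 < \<eta>" for \<eta>
  proof -
    obtain \<delta> where \<delta>: "0 < \<delta>" "\<And>p \<alpha>. p tagged_division_of {a..b} \<Longrightarrow> (\<lambda>x. ball x \<delta>) fine p \<Longrightarrow> sq_int M \<alpha> \<Longrightarrow>
      cmod (pairing M (RS g p) \<alpha> - IP g a b \<alpha>) \<le> \<eta> * sqrt (E2 M \<alpha>)"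
      using riemann_pairing[OF g ab \<eta>] by blast
    obtain p where p: "p tagged_division_of {a..b}" "(\<lambda>x. ball x \<delta>) fine p"
      using fine_tagged_division[OF \<delta>(1)] by blast
    show ?thesis using RS_props(1)[OF p(1)] \<delta>(2)[OF p] by blast
  qed
  then obtain Z where Z: "sq_int M Z" "\<And>\<alpha>. sq_int M \<alpha> \<Longrightarrow> pairing M Z \<alpha> = IP g a b \<alpha>"
    using dual_representation[of "IP g a b"] by blast
  have "has_ms_integral_on M (integrand g) a b Z"
    unfolding has_ms_integral_on_def
  proof (intro conjI allI impI)
    show "Z \<in> borel_measurable M" using Z(1) by auto
    fix \<epsilon> :: real assume \<epsilon>: "0 < \<epsilon>"
    define \<eta> where "\<eta> = sqrt (\<epsilon> / 4)"
    have \<eta>: "0 < \<eta>" using \<epsilon> by (simp add: \<eta>_def)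
    obtain \<delta> where \<delta>: "0 < \<delta>" "\<And>p \<alpha>. p tagged_division_of {a..b} \<Longrightarrow> (\<lambda>x. ball x \<delta>) fine p \<Longrightarrow> sq_int M \<alpha> \<Longrightarrow>
      cmod (pairing M (RS g p) \<alpha> - IP g a b \<alpha>) \<le> \<eta> * sqrt (E2 M \<alpha>)"
      using riemann_pairing[OF g ab \<eta>] by blast
    show "\<exists>\<delta>>0. \<forall>p. p tagged_division_of {a..b} \<longrightarrow> (\<lambda>x. ball x \<delta>) fine p \<longrightarrow>
        ms_dist M (\<lambda>\<omega>. \<Sum>(x, K)\<in>p. measure lborel K *\<^sub>R integrand g x \<omega>) Z < ennreal \<epsilon>"
    proof (intro exI[of _ \<delta>] conjI allI impI \<delta>(1))
      fix p assume p: "p tagged_division_of {a..b}" "(\<lambda>x. ball x \<delta>) fine p"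
      note s = RS_props(1)[OF p(1), of g]
      have "E2 M (\<lambda>\<omega>. RS g p \<omega> - Z \<omega>) \<le> 2 * \<eta>\<^sup>2"
        by (rule dual_distance[OF s Z(1) _ Z(2) \<delta>(2)[OF p]]) (use \<eta> in auto)
      also have "\<dots> < \<epsilon>" using \<epsilon> by (simp add: \<eta>_def)
      finally have "ms_dist M (RS g p) Z < ennreal \<epsilon>"
        using \<epsilon> by (simp add: ms_dist_E2[OF sq_int_diff(1)[OF s Z(1)]] ennreal_less_iff E2_nonneg)
      then show "ms_dist M (\<lambda>\<omega>. \<Sum>(x, K)\<in>p. measure lborel K *\<^sub>R integrand g x \<omega>) Z < ennreal \<epsilon>"
        by (simp only: RS_def[abs_def])
    qed
  qed
  then show ?thesis by blast
qed

text \<open>The properties are proved for an arbitrary version of the integral. The last one keeps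
  finite combinations of the process close to the integral, so that Gaussian moment bounds can pass
  to the limit.\<close>

lemma ms_integral_on_props:
  assumes g: "continuous_on UNIV g" and ab: "a \<le> b" and J: "has_ms_integral_on M (integrand g) a b J"
  shows "sq_int M J" "\<And>\<alpha>. sq_int M \<alpha> \<Longrightarrow> pairing M J \<alpha> = IP g a b \<alpha>"
    and "\<And>\<epsilon>. 0 < \<epsilon> \<Longrightarrow> \<exists>p. p tagged_division_of {a..b} \<and> E2 M (\<lambda>\<omega>. RS g p \<omega> - J \<omega>) \<le> \<epsilon>"
proof -
  have mJ: "J \<in> borel_measurable M" using J by (simp add: has_ms_integral_on_def)
  have approx: "\<exists>p. p tagged_division_of {a..b} \<and> ms_dist M (RS g p) J < ennreal \<epsilon> \<and>
      (\<forall>\<alpha>. sq_int M \<alpha> \<longrightarrow> cmod (pairing M (RS g p) \<alpha> - IP g a b \<alpha>) \<le> \<epsilon> * sqrt (E2 M \<alpha>))"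
    if \<epsilon>: "0 < \<epsilon>" for \<epsilon>
  proof -
    obtain \<delta>1 where \<delta>1: "0 < \<delta>1" "\<And>p \<alpha>. p tagged_division_of {a..b} \<Longrightarrow> (\<lambda>x. ball x \<delta>1) fine p \<Longrightarrow> sq_int M \<alpha> \<Longrightarrow>
      cmod (pairing M (RS g p) \<alpha> - IP g a b \<alpha>) \<le> \<epsilon> * sqrt (E2 M \<alpha>)"
      using riemann_pairing[OF g ab \<epsilon>] by blast
    obtain \<delta>2 where \<delta>2: "0 < \<delta>2" "\<And>p. p tagged_division_of {a..b} \<Longrightarrow> (\<lambda>x. ball x \<delta>2) fine p \<Longrightarrow> ms_dist M (RS g p) J < ennreal \<epsilon>"
    proof -
      have "\<exists>\<delta>>0. \<forall>p. p tagged_division_of {a..b} \<longrightarrow> (\<lambda>x. ball x \<delta>) fine p \<longrightarrow> ms_dist M (RS g p) J < ennreal \<epsilon>"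
        using J \<epsilon> by (simp only: has_ms_integral_on_def RS_def[abs_def])
      then show thesis using that by blast
    qed
    obtain p where p: "p tagged_division_of {a..b}" "(\<lambda>x. ball x (min \<delta>1 \<delta>2)) fine p"
      by (rule fine_tagged_division[of "min \<delta>1 \<delta>2" a b]) (use \<delta>1(1) \<delta>2(1) in auto)
    have sub: "ball x (min \<delta>1 \<delta>2) \<subseteq> ball x \<delta>1" "ball x (min \<delta>1 \<delta>2) \<subseteq> ball x \<delta>2" for x :: real
      by (auto simp: min_def)
    have f1: "(\<lambda>x. ball x \<delta>1) fine p"
      by (rule fineI, rule order_trans[OF fineD[OF p(2)] sub(1)])
    have f2: "(\<lambda>x. ball x \<delta>2) fine p"
      by (rule fineI, rule order_trans[OF fineD[OF p(2)] sub(2)])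
    show ?thesis using p(1) \<delta>1(2)[OF p(1) f1] \<delta>2(2)[OF p(1) f2] by blast
  qed
  obtain p0 where p0: "p0 tagged_division_of {a..b}" "ms_dist M (RS g p0) J < ennreal 1"
    using approx[of 1] by auto
  show s: "sq_int M J"
    by (rule sq_int_of_ms_dist[OF RS_props(1)[OF p0(1)] mJ]) (use p0(2) in \<open>auto intro: less_trans\<close>)
  have E: "E2 M (\<lambda>\<omega>. RS g p \<omega> - J \<omega>) < \<epsilon>" if "p tagged_division_of {a..b}" "ms_dist M (RS g p) J < ennreal \<epsilon>" "0 < \<epsilon>" for p \<epsilon>
    using that ms_dist_E2[OF sq_int_diff(1)[OF RS_props(1)[OF that(1)] s]] by (simp add: ennreal_less_iff E2_nonneg)
  show "\<exists>p. p tagged_division_of {a..b} \<and> E2 M (\<lambda>\<omega>. RS g p \<omega> - J \<omega>) \<le> \<epsilon>" if pos: "0 < \<epsilon>" for \<epsilon>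
  proof -
    obtain p where "p tagged_division_of {a..b}" "ms_dist M (RS g p) J < ennreal \<epsilon>"
      using approx[OF pos] by blast
    then show ?thesis using E[OF _ _ pos, of p] by (intro exI[of _ p]) simp
  qed
  fix \<alpha> :: "'a \<Rightarrow> real" assume \<alpha>: "sq_int M \<alpha>"
  have "\<exists>p. p tagged_division_of {a..b} \<and> E2 M (\<lambda>\<omega>. RS g p \<omega> - J \<omega>) < 1 / real (Suc n) \<and>
      cmod (pairing M (RS g p) \<alpha> - IP g a b \<alpha>) \<le> 1 / real (Suc n) * sqrt (E2 M \<alpha>)" for n
  proof -
    have pos: "0 < 1 / real (Suc n)" by simp
    obtain p where "p tagged_division_of {a..b}" "ms_dist M (RS g p) J < ennreal (1 / real (Suc n))"
      "\<forall>\<alpha>. sq_int M \<alpha> \<longrightarrow> cmod (pairing M (RS g p) \<alpha> - IP g a b \<alpha>) \<le> 1 / real (Suc n) * sqrt (E2 M \<alpha>)"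
      using approx[OF pos] by blast
    then show ?thesis using E[OF _ _ pos, of p] \<alpha> by (intro exI[of _ p]) blast
  qed
  then obtain p where p: "\<And>n. p n tagged_division_of {a..b}" "\<And>n. E2 M (\<lambda>\<omega>. RS g (p n) \<omega> - J \<omega>) < 1 / real (Suc n)"
    "\<And>n. cmod (pairing M (RS g (p n)) \<alpha> - IP g a b \<alpha>) \<le> 1 / real (Suc n) * sqrt (E2 M \<alpha>)"
    by metis
  note l0 = inverse_Suc_tendsto
  have "(\<lambda>n. E2 M (\<lambda>\<omega>. RS g (p n) \<omega> - J \<omega>)) \<longlonglongrightarrow> 0"
    by (rule tendsto_sandwich[OF _ _ tendsto_const l0]) (use less_imp_le[OF p(2)] E2_nonneg in \<open>auto intro!: eventuallyI\<close>)
  from sq_int_tendsto[OF RS_props(1)[OF p(1)] s \<alpha> this]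
  have 1: "(\<lambda>n. LINT \<omega>|M. RS g (p n) \<omega> * of_real (\<alpha> \<omega>)) \<longlonglongrightarrow> pairing M J \<alpha>" .
  have "(\<lambda>n. 1 / real (Suc n) * sqrt (E2 M \<alpha>)) \<longlonglongrightarrow> 0" using tendsto_mult_left_zero[OF l0] by simp
  then have "(\<lambda>n. pairing M (RS g (p n)) \<alpha> - IP g a b \<alpha>) \<longlonglongrightarrow> 0"
    by (rule Lim_null_comparison[rotated]) (use p(3) in \<open>auto intro!: eventuallyI\<close>)
  then have "(\<lambda>n. LINT \<omega>|M. RS g (p n) \<omega> * of_real (\<alpha> \<omega>)) \<longlonglongrightarrow> IP g a b \<alpha>" by (simp add: LIM_zero_iff)
  with 1 show "pairing M J \<alpha> = IP g a b \<alpha>" by (rule LIMSEQ_unique)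
qed

section \<open>Mean-square integrals over the whole line\<close>

definition IR :: "(real \<Rightarrow> complex) \<Rightarrow> ('a \<Rightarrow> real) \<Rightarrow> complex" where
  "IR g \<alpha> = (LINT t|lborel. of_real (pf \<alpha> t) * cnj (g t))"

definition tail :: "(real \<Rightarrow> complex) \<Rightarrow> nat \<Rightarrow> real" where
  "tail g N = (LINT t|lborel. indicator (- {- real N..real N}) t *\<^sub>R (gw \<beta> t * cmod (g t)))"

lemma tail_nonneg: "0 \<le> tail g N"
  unfolding tail_def by (rule integral_nonneg_AE) simp

lemma tail_tendsto:
  assumes i: "integrable lborel (\<lambda>t. gw \<beta> t * cmod (g t))"
  shows "tail g \<longlonglongrightarrow> 0"
proof -
  have "(\<lambda>N. LINT t|lborel. indicator (- {- real N..real N}) t *\<^sub>R (gw \<beta> t * cmod (g t))) \<longlonglongrightarrow> (LINT t|(lborel :: real measure). (0::real))"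
  proof (rule integral_dominated_convergence[where w = "\<lambda>t. gw \<beta> t * cmod (g t)"])
    show "AE t in lborel. (\<lambda>N. indicator (- {- real N..real N}) t *\<^sub>R (gw \<beta> t * cmod (g t))) \<longlonglongrightarrow> 0"
    proof (rule AE_I2)
      fix t :: real
      obtain N where N: "\<bar>t\<bar> \<le> real N" using real_arch_simple by blast
      have "\<forall>\<^sub>F n in sequentially. indicator (- {- real n..real n}) t *\<^sub>R (gw \<beta> t * cmod (g t)) = 0"
        using eventually_ge_at_top[of N] by eventually_elim (use N in \<open>auto simp: indicator_def\<close>)
      then show "(\<lambda>N. indicator (- {- real N..real N}) t *\<^sub>R (gw \<beta> t * cmod (g t))) \<longlonglongrightarrow> 0"
        by (rule tendsto_eventually)
    qed
    show "(\<lambda>t. indicator (- {- real N..real N}) t *\<^sub>R (gw \<beta> t * cmod (g t))) \<in> borel_measurable lborel" for N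
      by (rule borel_measurable_integrable, intro integrable_mult_indicator i) simp
  qed (use i in \<open>auto simp: indicator_def\<close>)
  then show ?thesis unfolding tail_def[abs_def] by simp
qed

lemma IP_IR:
  assumes g: "continuous_on UNIV g" and i: "integrable lborel (\<lambda>t. gw \<beta> t * cmod (g t))" and \<alpha>: "sq_int M \<alpha>"
    and ab: "a \<le> - real N" "real N \<le> b"
  shows "cmod (IP g a b \<alpha> - IR g \<alpha>) \<le> tail g N * sqrt (E2 M \<alpha>)"
proof -
  note h = pf_holder[OF \<alpha>]
  let ?q = "\<lambda>t. complex_of_real (pf \<alpha> t) * cnj (g t)"
  have mp: "pf \<alpha> \<in> borel_measurable borel" by (rule borel_measurable_continuous_onI[OF holder_continuous[OF h \<beta>]])
  have mg: "g \<in> borel_measurable borel" by (rule borel_measurable_continuous_onI[OF g])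
  have mq: "?q \<in> borel_measurable borel" using mp mg by measurable
  have b: "norm (?q t) \<le> sqrt (E2 M \<alpha>) * (gw \<beta> t * cmod (g t))" for t
    using mult_right_mono[OF holder_growth[OF h less_imp_le[OF \<beta>], of t] norm_ge_zero[of "g t"]]
    by (simp add: norm_mult mult_ac)
  have iB: "integrable lborel (\<lambda>t. sqrt (E2 M \<alpha>) * (gw \<beta> t * cmod (g t)))" by (intro integrable_mult_right i)
  have iq: "integrable lborel ?q"
    by (rule Bochner_Integration.integrable_bound[OF iB])
       (use mq b in \<open>auto intro!: AE_I2 intro: order_trans[OF _ abs_ge_self]\<close>)
  have i1: "integrable lborel (\<lambda>t. indicator {a..b} t *\<^sub>R ?q t)" and i2: "integrable lborel (\<lambda>t. indicator (- {a..b}) t *\<^sub>R ?q t)"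
    by (intro integrable_mult_indicator iq; simp)+
  have "IR g \<alpha> = (LINT t|lborel. indicator {a..b} t *\<^sub>R ?q t + indicator (- {a..b}) t *\<^sub>R ?q t)"
    unfolding IR_def by (intro Bochner_Integration.integral_cong) (auto simp: indicator_def)
  also have "\<dots> = IP g a b \<alpha> + (LINT t|lborel. indicator (- {a..b}) t *\<^sub>R ?q t)"
    unfolding IP_def set_lebesgue_integral_def by (rule Bochner_Integration.integral_add[OF i1 i2])
  finally have "cmod (IP g a b \<alpha> - IR g \<alpha>) = cmod (LINT t|lborel. indicator (- {a..b}) t *\<^sub>R ?q t)" by simp
  also have "\<dots> \<le> (LINT t|lborel. sqrt (E2 M \<alpha>) * (indicator (- {- real N..real N}) t *\<^sub>R (gw \<beta> t * cmod (g t))))"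
  proof (rule integral_norm_le[OF i2])
    show "integrable lborel (\<lambda>t. sqrt (E2 M \<alpha>) * (indicator (- {- real N..real N}) t *\<^sub>R (gw \<beta> t * cmod (g t))))"
      by (intro integrable_mult_right integrable_mult_indicator i) simp
    show "norm (indicator (- {a..b}) t *\<^sub>R ?q t) \<le> sqrt (E2 M \<alpha>) * (indicator (- {- real N..real N}) t *\<^sub>R (gw \<beta> t * cmod (g t)))" for t
    proof (cases "t \<in> {a..b}")
      case True
      then show ?thesis by (simp add: E2_nonneg)
    next
      case False
      then have "t \<in> - {- real N..real N}" using ab by auto
      then show ?thesis using False b[of t] by (simp add: indicator_def)
    qed
  qed
  also have "\<dots> = tail g N * sqrt (E2 M \<alpha>)" unfolding tail_def by simp
  finally show ?thesis .
qed

text \<open>The integrals over \<open>[-N, N]\<close> approximate the functional \<open>IR g\<close>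
  with relative error \<open>tail g N\<close>, and the same estimate holds for every larger
  interval. It yields the representing variable and then the convergence along both
  endpoints.\<close>

lemma ms_integral_exists:
  assumes g: "continuous_on UNIV g" and i: "integrable lborel (\<lambda>t. gw \<beta> t * cmod (g t))"
  shows "\<exists>Y. has_ms_integral M (integrand g) Y"
proof -
  have "\<exists>J. a \<le> b \<longrightarrow> has_ms_integral_on M (integrand g) a b J" for a b
    using ms_integral_on_exists[OF g] by blast
  then obtain J where J: "\<And>a b. a \<le> b \<Longrightarrow> has_ms_integral_on M (integrand g) a b (J a b)"
    by metis
  note Jp = ms_integral_on_props[OF g _ J]
  have err: "cmod (pairing M (J a b) \<alpha> - IR g \<alpha>) \<le> tail g N * sqrt (E2 M \<alpha>)"
    if "a \<le> - real N" "real N \<le> b" "sq_int M \<alpha>" for a b N \<alpha>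
  proof -
    have ab: "a \<le> b" using that(1,2) by linarith
    show ?thesis unfolding Jp(2)[OF ab ab that(3)] by (rule IP_IR[OF g i that(3,1,2)])
  qed
  have small: "\<exists>N. tail g N \<le> \<eta>" if "0 < \<eta>" for \<eta>
  proof -
    have "\<forall>\<^sub>F N in sequentially. tail g N < \<eta>" using tail_tendsto[OF i] that by (rule order_tendstoD(2))
    then show ?thesis using less_imp_le unfolding eventually_sequentially by blast
  qed
  have "\<exists>Y. sq_int M Y \<and> (\<forall>\<alpha>. sq_int M \<alpha> \<longrightarrow> cmod (pairing M Y \<alpha> - IR g \<alpha>) \<le> \<eta> * sqrt (E2 M \<alpha>))"
    if \<eta>: "0 < \<eta>" for \<eta>
  proof -
    obtain N where N: "tail g N \<le> \<eta>" using small[OF \<eta>] by blast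
    have ab: "- real N \<le> real N" by simp
    have "cmod (pairing M (J (- real N) (real N)) \<alpha> - IR g \<alpha>) \<le> \<eta> * sqrt (E2 M \<alpha>)" if "sq_int M \<alpha>" for \<alpha>
      using err[OF order_refl order_refl that, of N] mult_right_mono[OF N, of "sqrt (E2 M \<alpha>)"] E2_nonneg[of M \<alpha>] by simp
    then show ?thesis using Jp(1)[OF ab ab] by blast
  qed
  then obtain Z where Z: "sq_int M Z" "\<And>\<alpha>. sq_int M \<alpha> \<Longrightarrow> pairing M Z \<alpha> = IR g \<alpha>"
    using dual_representation[of "IR g"] by blast
  have d: "ms_dist M (J a b) Z \<le> ennreal (2 * (tail g N)\<^sup>2)" if "a \<le> - real N" "real N \<le> b" for a b N
  proof -
    have ab: "a \<le> b" using that by linarith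
    have "E2 M (\<lambda>\<omega>. J a b \<omega> - Z \<omega>) \<le> 2 * (tail g N)\<^sup>2"
      by (rule dual_distance[OF Jp(1)[OF ab ab] Z(1) tail_nonneg Z(2) err[OF that]])
    then show ?thesis unfolding ms_dist_E2[OF sq_int_diff(1)[OF Jp(1)[OF ab ab] Z(1)]] by (rule ennreal_leI)
  qed
  have "((\<lambda>(a, b). ms_dist M (J a b) Z) \<longlongrightarrow> 0) (at_bot \<times>\<^sub>F at_top)"
  proof (rule order_tendstoI)
    fix y :: ennreal assume y: "0 < y"
    have "(\<lambda>N. ennreal (2 * (tail g N)\<^sup>2)) \<longlonglongrightarrow> ennreal (2 * 0\<^sup>2)"
      by (intro tendsto_ennrealI tendsto_intros tail_tendsto i)
    then have "\<forall>\<^sub>F N in sequentially. ennreal (2 * (tail g N)\<^sup>2) < y"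
      using y by (intro order_tendstoD(2)) auto
    then obtain N where N: "ennreal (2 * (tail g N)\<^sup>2) < y" by (auto simp: eventually_sequentially)
    show "\<forall>\<^sub>F x in at_bot \<times>\<^sub>F at_top. (case x of (a, b) \<Rightarrow> ms_dist M (J a b) Z) < y"
      unfolding eventually_prod_filter
    proof (intro exI conjI allI impI)
      show "\<forall>\<^sub>F a in at_bot. a \<le> - real N" by (rule eventually_le_at_bot)
      show "\<forall>\<^sub>F b in at_top. real N \<le> b" by (rule eventually_ge_at_top)
      fix a b assume "a \<le> - real N" "real N \<le> b"
      then show "(case (a, b) of (a, b) \<Rightarrow> ms_dist M (J a b) Z) < y"
        using d[of a N b] N by (auto intro: le_less_trans)
    qed
  qed simp
  then have "has_ms_integral M (integrand g) Z"
    unfolding has_ms_integral_def using Z(1) J by blast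
  then show ?thesis by blast
qed

text \<open>For the moment bound, Riemann sums over \<open>[-n, n]\<close> at squared distance at
  most \<open>1 / (n + 1)\<close> from the integral over that interval are chosen. They converge to
  \<open>Y\<close> in mean square, and \<open>moment_L2_limit\<close> applies.\<close>

lemma ms_integral_props:
  assumes g: "continuous_on UNIV g" and i: "integrable lborel (\<lambda>t. gw \<beta> t * cmod (g t))"
    and Y: "has_ms_integral M (integrand g) Y"
  shows "sq_int M Y" "\<And>\<alpha>. sq_int M \<alpha> \<Longrightarrow> pairing M Y \<alpha> = IR g \<alpha>"
    and "(\<integral>\<^sup>+ \<omega>. ennreal (cmod (Y \<omega>) ^ 16) \<partial>M) \<le> ennreal (C16 * (2 * E2 M Y) ^ 8)"
proof -
  have mY: "Y \<in> borel_measurable M" using Y by (simp add: has_ms_integral_def)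
  obtain J where J: "\<And>a b. a \<le> b \<Longrightarrow> has_ms_integral_on M (integrand g) a b (J a b)"
    and lim: "((\<lambda>(a, b). ms_dist M (J a b) Y) \<longlongrightarrow> 0) (at_bot \<times>\<^sub>F at_top)"
    using Y by (auto simp: has_ms_integral_def)
  define K where "K n = J (- real n) (real n)" for n :: nat
  have nn: "- real n \<le> real n" for n by simp
  note Kp = ms_integral_on_props[OF g nn J[OF nn], folded K_def]
  have "filterlim (\<lambda>n. (- real n, real n)) (at_bot \<times>\<^sub>F at_top) sequentially"
    by (intro filterlim_Pair filterlim_real_sequentially
        filterlim_compose[OF filterlim_uminus_at_bot_at_top filterlim_real_sequentially])
  from filterlim_compose[OF lim this]
  have Kl: "(\<lambda>n. ms_dist M (K n) Y) \<longlonglongrightarrow> 0" by (simp add: K_def)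
  then have "\<forall>\<^sub>F n in sequentially. ms_dist M (K n) Y < 1" by (rule order_tendstoD(2)) simp
  then obtain n0 where n0: "ms_dist M (K n0) Y < 1" by (auto simp: eventually_sequentially)
  show s: "sq_int M Y"
    by (rule sq_int_of_ms_dist[OF Kp(1) mY]) (use n0 in \<open>auto intro: less_trans\<close>)
  have "(\<lambda>n. ennreal (E2 M (\<lambda>\<omega>. K n \<omega> - Y \<omega>))) \<longlonglongrightarrow> ennreal 0"
    using Kl by (simp add: ms_dist_E2[OF sq_int_diff(1)[OF Kp(1) s]])
  then have El: "(\<lambda>n. E2 M (\<lambda>\<omega>. K n \<omega> - Y \<omega>)) \<longlonglongrightarrow> 0"
    by (subst (asm) tendsto_ennreal_iff) (auto simp: E2_nonneg)
  show "pairing M Y \<alpha> = IR g \<alpha>" if \<alpha>: "sq_int M \<alpha>" for \<alpha>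
  proof -
    have 1: "(\<lambda>n. IP g (- real n) (real n) \<alpha>) \<longlonglongrightarrow> pairing M Y \<alpha>"
      using sq_int_tendsto[OF Kp(1) s \<alpha> El] by (simp add: Kp(2)[OF \<alpha>])
    have "(\<lambda>n. tail g n * sqrt (E2 M \<alpha>)) \<longlonglongrightarrow> 0" by (rule tendsto_mult_left_zero[OF tail_tendsto[OF i]])
    then have "(\<lambda>n. IP g (- real n) (real n) \<alpha> - IR g \<alpha>) \<longlonglongrightarrow> 0"
      by (rule Lim_null_comparison[rotated]) (use IP_IR[OF g i \<alpha>] in \<open>auto intro!: eventuallyI\<close>)
    then have "(\<lambda>n. IP g (- real n) (real n) \<alpha>) \<longlonglongrightarrow> IR g \<alpha>" by (simp add: LIM_zero_iff)
    with 1 show ?thesis by (rule LIMSEQ_unique)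
  qed
  have "\<exists>p. p tagged_division_of {- real n..real n} \<and> E2 M (\<lambda>\<omega>. RS g p \<omega> - K n \<omega>) \<le> 1 / real (Suc n)" for n
    by (rule Kp(3)) simp
  then obtain p where p: "\<And>n. p n tagged_division_of {- real n..real n}" "\<And>n. E2 M (\<lambda>\<omega>. RS g (p n) \<omega> - K n \<omega>) \<le> 1 / real (Suc n)"
    by metis
  note Rs = RS_props[OF p(1)]
  have bd: "E2 M (\<lambda>\<omega>. RS g (p n) \<omega> - Y \<omega>) \<le> 2 * (1 / real (Suc n)) + 2 * E2 M (\<lambda>\<omega>. K n \<omega> - Y \<omega>)" for n
  proof -
    have "E2 M (\<lambda>\<omega>. (RS g (p n) \<omega> - K n \<omega>) + (K n \<omega> - Y \<omega>)) \<le> 2 * E2 M (\<lambda>\<omega>. RS g (p n) \<omega> - K n \<omega>) + 2 * E2 M (\<lambda>\<omega>. K n \<omega> - Y \<omega>)"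
      by (rule sq_int_add(2)[OF sq_int_diff(1)[OF Rs(1) Kp(1)] sq_int_diff(1)[OF Kp(1) s]])
    then show ?thesis using p(2)[of n] by simp
  qed
  from tendsto_add[OF tendsto_mult[OF tendsto_const[of 2] inverse_Suc_tendsto] tendsto_mult[OF tendsto_const[of 2] El]]
  have up: "(\<lambda>n. 2 * (1 / real (Suc n)) + 2 * E2 M (\<lambda>\<omega>. K n \<omega> - Y \<omega>)) \<longlonglongrightarrow> 0" by simp
  have "(\<lambda>n. E2 M (\<lambda>\<omega>. RS g (p n) \<omega> - Y \<omega>)) \<longlonglongrightarrow> 0"
    by (rule tendsto_sandwich[OF _ _ tendsto_const up]) (use bd E2_nonneg in \<open>auto intro!: eventuallyI\<close>)
  then show "(\<integral>\<^sup>+ \<omega>. ennreal (cmod (Y \<omega>) ^ 16) \<partial>M) \<le> ennreal (C16 * (2 * E2 M Y) ^ 8)"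
    by (intro moment_L2_limit[OF Rs(1) s Rs(2)]) (simp_all add: C16_def c16_def)
qed

end

subsection \<open>Wavelet coefficients of the process\<close>

lemma dilate_nat: "dilate g (int j) k x = of_real (2 powr (real j / 2)) * g (2 ^ j * x - of_int k)"
  by (simp add: dilate_def powr_realpow)

context amalgam
begin

lemma dilate_continuous: "continuous_on UNIV (dilate g (int j) k)"
proof -
  have "continuous_on UNIV (\<lambda>x. g (2 ^ j * x - of_int k))"
    by (rule continuous_on_compose2[OF cont]) (auto intro!: continuous_intros)
  then show ?thesis unfolding dilate_nat[abs_def] by (intro continuous_intros)
qed

lemma dilate_integrable: "integrable lborel (\<lambda>t. gw \<beta> t * cmod (dilate g (int j) k t))"
proof -
  let ?h = "\<lambda>t. gw \<beta> (- of_int k + 2 ^ j * t) * cmod (g (- of_int k + 2 ^ j * t))"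
  have "integrable lborel ?h" by (rule lborel_integrable_real_affine[OF integrable_gw_g]) simp
  then have i: "integrable lborel (\<lambda>t. (2 powr (real j / 2) * gw \<beta> (of_int k)) * ?h t)" by (rule integrable_mult_right)
  have md: "dilate g (int j) k \<in> borel_measurable borel" by (rule borel_measurable_continuous_onI[OF dilate_continuous])
  show ?thesis
  proof (rule Bochner_Integration.integrable_bound[OF i])
    show "(\<lambda>t. gw \<beta> t * cmod (dilate g (int j) k t)) \<in> borel_measurable lborel" using md by measurable
    show "AE t in lborel. norm (gw \<beta> t * cmod (dilate g (int j) k t)) \<le> norm ((2 powr (real j / 2) * gw \<beta> (of_int k)) * ?h t)"
    proof (rule AE_I2)
      fix t :: real
      \<comment> \<open>Since \<open>j\<close> is a natural number, the dilation can only increase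
        \<open>|t|\<close> and with it the weight.\<close>
      have "\<bar>t\<bar> \<le> \<bar>2 ^ j * t\<bar>" by (simp add: abs_mult mult_le_cancel_right1)
      then have "gw \<beta> t \<le> gw \<beta> (of_int k + (- of_int k + 2 ^ j * t))" by (simp add: gw_mono[OF \<beta>])
      also have "\<dots> \<le> gw \<beta> (of_int k) * gw \<beta> (- of_int k + 2 ^ j * t)" by (rule gw_submult[OF \<beta>])
      finally have le: "gw \<beta> t \<le> gw \<beta> (of_int k) * gw \<beta> (- of_int k + 2 ^ j * t)" .
      have de: "cmod (dilate g (int j) k t) = 2 powr (real j / 2) * cmod (g (- of_int k + 2 ^ j * t))"
        by (simp add: dilate_nat norm_mult)
      have "gw \<beta> t * cmod (dilate g (int j) k t) \<le> (2 powr (real j / 2) * gw \<beta> (of_int k)) * ?h t"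
        using mult_right_mono[OF le, of "2 powr (real j / 2) * cmod (g (- of_int k + 2 ^ j * t))"]
        unfolding de by (simp only: mult_ac) simp
      then show "norm (gw \<beta> t * cmod (dilate g (int j) k t)) \<le> norm ((2 powr (real j / 2) * gw \<beta> (of_int k)) * ?h t)"
        by simp
    qed
  qed
qed

lemma integral_dilate:
  "(LINT t|lborel. f t * cnj (dilate g (int j) k t)) = of_real (2 powr (- real j / 2)) * wcoef g (\<lambda>u. f (u / 2 ^ j)) k"
proof -
  have "(LINT t|lborel. f t * cnj (dilate g (int j) k t))
      = \<bar>1 / 2 ^ j\<bar> *\<^sub>R (LINT u|lborel. f (0 + 1 / 2 ^ j * u) * cnj (dilate g (int j) k (0 + 1 / 2 ^ j * u)))"
    by (rule lborel_integral_real_affine) simp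
  also have "\<dots> = (1 / 2 ^ j) *\<^sub>R (LINT u|lborel. of_real (2 powr (real j / 2)) * (f (u / 2 ^ j) * cnj (g (u - of_int k))))"
    by (simp add: dilate_nat mult_ac)
  also have "\<dots> = (1 / 2 ^ j) *\<^sub>R (of_real (2 powr (real j / 2)) * wcoef g (\<lambda>u. f (u / 2 ^ j)) k)"
    unfolding wcoef_def by simp
  also have "\<dots> = of_real (1 / 2 ^ j * 2 powr (real j / 2)) * wcoef g (\<lambda>u. f (u / 2 ^ j)) k"
    by (simp add: scaleR_conv_of_real)
  also have "1 / 2 ^ j * 2 powr (real j / 2) = 2 powr (- real j / 2)"
  proof -
    have "1 / 2 ^ j = 2 powr (- real j)" by (simp add: powr_minus powr_realpow divide_inverse)
    then show ?thesis by (simp flip: powr_add)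
  qed
  finally show ?thesis .
qed

end

locale fbm_wavelet = abs_fbm M W \<beta> + wavelet_pair \<beta> w \<phi> \<psi> F'
  for M :: "'a measure" and W :: "real \<Rightarrow> 'a \<Rightarrow> real" and \<beta> :: real and w :: "int \<Rightarrow> real"
    and \<phi> \<psi> F' :: "real \<Rightarrow> complex"
begin

abbreviation coef :: "(real \<Rightarrow> complex) \<Rightarrow> nat \<Rightarrow> int \<Rightarrow> 'a \<Rightarrow> complex" where
  "coef g j k \<equiv> wavelet_coeff M W g (int j) k"

text \<open>The coefficient is picked by a choice operator. Existence makes the choice a genuine
  mean-square integral, and all properties used hold for every version.\<close>

lemma coef_props:
  assumes g: "amalgam \<beta> w g"
  shows "sq_int M (coef g j k)"
    and "\<And>\<alpha>. sq_int M \<alpha> \<Longrightarrow> pairing M (coef g j k) \<alpha>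
        = of_real (2 powr (- real j / 2)) * wcoef g (\<lambda>u. of_real (pf \<alpha> (u / 2 ^ j))) k"
    and "(\<integral>\<^sup>+ \<omega>. ennreal (cmod (coef g j k \<omega>) ^ 16) \<partial>M) \<le> ennreal (C16 * (2 * E2 M (coef g j k)) ^ 8)"
proof -
  let ?d = "dilate g (int j) k"
  note c = amalgam.dilate_continuous[OF g, of j k] and i = amalgam.dilate_integrable[OF g, of j k]
  have "coef g j k = (SOME Y. has_ms_integral M (integrand ?d) Y)"
    by (simp only: wavelet_coeff_def ms_integral_def integrand_def[abs_def])
  then have "has_ms_integral M (integrand ?d) (coef g j k)"
    using someI_ex[OF ms_integral_exists[OF c i]] by (simp only:)
  note p = ms_integral_props[OF c i this]
  show "sq_int M (coef g j k)" by (rule p(1))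
  show "(\<integral>\<^sup>+ \<omega>. ennreal (cmod (coef g j k \<omega>) ^ 16) \<partial>M) \<le> ennreal (C16 * (2 * E2 M (coef g j k)) ^ 8)" by (rule p(3))
  show "pairing M (coef g j k) \<alpha>
        = of_real (2 powr (- real j / 2)) * wcoef g (\<lambda>u. of_real (pf \<alpha> (u / 2 ^ j))) k" if "sq_int M \<alpha>" for \<alpha>
    unfolding p(2)[OF that] IR_def by (rule amalgam.integral_dilate[OF g])
qed

lemma am: "amalgam \<beta> w \<phi>" "amalgam \<beta> w \<psi>" by unfold_locales

lemma coef_psi_E2: "E2 M (coef \<psi> j k) \<le> 2 * (2 powr (- real j / 2) * 2 powr (- \<beta> * real j) * S)\<^sup>2"
proof (rule sq_int_duality[OF coef_props(1)[OF am(2)]])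
  show "0 \<le> 2 powr (- real j / 2) * 2 powr (- \<beta> * real j) * S" using phi.S_nonneg by simp
  fix \<alpha> :: "'a \<Rightarrow> real" assume \<alpha>: "sq_int M \<alpha>"
  have "cmod (pairing M (coef \<psi> j k) \<alpha>) = 2 powr (- real j / 2) * cmod (wcoef \<psi> (\<lambda>u. of_real (pf \<alpha> (u / 2 ^ j))) k)"
    unfolding coef_props(2)[OF am(2) \<alpha>] by (simp add: norm_mult)
  also have "\<dots> \<le> 2 powr (- real j / 2) * (sqrt (E2 M \<alpha>) * 2 powr (- \<beta> * real j) * S)"
    by (rule mult_left_mono[OF psi_coefficient_bound[OF pf_holder[OF \<alpha>] \<beta>]]) simp
  finally show "cmod (pairing M (coef \<psi> j k) \<alpha>) \<le> 2 powr (- real j / 2) * 2 powr (- \<beta> * real j) * S * sqrt (E2 M \<alpha>)"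
    by (simp only: mult_ac)
qed

lemma coef_phi_E2: "E2 M (coef \<phi> 0 k) \<le> 2 * (S * gw \<beta> (of_int k))\<^sup>2"
proof (rule sq_int_duality[OF coef_props(1)[OF am(1)]])
  show "0 \<le> S * gw \<beta> (of_int k)" using phi.S_nonneg by simp
  fix \<alpha> :: "'a \<Rightarrow> real" assume \<alpha>: "sq_int M \<alpha>"
  have "cmod (pairing M (coef \<phi> 0 k) \<alpha>) = cmod (wcoef \<phi> (\<lambda>u. of_real (pf \<alpha> u)) k)"
    unfolding coef_props(2)[OF am(1) \<alpha>] by simp
  also have "\<dots> \<le> sqrt (E2 M \<alpha>) * S * gw \<beta> (of_int k)"
    by (rule phi_coefficient_bound[OF pf_holder[OF \<alpha>] \<beta>])
  finally show "cmod (pairing M (coef \<phi> 0 k) \<alpha>) \<le> S * gw \<beta> (of_int k) * sqrt (E2 M \<alpha>)"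
    by (simp only: mult_ac)
qed

abbreviation expansion :: "nat \<Rightarrow> nat \<Rightarrow> (nat \<Rightarrow> nat) \<Rightarrow> real \<Rightarrow> 'a \<Rightarrow> complex" where
  "expansion \<equiv> wavelet_expansion M W \<phi> \<psi>"

lemma expansion_alt: "expansion n k0 k t \<omega> =
  (\<Sum>l\<in>{- int k0..int k0}. coef \<phi> 0 l \<omega> * dilate \<phi> (int 0) l t) +
  (\<Sum>j<n. \<Sum>l\<in>{- int (k j)..int (k j)}. coef \<psi> j l \<omega> * dilate \<psi> (int j) l t)"
  unfolding wavelet_expansion_def by simp

lemma coef_mult:
  assumes "amalgam \<beta> w g"
  shows "sq_int M (\<lambda>\<omega>. coef g j l \<omega> * c)"
  using sq_int_scale(1)[OF coef_props(1)[OF assms, of j l], of c] by (simp add: mult.commute)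

lemma expansion_sq_int: "sq_int M (expansion n k0 k t)"
proof -
  have "sq_int M (\<lambda>\<omega>. (\<Sum>l\<in>{- int k0..int k0}. coef \<phi> 0 l \<omega> * dilate \<phi> (int 0) l t) +
     (\<Sum>j<n. \<Sum>l\<in>{- int (k j)..int (k j)}. coef \<psi> j l \<omega> * dilate \<psi> (int j) l t))"
    by (intro sq_int_add(1) sq_int_sum coef_mult am)
  then show ?thesis by (simp only: expansion_alt[abs_def])
qed

text \<open>The normalizations \<open>2 powr (j / 2)\<close> of the dilate and
  \<open>2 powr (- j / 2)\<close> of the coefficient cancel, and a summand of the series
  \<open>proj\<close> at \<open>2 ^ j * t\<close> remains.\<close>

lemma coef_term_pairing:
  assumes g: "amalgam \<beta> w g" and \<alpha>: "sq_int M \<alpha>"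
  shows "integrable M (\<lambda>\<omega>. coef g j l \<omega> * dilate g (int j) l t * of_real (\<alpha> \<omega>))"
    and "(LINT \<omega>|M. coef g j l \<omega> * dilate g (int j) l t * of_real (\<alpha> \<omega>))
      = wcoef g (\<lambda>u. of_real (pf \<alpha> (u / 2 ^ j))) l * g (2 ^ j * t - of_int l)"
proof -
  show "integrable M (\<lambda>\<omega>. coef g j l \<omega> * dilate g (int j) l t * of_real (\<alpha> \<omega>))"
    by (rule sq_int_mult(1)[OF coef_mult[OF g] \<alpha>])
  have "(LINT \<omega>|M. coef g j l \<omega> * dilate g (int j) l t * of_real (\<alpha> \<omega>)) =
      (LINT \<omega>|M. dilate g (int j) l t * (coef g j l \<omega> * of_real (\<alpha> \<omega>)))"
    by (simp only: mult_ac)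
  also have "\<dots> = dilate g (int j) l t * (of_real (2 powr (- real j / 2)) * wcoef g (\<lambda>u. of_real (pf \<alpha> (u / 2 ^ j))) l)"
    by (simp only: integral_mult_right_zero coef_props(2)[OF g \<alpha>])
  also have "\<dots> = of_real (2 powr (real j / 2) * 2 powr (- real j / 2)) * (wcoef g (\<lambda>u. of_real (pf \<alpha> (u / 2 ^ j))) l * g (2 ^ j * t - of_int l))"
    unfolding dilate_nat of_real_mult by (simp only: mult_ac)
  also have "2 powr (real j / 2) * 2 powr (- real j / 2) = (1::real)" by (simp flip: powr_add)
  finally show "(LINT \<omega>|M. coef g j l \<omega> * dilate g (int j) l t * of_real (\<alpha> \<omega>))
      = wcoef g (\<lambda>u. of_real (pf \<alpha> (u / 2 ^ j))) l * g (2 ^ j * t - of_int l)" by simp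
qed

lemma expansion_pairing:
  assumes \<alpha>: "sq_int M \<alpha>"
  shows "pairing M (expansion n k0 k t) \<alpha> =
    (\<Sum>l\<in>{- int k0..int k0}. wcoef \<phi> (\<lambda>u. of_real (pf \<alpha> u)) l * \<phi> (t - of_int l)) +
    (\<Sum>j<n. \<Sum>l\<in>{- int (k j)..int (k j)}. wcoef \<psi> (\<lambda>u. of_real (pf \<alpha> (u / 2 ^ j))) l * \<psi> (2 ^ j * t - of_int l))"
proof -
  note ip = coef_term_pairing[OF am(1) \<alpha>] and iq = coef_term_pairing[OF am(2) \<alpha>]
  have "pairing M (expansion n k0 k t) \<alpha> =
      (LINT \<omega>|M. (\<Sum>l\<in>{- int k0..int k0}. coef \<phi> 0 l \<omega> * dilate \<phi> (int 0) l t * of_real (\<alpha> \<omega>)) +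
      (\<Sum>j<n. \<Sum>l\<in>{- int (k j)..int (k j)}. coef \<psi> j l \<omega> * dilate \<psi> (int j) l t * of_real (\<alpha> \<omega>)))"
    by (simp only: expansion_alt distrib_right sum_distrib_right)
  also have "\<dots> = (LINT \<omega>|M. (\<Sum>l\<in>{- int k0..int k0}. coef \<phi> 0 l \<omega> * dilate \<phi> (int 0) l t * of_real (\<alpha> \<omega>))) +
      (LINT \<omega>|M. (\<Sum>j<n. \<Sum>l\<in>{- int (k j)..int (k j)}. coef \<psi> j l \<omega> * dilate \<psi> (int j) l t * of_real (\<alpha> \<omega>)))"
    by (intro Bochner_Integration.integral_add Bochner_Integration.integrable_sum ip(1) iq(1))
  also have "(LINT \<omega>|M. (\<Sum>l\<in>{- int k0..int k0}. coef \<phi> 0 l \<omega> * dilate \<phi> (int 0) l t * of_real (\<alpha> \<omega>)))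
      = (\<Sum>l\<in>{- int k0..int k0}. LINT \<omega>|M. coef \<phi> 0 l \<omega> * dilate \<phi> (int 0) l t * of_real (\<alpha> \<omega>))"
    by (rule Bochner_Integration.integral_sum) (rule ip(1))
  also have "(LINT \<omega>|M. (\<Sum>j<n. \<Sum>l\<in>{- int (k j)..int (k j)}. coef \<psi> j l \<omega> * dilate \<psi> (int j) l t * of_real (\<alpha> \<omega>)))
      = (\<Sum>j<n. LINT \<omega>|M. (\<Sum>l\<in>{- int (k j)..int (k j)}. coef \<psi> j l \<omega> * dilate \<psi> (int j) l t * of_real (\<alpha> \<omega>)))"
    by (rule Bochner_Integration.integral_sum) (intro Bochner_Integration.integrable_sum iq(1))
  also have "(\<Sum>j<n. LINT \<omega>|M. (\<Sum>l\<in>{- int (k j)..int (k j)}. coef \<psi> j l \<omega> * dilate \<psi> (int j) l t * of_real (\<alpha> \<omega>)))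
      = (\<Sum>j<n. \<Sum>l\<in>{- int (k j)..int (k j)}. LINT \<omega>|M. coef \<psi> j l \<omega> * dilate \<psi> (int j) l t * of_real (\<alpha> \<omega>))"
    by (rule sum.cong[OF refl], rule Bochner_Integration.integral_sum) (rule iq(1))
  finally show ?thesis unfolding ip(2) iq(2) by simp
qed

section \<open>Mean-square convergence at a fixed point\<close>

definition trunc :: "real \<Rightarrow> nat \<Rightarrow> nat \<Rightarrow> real" where
  "trunc t j K = (LINT l|IZ. far K l * (S * gw \<beta> (2 ^ j * t) * w (\<lfloor>2 ^ j * t\<rfloor> - l)))"

lemma trunc_tendsto: "trunc t j \<longlonglongrightarrow> 0"
  unfolding trunc_def[abs_def] by (rule far_tendsto) (intro integrable_mult_right phi.integrable_IZ_\<omega>)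

lemma trunc_error:
  assumes g: "amalgam \<beta> w g" and h: "holder \<beta> H f" and HH: "H \<le> H'"
  shows "cmod (proj g (\<lambda>u. of_real (f u)) (2 ^ j * t) - (\<Sum>l\<in>{- int K..int K}. wcoef g (\<lambda>u. of_real (f u)) l * g (2 ^ j * t - of_int l)))
    \<le> H' * trunc t j K"
proof -
  have H: "0 \<le> H'" using h HH by (simp add: holder_def)
  have m: "(\<lambda>u. complex_of_real (f u)) \<in> borel_measurable borel"
    using borel_measurable_continuous_onI[OF holder_continuous[OF h \<beta>]] by measurable
  have b: "norm (complex_of_real (f u)) \<le> H' * gw \<beta> u" for u
    using holder_growth[OF h less_imp_le[OF \<beta>], of u] mult_right_mono[OF HH gw_nonneg[of \<beta> u]] by simp
  let ?u = "\<lambda>l. H' * (S * gw \<beta> (2 ^ j * t) * w (\<lfloor>2 ^ j * t\<rfloor> - l))"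
  have "cmod (proj g (\<lambda>u. of_real (f u)) (2 ^ j * t) - (\<Sum>l\<in>{- int K..int K}. wcoef g (\<lambda>u. of_real (f u)) l * g (2 ^ j * t - of_int l)))
      \<le> (LINT l|IZ. far K l * ?u l)"
    unfolding proj_def
  proof (rule IZ_truncation_error)
    show "integrable IZ ?u" by (intro integrable_mult_right phi.integrable_IZ_\<omega>)
    show "norm (wcoef g (\<lambda>u. of_real (f u)) l * g (2 ^ j * t - of_int l)) \<le> ?u l" for l
    proof -
      have "norm (wcoef g (\<lambda>u. of_real (f u)) l) \<le> H' * S * gw \<beta> (of_int l)"
        by (rule amalgam.wcoef_bound[OF g m b])
      from amalgam.term_bound[where a = "wcoef g (\<lambda>u. of_real (f u))" and k = l and x = "2 ^ j * t", OF g this]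
      show ?thesis unfolding mult.assoc .
    qed
  qed
  also have "\<dots> = (LINT l|IZ. H' * (far K l * (S * gw \<beta> (2 ^ j * t) * w (\<lfloor>2 ^ j * t\<rfloor> - l))))"
    by (intro Bochner_Integration.integral_cong refl) (simp add: mult_ac)
  also have "\<dots> = H' * trunc t j K" unfolding trunc_def by simp
  finally show ?thesis .
qed

text \<open>Paired with a test variable, the error splits into the truncation error of the
  translates of \<open>\<phi>\<close>, those of the levels \<open>j < n\<close>, and the resolution
  error at level \<open>n\<close>. Each is a multiple of the norm of the test variable.\<close>

lemma expansion_error:
  "E2 M (\<lambda>\<omega>. expansion n K (\<lambda>_. K) t \<omega> - of_real (W t \<omega>))
    \<le> 2 * (trunc t 0 K + (\<Sum>j<n. trunc t j K) + 2 powr (- \<beta> * real n) * S * S)\<^sup>2"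
proof (rule dual_distance[where lf = "\<lambda>\<alpha>. of_real (pf \<alpha> t)"])
  show "sq_int M (expansion n K (\<lambda>_. K) t)" by (rule expansion_sq_int)
  show "sq_int M (\<lambda>\<omega>. complex_of_real (W t \<omega>))" by (rule sq_int_of_real[OF W_sq_int])
  have w0: "0 \<le> w l" for l by (rule phi.\<omega>_nonneg)
  have t0: "0 \<le> trunc t j K" for j
    unfolding trunc_def using w0 phi.S_nonneg by (intro integral_nonneg_AE) (simp add: far_def)
  show "0 \<le> trunc t 0 K + (\<Sum>j<n. trunc t j K) + 2 powr (- \<beta> * real n) * S * S"
    using t0 phi.S_nonneg by (intro add_nonneg_nonneg sum_nonneg mult_nonneg_nonneg) auto
  fix \<alpha> :: "'a \<Rightarrow> real" assume \<alpha>: "sq_int M \<alpha>"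
  show "(LINT \<omega>|M. complex_of_real (W t \<omega>) * of_real (\<alpha> \<omega>)) = of_real (pf \<alpha> t)"
    unfolding pf_def by (simp only: of_real_mult[symmetric] integral_complex_of_real)
  let ?H = "sqrt (E2 M \<alpha>)"
  have H0: "0 \<le> ?H" by (simp add: E2_nonneg)
  note h = pf_holder[OF \<alpha>]
  let ?P = "\<lambda>l. wcoef \<phi> (\<lambda>u. of_real (pf \<alpha> u)) l * \<phi> (t - of_int l)"
  let ?Q = "\<lambda>j l. wcoef \<psi> (\<lambda>u. of_real (pf \<alpha> (u / 2 ^ j))) l * \<psi> (2 ^ j * t - of_int l)"
  let ?A = "{- int K..int K}"
  define p where "p = proj \<phi> (\<lambda>u. of_real (pf \<alpha> u)) t"
  define q where "q j = proj \<psi> (\<lambda>u. of_real (pf \<alpha> (u / 2 ^ j))) (2 ^ j * t)" for j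
  have e1: "cmod (p - (\<Sum>l\<in>?A. ?P l)) \<le> ?H * trunc t 0 K"
    using trunc_error[OF am(1) h order_refl, of 0 t K] by (simp add: p_def)
  have e2: "cmod (q j - (\<Sum>l\<in>?A. ?Q j l)) \<le> ?H * trunc t j K" for j
  proof -
    \<comment> \<open>The Hoelder constant at level \<open>j\<close> does not exceed the one at
      level 0, so a common constant can be used for all truncation errors.\<close>
    have "2 powr (- \<beta> * real j) \<le> 2 powr 0" using \<beta> by (intro powr_mono) auto
    then have "?H * 2 powr (- \<beta> * real j) \<le> ?H * 1" using H0 by (intro mult_left_mono) auto
    then show ?thesis unfolding q_def using trunc_error[OF am(2) holder_scale[OF h, of j], of ?H j t K] by simp
  qed
  have e3: "cmod (p + (\<Sum>j<n. q j) - of_real (pf \<alpha> t)) \<le> ?H * 2 powr (- \<beta> * real n) * S * S"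
    unfolding p_def q_def by (rule multiresolution_error[OF h \<beta>])
  have eq: "pairing M (expansion n K (\<lambda>_. K) t) \<alpha> - of_real (pf \<alpha> t) =
      - (p - (\<Sum>l\<in>?A. ?P l)) - (\<Sum>j<n. q j - (\<Sum>l\<in>?A. ?Q j l)) + (p + (\<Sum>j<n. q j) - of_real (pf \<alpha> t))"
  proof -
    have id: "(a + b) - x = - (p' - a) - (q' - b) + (p' + q' - x)" for a b p' q' x :: complex by simp
    show ?thesis unfolding expansion_pairing[OF \<alpha>] sum_subtractf by (rule id)
  qed
  have "cmod (pairing M (expansion n K (\<lambda>_. K) t) \<alpha> - of_real (pf \<alpha> t))
      \<le> cmod (p - (\<Sum>l\<in>?A. ?P l)) + cmod (\<Sum>j<n. q j - (\<Sum>l\<in>?A. ?Q j l)) + cmod (p + (\<Sum>j<n. q j) - of_real (pf \<alpha> t))"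
  proof -
    have tri: "cmod (- a - b + c) \<le> cmod a + cmod b + cmod c" for a b c :: complex
      using norm_triangle_ineq[of "- a - b" c] norm_triangle_ineq4[of "- a" b] by simp
    show ?thesis unfolding eq by (rule tri)
  qed
  also have "\<dots> \<le> ?H * trunc t 0 K + (\<Sum>j<n. ?H * trunc t j K) + ?H * 2 powr (- \<beta> * real n) * S * S"
  proof -
    have "cmod (\<Sum>j<n. q j - (\<Sum>l\<in>?A. ?Q j l)) \<le> (\<Sum>j<n. ?H * trunc t j K)"
      by (rule sum_norm_le) (rule e2)
    then show ?thesis by (rule add_mono[OF add_mono[OF e1] e3])
  qed
  also have "\<dots> = (trunc t 0 K + (\<Sum>j<n. trunc t j K) + 2 powr (- \<beta> * real n) * S * S) * ?H"
  proof -
    have id: "h * a + h * s + h * e * c * c = (a + s + e * c * c) * h" for a s e c h :: real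
      by (simp add: algebra_simps)
    have "(\<Sum>j<n. ?H * trunc t j K) = ?H * (\<Sum>j<n. trunc t j K)" by (rule sum_distrib_left[symmetric])
    then show ?thesis by (simp only: id)
  qed
  finally show "cmod (pairing M (expansion n K (\<lambda>_. K) t) \<alpha> - of_real (pf \<alpha> t))
      \<le> (trunc t 0 K + (\<Sum>j<n. trunc t j K) + 2 powr (- \<beta> * real n) * S * S) * ?H" .
qed

text \<open>A single diagonal sequence is enough: the pathwise limit will not depend on the
  truncations, and this sequence only has to identify it.\<close>

lemma expansion_L2_limit:
  obtains K where "\<And>n. n \<le> K n" "(\<lambda>n. E2 M (\<lambda>\<omega>. expansion n (K n) (\<lambda>_. K n) t \<omega> - of_real (W t \<omega>))) \<longlonglongrightarrow> 0"
proof -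
  have w0: "0 \<le> w l" for l by (rule phi.\<omega>_nonneg)
  have t0: "0 \<le> trunc t j K" for j K
    unfolding trunc_def using w0 phi.S_nonneg by (intro integral_nonneg_AE) (simp add: far_def)
  have "\<exists>K\<ge>n. trunc t 0 K + (\<Sum>j<n. trunc t j K) < 1 / real (Suc n)" for n
  proof -
    have "(\<lambda>K. trunc t 0 K + (\<Sum>j<n. trunc t j K)) \<longlonglongrightarrow> 0 + (\<Sum>j<n. 0)"
      by (intro tendsto_add tendsto_sum trunc_tendsto)
    then have "\<forall>\<^sub>F K in sequentially. trunc t 0 K + (\<Sum>j<n. trunc t j K) < 1 / real (Suc n)"
      by (rule order_tendstoD(2)) simp
    then have "\<forall>\<^sub>F K in sequentially. n \<le> K \<and> trunc t 0 K + (\<Sum>j<n. trunc t j K) < 1 / real (Suc n)"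
      using eventually_ge_at_top[of n] by eventually_elim simp
    then show ?thesis by (auto simp: eventually_sequentially)
  qed
  then obtain K where K: "\<And>n. n \<le> K n" "\<And>n. trunc t 0 (K n) + (\<Sum>j<n. trunc t j (K n)) < 1 / real (Suc n)"
    by metis
  define b where "b n = 2 * (1 / real (Suc n) + (2 powr (- \<beta>)) ^ n * S * S)\<^sup>2" for n
  have pw: "2 powr (- \<beta> * real n) = (2 powr (- \<beta>)) ^ n" for n
    by (subst powr_realpow[symmetric]) (simp_all add: powr_powr)
  have bd: "E2 M (\<lambda>\<omega>. expansion n (K n) (\<lambda>_. K n) t \<omega> - of_real (W t \<omega>)) \<le> b n" for n
  proof (rule order_trans[OF expansion_error])
    have "0 \<le> trunc t 0 (K n) + (\<Sum>j<n. trunc t j (K n))" by (intro add_nonneg_nonneg sum_nonneg t0)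
    then show "2 * (trunc t 0 (K n) + (\<Sum>j<n. trunc t j (K n)) + 2 powr (- \<beta> * real n) * S * S)\<^sup>2 \<le> b n"
      unfolding b_def pw using K(2)[of n] phi.S_nonneg by (intro mult_left_mono power_mono add_mono add_nonneg_nonneg sum_nonneg t0) auto
  qed
  have "2 powr (- \<beta>) < 2 powr 0" using \<beta> by (intro powr_less_mono) auto
  then have l1: "(\<lambda>n. (2 powr (- \<beta>)) ^ n) \<longlonglongrightarrow> 0" by (intro LIMSEQ_power_zero) simp
  note l2 = inverse_Suc_tendsto
  have "b \<longlonglongrightarrow> 2 * (0 + 0 * S * S)\<^sup>2"
    unfolding b_def[abs_def] by (intro tendsto_mult tendsto_power tendsto_add tendsto_const l1 l2)
  then have bl: "b \<longlonglongrightarrow> 0" by simp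
  show thesis
  proof (rule that[of K])
    show "n \<le> K n" for n by (rule K(1))
    show "(\<lambda>n. E2 M (\<lambda>\<omega>. expansion n (K n) (\<lambda>_. K n) t \<omega> - of_real (W t \<omega>))) \<longlonglongrightarrow> 0"
      by (rule tendsto_sandwich[OF _ _ tendsto_const bl]) (use bd E2_nonneg in \<open>auto intro!: eventuallyI\<close>)
  qed
qed

end

subsection \<open>Pathwise uniform convergence\<close>

lemma IZ_inverse_square: "integrable IZ (\<lambda>l. 1 / (1 + \<bar>real_of_int l\<bar>)\<^sup>2)"
proof -
  let ?f = "\<lambda>l. 1 / (1 + \<bar>real_of_int l\<bar>)\<^sup>2"
  have b1: "bij_betw int UNIV {0..}" by (rule bij_betwI[where g = nat]) auto
  have b2: "bij_betw (\<lambda>n. - int n - 1) UNIV {..<0}" by (rule bij_betwI[where g = "\<lambda>l. nat (- l - 1)"]) auto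
  have s0: "summable (\<lambda>n. inverse (real n ^ 2))" by (rule inverse_power_summable) simp
  then have s1: "summable (\<lambda>n. inverse (real (Suc n) ^ 2))" by (subst summable_Suc_iff)
  then have s2: "summable (\<lambda>n. inverse (real (Suc (Suc n)) ^ 2))" by (subst summable_Suc_iff)
  have "Infinite_Set_Sum.abs_summable_on (\<lambda>n. ?f (int n)) UNIV"
    using s1 unfolding Infinite_Set_Sum.abs_summable_on_def integrable_count_space_nat_iff by (simp add: inverse_eq_divide)
  then have a1: "Infinite_Set_Sum.abs_summable_on ?f {0..}"
    by (subst (asm) Infinite_Set_Sum.abs_summable_on_reindex_bij_betw[OF b1])
  have "Infinite_Set_Sum.abs_summable_on (\<lambda>n. ?f (- int n - 1)) UNIV"
    using s2 unfolding Infinite_Set_Sum.abs_summable_on_def integrable_count_space_nat_iff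
    by (simp add: inverse_eq_divide abs_if add.commute)
  then have a2: "Infinite_Set_Sum.abs_summable_on ?f {..<0}"
    by (subst (asm) Infinite_Set_Sum.abs_summable_on_reindex_bij_betw[OF b2])
  have "{0..} \<union> {..<0} = (UNIV :: int set)" by auto
  then show ?thesis
    using Infinite_Set_Sum.abs_summable_on_union[OF a1 a2] by (simp add: Infinite_Set_Sum.abs_summable_on_def)
qed

text \<open>Enumerating the integers turns lattice sums of random terms into series, for which
  expectation and summation can be exchanged.\<close>

lemma IZ_int_decode:
  fixes f :: "int \<Rightarrow> real"
  assumes "\<And>l. 0 \<le> f l"
  shows "integrable IZ f \<longleftrightarrow> summable (\<lambda>n. f (int_decode n))"
  using integrable_bij_count_space[OF bij_int_decode, of f] assms by (simp add: integrable_count_space_nat_iff)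

lemma IZ_sum_le:
  fixes h :: "int \<Rightarrow> real"
  assumes h: "integrable IZ h" "\<And>l. 0 \<le> h l" and A: "finite A"
  shows "sum h A \<le> (LINT l|IZ. h l)"
proof -
  have s: "integrable IZ (\<lambda>l. (if l = a then h a else 0))" "(LINT l|IZ. (if l = a then h a else 0)) = h a" for a
    using IZ_single[of a "\<lambda>l. (if l = a then h a else 0)"] by simp_all
  have "sum h A = (LINT l|IZ. (\<Sum>a\<in>A. if l = a then h a else 0))"
    by (subst Bochner_Integration.integral_sum) (simp_all only: s)
  also have "\<dots> \<le> (LINT l|IZ. h l)"
  proof (rule integral_mono)
    show "integrable IZ (\<lambda>l. \<Sum>a\<in>A. (if l = a then h a else 0))" by (rule Bochner_Integration.integrable_sum) (rule s(1))
    show "(\<Sum>a\<in>A. (if l = a then h a else 0)) \<le> h l" for l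
      using A h(2) by (subst sum.delta') auto
  qed (rule h(1))
  finally show ?thesis .
qed

lemma uniform_truncation:
  fixes f :: "int \<Rightarrow> real \<Rightarrow> complex"
  assumes u: "integrable IZ u" and b: "\<And>t l. t \<in> I \<Longrightarrow> norm (f l t) \<le> u l" and K: "filterlim K at_top sequentially"
  shows "uniform_limit I (\<lambda>i t. \<Sum>l\<in>{- int (K i)..int (K i)}. f l t) (\<lambda>t. LINT l|IZ. f l t) sequentially"
proof (rule uniform_limitI)
  fix e :: real assume e: "0 < e"
  have "(\<lambda>i. LINT l|IZ. far (K i) l * u l) \<longlonglongrightarrow> 0" by (rule filterlim_compose[OF far_tendsto[OF u] K])
  then have "\<forall>\<^sub>F i in sequentially. (LINT l|IZ. far (K i) l * u l) < e" using e by (rule order_tendstoD(2))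
  then show "\<forall>\<^sub>F i in sequentially. \<forall>t\<in>I. dist (\<Sum>l\<in>{- int (K i)..int (K i)}. f l t) (LINT l|IZ. f l t) < e"
  proof eventually_elim
    case (elim i)
    show ?case
    proof
      fix t assume "t \<in> I"
      from IZ_truncation_error[OF u b[OF this], of "K i"] elim
      show "dist (\<Sum>l\<in>{- int (K i)..int (K i)}. f l t) (LINT l|IZ. f l t) < e"
        by (subst dist_commute) (simp add: dist_norm)
    qed
  qed
qed

lemma uniform_limit_tannery:
  fixes f :: "nat \<Rightarrow> nat \<Rightarrow> 'b \<Rightarrow> complex"
  assumes M: "summable M" and fM: "\<And>i j t. t \<in> I \<Longrightarrow> norm (f i j t) \<le> M j"
    and FM: "\<And>j t. t \<in> I \<Longrightarrow> norm (F j t) \<le> M j"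
    and ul: "\<And>j. uniform_limit I (\<lambda>i. f i j) (F j) sequentially" and n: "filterlim n at_top sequentially"
  shows "uniform_limit I (\<lambda>i t. \<Sum>j<n i. f i j t) (\<lambda>t. \<Sum>j. F j t) sequentially"
proof (cases "I = {}")
  case True
  then show ?thesis by (simp add: uniform_limit_iff)
next
  case False
  then obtain t0 where t0: "t0 \<in> I" by blast
  have M0: "0 \<le> M j" for j using order_trans[OF norm_ge_zero FM[OF t0]] .
  show ?thesis
  proof (rule uniform_limitI)
    fix e :: real assume e: "0 < e"
    \<comment> \<open>The tail beyond \<open>J\<close> takes at most \<open>e / 4\<close> from the
      finite sum and \<open>e / 4\<close> from the series; the first \<open>J\<close> terms together
      contribute at most \<open>e / 2\<close>.\<close>
    obtain J where J: "norm (\<Sum>j. M (j + J)) < e / 4"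
      using suminf_exist_split[of "e / 4" M] M e by (meson order_refl divide_pos_pos zero_less_numeral)
    have sJ: "summable (\<lambda>j. M (j + J))" using M by (simp add: summable_iff_shift)
    have TJ: "(\<Sum>j. M (j + J)) < e / 4" using J by simp
    define d where "d = e / (2 * (real J + 1))"
    have d: "0 < d" using e by (simp add: d_def)
    have "\<forall>\<^sub>F i in sequentially. \<forall>j\<in>{..<J}. \<forall>t\<in>I. dist (f i j t) (F j t) < d"
      by (rule eventually_ball_finite) (use uniform_limitD[OF ul d] in auto)
    moreover have "\<forall>\<^sub>F i in sequentially. J \<le> n i" using n by (simp add: filterlim_at_top)
    ultimately show "\<forall>\<^sub>F i in sequentially. \<forall>t\<in>I. dist (\<Sum>j<n i. f i j t) (\<Sum>j. F j t) < e"
    proof eventually_elim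
      case (elim i)
      show ?case
      proof
        fix t assume t: "t \<in> I"
        have sF: "summable (\<lambda>j. F j t)" by (rule summable_comparison_test'[OF M, of 0]) (rule FM[OF t])
        have sFJ: "summable (\<lambda>j. norm (F (j + J) t))" by (rule summable_comparison_test'[OF sJ, of 0]) (simp add: FM[OF t])
        have A: "cmod ((\<Sum>j<J. f i j t) - (\<Sum>j<J. F j t)) \<le> e / 2"
        proof -
          have "cmod ((\<Sum>j<J. f i j t) - (\<Sum>j<J. F j t)) \<le> (\<Sum>j<J. cmod (f i j t - F j t))"
            unfolding sum_subtractf[symmetric] by (rule norm_sum)
          also have "\<dots> \<le> (\<Sum>j<J. d)" using elim(1) t by (intro sum_mono) (auto simp: dist_norm less_imp_le)
          also have "\<dots> = real J * d" by simp
          also have "\<dots> \<le> (real J + 1) * d" using d by (intro mult_right_mono) auto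
          also have "\<dots> = e / 2" by (simp add: d_def field_simps)
          finally show ?thesis .
        qed
        have B: "cmod (\<Sum>j\<in>{J..<n i}. f i j t) < e / 4"
        proof -
          have "cmod (\<Sum>j\<in>{J..<n i}. f i j t) \<le> (\<Sum>j\<in>{J..<n i}. M j)" by (rule sum_norm_le) (rule fM[OF t])
          also have "\<dots> = (\<Sum>j<n i - J. M (j + J))"
            using sum.shift_bounds_nat_ivl[of M 0 J "n i - J"] elim(2) by (simp add: lessThan_atLeast0)
          also have "\<dots> \<le> (\<Sum>j. M (j + J))" by (rule sum_le_suminf[OF sJ]) (simp_all add: M0)
          finally show ?thesis using TJ by simp
        qed
        have C: "cmod (\<Sum>j. F (j + J) t) < e / 4"
        proof -
          have "cmod (\<Sum>j. F (j + J) t) \<le> (\<Sum>j. norm (F (j + J) t))" by (rule summable_norm[OF sFJ])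
          also have "\<dots> \<le> (\<Sum>j. M (j + J))" by (rule suminf_le[OF _ sFJ sJ]) (rule FM[OF t])
          finally show ?thesis using TJ by simp
        qed
        have s1: "(\<Sum>j<n i. f i j t) = (\<Sum>j<J. f i j t) + (\<Sum>j\<in>{J..<n i}. f i j t)"
          using sum.atLeastLessThan_concat[of 0 J "n i" "\<lambda>j. f i j t"] elim(2) by (simp add: lessThan_atLeast0)
        have s2: "(\<Sum>j. F j t) = (\<Sum>j. F (j + J) t) + (\<Sum>j<J. F j t)" by (rule suminf_split_initial_segment[OF sF])
        have tri: "cmod ((a + b) - (c + d)) \<le> cmod (a - d) + cmod b + cmod c" for a b c d :: complex
          using norm_triangle_ineq[of "a - d" "b - c"] norm_triangle_ineq4[of b c] by (simp add: algebra_simps)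
        show "dist (\<Sum>j<n i. f i j t) (\<Sum>j. F j t) < e"
          unfolding dist_norm s1 s2 using tri[of "\<Sum>j<J. f i j t" "\<Sum>j\<in>{J..<n i}. f i j t" "\<Sum>j. F (j + J) t" "\<Sum>j<J. F j t"] A B C
          by linarith
      qed
    qed
  qed
qed

section \<open>Almost sure bounds on the coefficients and uniform limits of paths\<close>

context fbm_wavelet
begin

text \<open>The rate \<open>3/4 * \<beta>\<close> lies midway between \<open>\<beta>\<close>, the
  rate in mean square, and \<open>\<beta> / 2\<close>, the loss from the weight at indices of size
  \<open>2 ^ j\<close>. One quarter is spent on summing the moments, the other on summing the
  levels.\<close>

definition vv :: "nat \<Rightarrow> int \<Rightarrow> real" where
  "vv j l = 2 powr (- real j / 2) * 2 powr (- (3/4) * \<beta> * real j) * gw (\<beta> / 2) (of_int l)"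

lemma vv_pos: "0 < vv j l" by (simp add: vv_def gw_pos)

lemma coef_measurable: "coef \<psi> j l \<in> borel_measurable M" "coef \<phi> j l \<in> borel_measurable M"
  by (rule sq_intD(1)[OF coef_props(1)[OF am(2)]], rule sq_intD(1)[OF coef_props(1)[OF am(1)]])

lemma coef_psi_moment:
  assumes quarter: "1/4 < \<beta>"
  shows "(\<integral>\<^sup>+ \<omega>. ennreal ((cmod (coef \<psi> j l \<omega>) / vv j l) ^ 16) \<partial>M)
    \<le> ennreal ((C16 * 4 ^ 8 * S ^ 16) * (2 powr (- 4 * \<beta>)) ^ j * (1 / (1 + \<bar>real_of_int l\<bar>)\<^sup>2))"
proof -
  note [measurable] = coef_measurable
  define D where "D = 2 powr (- real j / 2) * 2 powr (- \<beta> * real j) * S"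
  define v where "v = vv j l"
  have v: "0 < v" unfolding v_def by (rule vv_pos)
  have C0: "0 \<le> C16" by (simp add: C16_def c16_def)
  have D0: "0 \<le> D" unfolding D_def using phi.S_nonneg by simp
  have "(\<integral>\<^sup>+ \<omega>. ennreal ((cmod (coef \<psi> j l \<omega>) / v) ^ 16) \<partial>M)
      = (\<integral>\<^sup>+ \<omega>. ennreal (1 / v ^ 16) * ennreal (cmod (coef \<psi> j l \<omega>) ^ 16) \<partial>M)"
    using v by (intro nn_integral_cong) (simp add: power_divide flip: ennreal_mult)
  also have "\<dots> = ennreal (1 / v ^ 16) * (\<integral>\<^sup>+ \<omega>. ennreal (cmod (coef \<psi> j l \<omega>) ^ 16) \<partial>M)"
    by (rule nn_integral_cmult) measurable
  also have "\<dots> \<le> ennreal (1 / v ^ 16) * ennreal (C16 * (2 * E2 M (coef \<psi> j l)) ^ 8)"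
    by (intro mult_left_mono coef_props(3)[OF am(2)]) simp
  also have "\<dots> = ennreal (1 / v ^ 16 * (C16 * (2 * E2 M (coef \<psi> j l)) ^ 8))"
    using v C0 E2_nonneg[of M "coef \<psi> j l"] by (subst ennreal_mult) auto
  also have "\<dots> \<le> ennreal ((C16 * 4 ^ 8 * S ^ 16) * (2 powr (- 4 * \<beta>)) ^ j * (1 / (1 + \<bar>real_of_int l\<bar>)\<^sup>2))"
  proof (rule ennreal_leI)
    have "2 * E2 M (coef \<psi> j l) \<le> 4 * D\<^sup>2" using coef_psi_E2[of j l] by (simp add: D_def)
    then have "(2 * E2 M (coef \<psi> j l)) ^ 8 \<le> (4 * D\<^sup>2) ^ 8" by (rule power_mono) (simp add: E2_nonneg)
    also have "\<dots> = 4 ^ 8 * D ^ 16" by (simp add: power_mult_distrib flip: power_mult)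
    finally have "1 / v ^ 16 * (C16 * (2 * E2 M (coef \<psi> j l)) ^ 8) \<le> 1 / v ^ 16 * (C16 * (4 ^ 8 * D ^ 16))"
      using v C0 by (intro mult_left_mono) auto
    also have "\<dots> = C16 * 4 ^ 8 * (D / v) ^ 16" by (simp add: power_divide)
    also have "D / v = S * 2 powr (- (\<beta> / 4) * real j) / gw (\<beta> / 2) (of_int l)"
    proof -
      have "2 powr (- \<beta> * real j) = 2 powr (- (3/4) * \<beta> * real j) * 2 powr (- (\<beta> / 4) * real j)"
        by (simp flip: powr_add)
      then show ?thesis unfolding D_def v_def vv_def by simp
    qed
    also have "(S * 2 powr (- (\<beta> / 4) * real j) / gw (\<beta> / 2) (of_int l)) ^ 16
        = S ^ 16 * (2 powr (- (\<beta> / 4) * real j)) ^ 16 * (1 / gw (\<beta> / 2) (of_int l) ^ 16)"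
      by (simp add: power_divide power_mult_distrib)
    also have "(2 powr (- (\<beta> / 4) * real j)) ^ 16 = (2 powr (- 4 * \<beta>)) ^ j"
      by (simp add: powr_power mult_ac)
    finally have "1 / v ^ 16 * (C16 * (2 * E2 M (coef \<psi> j l)) ^ 8)
        \<le> C16 * 4 ^ 8 * (S ^ 16 * (2 powr (- 4 * \<beta>)) ^ j * (1 / gw (\<beta> / 2) (of_int l) ^ 16))" .
    also have "\<dots> \<le> C16 * 4 ^ 8 * (S ^ 16 * (2 powr (- 4 * \<beta>)) ^ j * (1 / (1 + \<bar>real_of_int l\<bar>)\<^sup>2))"
    proof -
      \<comment> \<open>Since \<open>\<beta> / 2 * 16 = 8 * \<beta> > 2\<close>, the power 16 of the
        weight beats the summable inverse square.\<close>
      have "(1 + \<bar>real_of_int l\<bar>)\<^sup>2 = (1 + \<bar>real_of_int l\<bar>) powr 2" by (simp add: powr_numeral)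
      also have "\<dots> \<le> (1 + \<bar>real_of_int l\<bar>) powr (\<beta> / 2 * 16)" using quarter by (intro powr_mono) auto
      also have "\<dots> = gw (\<beta> / 2) (of_int l) ^ 16" unfolding gw_def by (simp add: powr_power)
      finally have "1 / gw (\<beta> / 2) (of_int l) ^ 16 \<le> 1 / (1 + \<bar>real_of_int l\<bar>)\<^sup>2"
        by (intro divide_left_mono mult_pos_pos zero_less_power gw_pos) (auto simp: add_pos_nonneg)
      then show ?thesis using C0 phi.S_nonneg by (intro mult_left_mono) auto
    qed
    finally show "1 / v ^ 16 * (C16 * (2 * E2 M (coef \<psi> j l)) ^ 8)
        \<le> (C16 * 4 ^ 8 * S ^ 16) * (2 powr (- 4 * \<beta>)) ^ j * (1 / (1 + \<bar>real_of_int l\<bar>)\<^sup>2)" by (simp only: mult.assoc)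
  qed
  finally show ?thesis unfolding v_def .
qed

text \<open>Borel--Cantelli in summed form: the expected sum over \<open>j, l\<close> of \<open>(|coef \<psi> j l| / vv j l) ^ 16\<close> is
  finite. The power \<open>16\<close> suffices because \<open>\<beta> > 1/4\<close>.\<close>

lemma psi_coefs_bounded:
  assumes quarter: "1/4 < \<beta>"
  shows "AE \<omega> in M. \<exists>B\<ge>0. \<forall>j l. cmod (coef \<psi> j l \<omega>) \<le> B * vv j l"
proof -
  note [measurable] = coef_measurable
  define R where "R j n \<omega> = (cmod (coef \<psi> j (int_decode n) \<omega>) / vv j (int_decode n)) ^ 16" for j n \<omega>
  have mR [measurable]: "R j n \<in> borel_measurable M" for j n unfolding R_def by measurable
  define Cc where "Cc = C16 * 4 ^ 8 * S ^ 16"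
  define q where "q = 2 powr (- 4 * \<beta>)"
  define c where "c n = 1 / (1 + \<bar>real_of_int (int_decode n)\<bar>)\<^sup>2" for n
  have Cc0: "0 \<le> Cc" unfolding Cc_def using phi.S_nonneg by (simp add: C16_def c16_def)
  have "2 powr (- 4 * \<beta>) < 2 powr 0" using \<beta> by (intro powr_less_mono) auto
  then have q: "0 \<le> q" "q < 1" by (simp_all add: q_def)
  have sc: "summable c" unfolding c_def using IZ_int_decode[of "\<lambda>l. 1 / (1 + \<bar>real_of_int l\<bar>)\<^sup>2"] IZ_inverse_square by simp
  have c0: "0 \<le> c n" for n by (simp add: c_def)
  have inner: "(\<Sum>n. \<integral>\<^sup>+ \<omega>. ennreal (R j n \<omega>) \<partial>M) \<le> ennreal (Cc * q ^ j * suminf c)" for j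
  proof -
    have "(\<Sum>n. \<integral>\<^sup>+ \<omega>. ennreal (R j n \<omega>) \<partial>M) \<le> (\<Sum>n. ennreal (Cc * q ^ j * c n))"
    proof (rule suminf_le)
      show "(\<integral>\<^sup>+ \<omega>. ennreal (R j n \<omega>) \<partial>M) \<le> ennreal (Cc * q ^ j * c n)" for n
        unfolding R_def Cc_def q_def c_def by (rule coef_psi_moment[OF quarter])
    qed simp_all
    also have "\<dots> = ennreal (\<Sum>n. Cc * q ^ j * c n)"
      by (rule suminf_ennreal2) (use Cc0 q c0 sc in \<open>auto intro: summable_mult\<close>)
    also have "(\<Sum>n. Cc * q ^ j * c n) = Cc * q ^ j * suminf c" by (rule suminf_mult[OF sc])
    finally show ?thesis .
  qed
  have "(\<integral>\<^sup>+ \<omega>. (\<Sum>j. \<Sum>n. ennreal (R j n \<omega>)) \<partial>M) = (\<Sum>j. \<integral>\<^sup>+ \<omega>. (\<Sum>n. ennreal (R j n \<omega>)) \<partial>M)"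
    by (rule nn_integral_suminf) measurable
  also have "\<dots> = (\<Sum>j. \<Sum>n. \<integral>\<^sup>+ \<omega>. ennreal (R j n \<omega>) \<partial>M)"
    by (intro suminf_cong nn_integral_suminf) measurable
  also have "\<dots> \<le> (\<Sum>j. ennreal (Cc * q ^ j * suminf c))" by (rule suminf_le) (use inner in simp_all)
  also have "\<dots> = ennreal (\<Sum>j. Cc * q ^ j * suminf c)"
  proof (rule suminf_ennreal2)
    show "0 \<le> Cc * q ^ j * suminf c" for j using Cc0 q suminf_nonneg[OF sc c0] by simp
    show "summable (\<lambda>j. Cc * q ^ j * suminf c)" using q by (intro summable_mult2 summable_mult summable_geometric) simp
  qed
  finally have "(\<integral>\<^sup>+ \<omega>. (\<Sum>j. \<Sum>n. ennreal (R j n \<omega>)) \<partial>M) \<noteq> \<infinity>" by (auto simp: top_unique)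
  then have "AE \<omega> in M. (\<Sum>j. \<Sum>n. ennreal (R j n \<omega>)) \<noteq> \<infinity>" by (intro nn_integral_PInf_AE) measurable
  then show ?thesis
  proof eventually_elim
    case (elim \<omega>)
    then obtain T where T: "0 \<le> T" "(\<Sum>j. \<Sum>n. ennreal (R j n \<omega>)) = ennreal T"
      by (cases "\<Sum>j. \<Sum>n. ennreal (R j n \<omega>)") auto
    have le: "R j n \<omega> \<le> T" for j n
    proof -
      have "ennreal (R j n \<omega>) \<le> (\<Sum>n. ennreal (R j n \<omega>))"
        using sum_le_suminf[of "\<lambda>n. ennreal (R j n \<omega>)" "{n}"] by simp
      also have "\<dots> \<le> (\<Sum>j. \<Sum>n. ennreal (R j n \<omega>))"
        using sum_le_suminf[of "\<lambda>j. \<Sum>n. ennreal (R j n \<omega>)" "{j}"] by simp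
      finally show ?thesis using T by simp
    qed
    \<comment> \<open>\<open>max 1 T\<close> avoids a root of order 16: a ratio above 1 is at most
      its own power 16, hence at most \<open>T\<close>.\<close>
    have "cmod (coef \<psi> j l \<omega>) \<le> max 1 T * vv j l" for j l
    proof -
      define x where "x = cmod (coef \<psi> j l \<omega>) / vv j l"
      have x0: "0 \<le> x" unfolding x_def using vv_pos[of j l] by simp
      have "x ^ 16 \<le> T" using le[of j "int_encode l"] by (simp add: R_def x_def)
      have "x \<le> max 1 T"
      proof (cases "x \<le> 1")
        case False
        then have "x ^ 1 \<le> x ^ 16" by (intro power_increasing) auto
        then show ?thesis using \<open>x ^ 16 \<le> T\<close> by simp
      qed simp
      then show ?thesis unfolding x_def using vv_pos[of j l] by (simp add: divide_le_eq)
    qed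
    then show ?case by (intro exI[of _ "max 1 T"]) auto
  qed
qed

text \<open>For \<open>|x| \<le> N\<close> the floor of \<open>x\<close> takes finitely many values;
  summing over them gives a majorant that depends only on \<open>N\<close> and is still summable in
  \<open>l\<close>.\<close>

definition uu :: "nat \<Rightarrow> int \<Rightarrow> real" where
  "uu N l = (\<Sum>m\<in>{- int N..int N}. w (m - l))"

lemma uu_integrable: "integrable IZ (uu N)"
  unfolding uu_def[abs_def] by (intro Bochner_Integration.integrable_sum phi.integrable_IZ_\<omega>)

lemma uu_nonneg: "0 \<le> uu N l"
  unfolding uu_def by (intro sum_nonneg phi.\<omega>_nonneg)

lemma w_le_uu: "\<bar>x\<bar> \<le> real N \<Longrightarrow> w (\<lfloor>x\<rfloor> - l) \<le> uu N l"
proof -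
  assume "\<bar>x\<bar> \<le> real N"
  then have "\<lfloor>x\<rfloor> \<in> {- int N..int N}" by (auto simp: le_floor_iff floor_le_iff)
  then show ?thesis unfolding uu_def by (intro member_le_sum) (auto simp: phi.\<omega>_nonneg)
qed

text \<open>Only one level occurs here, so first moments suffice: they grow at most like
  \<open>gw \<beta> l\<close>, and division by this weight leaves the summable
  \<open>uu N l\<close>.\<close>

lemma phi_coefs_summable:
  "AE \<omega> in M. integrable IZ (\<lambda>l. cmod (coef \<phi> 0 l \<omega>) * (uu N l / gw \<beta> (of_int l)))"
proof -
  note [measurable] = coef_measurable
  have one: "sq_int M (\<lambda>_. 1 :: real)" "E2 M (\<lambda>_. 1 :: real) = 1" by (auto simp: sq_int_def E2_def prob_space)
  define a where "a l = uu N l / gw \<beta> (of_int l)" for l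
  have a0: "0 \<le> a l" for l unfolding a_def using uu_nonneg[of N l] by simp
  have ix: "integrable M (\<lambda>\<omega>. cmod (coef \<phi> 0 l \<omega>))" and ex: "(LINT \<omega>|M. cmod (coef \<phi> 0 l \<omega>)) \<le> sqrt 2 * (S * gw \<beta> (of_int l))" for l
  proof -
    have s: "sq_int M (\<lambda>\<omega>. cmod (coef \<phi> 0 l \<omega>))" "E2 M (\<lambda>\<omega>. cmod (coef \<phi> 0 l \<omega>)) = E2 M (coef \<phi> 0 l)"
      using coef_props(1)[OF am(1), of 0 l] by (auto simp: sq_int_def E2_def)
    show "integrable M (\<lambda>\<omega>. cmod (coef \<phi> 0 l \<omega>))" using real_Cauchy_Schwarz(1)[OF s(1) one(1)] by simp
    have "(LINT \<omega>|M. cmod (coef \<phi> 0 l \<omega>)) \<le> sqrt (E2 M (coef \<phi> 0 l))"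
      using real_Cauchy_Schwarz(2)[OF s(1) one(1)] unfolding s(2) one(2) by simp
    also have "\<dots> \<le> sqrt (2 * (S * gw \<beta> (of_int l))\<^sup>2)" using coef_phi_E2 by simp
    also have "\<dots> = sqrt 2 * (S * gw \<beta> (of_int l))" using phi.S_nonneg by (simp add: real_sqrt_mult)
    finally show "(LINT \<omega>|M. cmod (coef \<phi> 0 l \<omega>)) \<le> sqrt 2 * (S * gw \<beta> (of_int l))" .
  qed
  define R where "R n \<omega> = cmod (coef \<phi> 0 (int_decode n) \<omega>) * a (int_decode n)" for n \<omega>
  have mR [measurable]: "R n \<in> borel_measurable M" for n unfolding R_def by measurable
  have R0: "0 \<le> R n \<omega>" for n \<omega> unfolding R_def using a0 by simp
  have su: "summable (\<lambda>n. sqrt 2 * S * uu N (int_decode n))"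
    using IZ_int_decode[of "uu N"] uu_integrable uu_nonneg by (intro summable_mult) blast
  have each: "(\<integral>\<^sup>+ \<omega>. ennreal (R n \<omega>) \<partial>M) \<le> ennreal (sqrt 2 * S * uu N (int_decode n))" for n
  proof -
    let ?l = "int_decode n"
    have "(\<integral>\<^sup>+ \<omega>. ennreal (R n \<omega>) \<partial>M) = ennreal (LINT \<omega>|M. R n \<omega>)"
      by (rule nn_integral_eq_integral) (use ix R0 in \<open>auto simp: R_def\<close>)
    also have "(LINT \<omega>|M. R n \<omega>) = (LINT \<omega>|M. cmod (coef \<phi> 0 ?l \<omega>)) * a ?l" unfolding R_def by simp
    also have "\<dots> \<le> sqrt 2 * (S * gw \<beta> (of_int ?l)) * a ?l" by (intro mult_right_mono ex a0)
    also have "\<dots> = sqrt 2 * S * uu N ?l" unfolding a_def using gw_pos[of \<beta> "of_int ?l"] by simp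
    finally show ?thesis by (simp add: ennreal_leI)
  qed
  have "(\<integral>\<^sup>+ \<omega>. (\<Sum>n. ennreal (R n \<omega>)) \<partial>M) = (\<Sum>n. \<integral>\<^sup>+ \<omega>. ennreal (R n \<omega>) \<partial>M)"
    by (rule nn_integral_suminf) measurable
  also have "\<dots> \<le> (\<Sum>n. ennreal (sqrt 2 * S * uu N (int_decode n)))" by (rule suminf_le) (use each in simp_all)
  also have "\<dots> = ennreal (\<Sum>n. sqrt 2 * S * uu N (int_decode n))"
    by (rule suminf_ennreal2[OF _ su]) (use phi.S_nonneg uu_nonneg in auto)
  finally have "(\<integral>\<^sup>+ \<omega>. (\<Sum>n. ennreal (R n \<omega>)) \<partial>M) \<noteq> \<infinity>" by (auto simp: top_unique)
  then have "AE \<omega> in M. (\<Sum>n. ennreal (R n \<omega>)) \<noteq> \<infinity>" by (intro nn_integral_PInf_AE) measurable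
  then show ?thesis
  proof eventually_elim
    case (elim \<omega>)
    have "summable (\<lambda>n. R n \<omega>)" by (rule summable_suminf_not_top) (use elim R0 in simp_all)
    then have "summable (\<lambda>n. cmod (coef \<phi> 0 (int_decode n) \<omega>) * a (int_decode n))" by (simp only: R_def)
    then have "integrable IZ (\<lambda>l. cmod (coef \<phi> 0 l \<omega>) * a l)"
      using IZ_int_decode[of "\<lambda>l. cmod (coef \<phi> 0 l \<omega>) * a l"] a0 by simp
    then show ?case by (simp only: a_def)
  qed
qed

text \<open>The condition involves neither the time nor the truncation parameters, so one
  exceptional null set serves all sequences of expansions.\<close>

definition good :: "'a \<Rightarrow> bool" where
  "good \<omega> \<longleftrightarrow> (\<exists>B\<ge>0. \<forall>j l. cmod (coef \<psi> j l \<omega>) \<le> B * vv j l) \<and>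
    (\<forall>N. integrable IZ (\<lambda>l. cmod (coef \<phi> 0 l \<omega>) * (uu N l / gw \<beta> (of_int l))))"

lemma good_AE: "1/4 < \<beta> \<Longrightarrow> AE \<omega> in M. good \<omega>"
  unfolding good_def using psi_coefs_bounded phi_coefs_summable by (simp add: AE_all_countable)

definition lim_expansion :: "real \<Rightarrow> 'a \<Rightarrow> complex" where
  "lim_expansion t \<omega> = (LINT l|IZ. coef \<phi> 0 l \<omega> * dilate \<phi> (int 0) l t) +
     (\<Sum>j. LINT l|IZ. coef \<psi> j l \<omega> * dilate \<psi> (int j) l t)"

lemma phi_term_bound:
  assumes "\<bar>t\<bar> \<le> real N"
  shows "cmod (coef \<phi> 0 l \<omega> * dilate \<phi> (int 0) l t) \<le> gw \<beta> (real N) * (cmod (coef \<phi> 0 l \<omega>) * (uu N l / gw \<beta> (of_int l)))"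
proof -
  have g: "gw \<beta> (of_int l) \<le> gw \<beta> t * gw \<beta> (t - of_int l)"
    using gw_submult[OF phi.\<beta>, of t "- (t - of_int l)"] by (simp only: gw_minus) simp
  have "gw \<beta> (of_int l) * cmod (\<phi> (t - of_int l)) \<le> gw \<beta> t * gw \<beta> (t - of_int l) * cmod (\<phi> (t - of_int l))"
    by (rule mult_right_mono[OF g]) simp
  also have "\<dots> = gw \<beta> t * (gw \<beta> (t - of_int l) * cmod (\<phi> (t - of_int l)))" by simp
  also have "\<dots> \<le> gw \<beta> (real N) * uu N l"
  proof (rule mult_mono)
    show "gw \<beta> t \<le> gw \<beta> (real N)" by (rule gw_mono[OF phi.\<beta>]) (use assms in simp)
    show "gw \<beta> (t - of_int l) * cmod (\<phi> (t - of_int l)) \<le> uu N l"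
      using phi.bound[of "t - of_int l"] w_le_uu[OF assms, of l] by simp
  qed simp_all
  finally have "cmod (\<phi> (t - of_int l)) \<le> gw \<beta> (real N) * uu N l / gw \<beta> (of_int l)"
    using gw_pos[of \<beta> "of_int l"] by (simp add: le_divide_eq mult.commute)
  then have "cmod (coef \<phi> 0 l \<omega>) * cmod (\<phi> (t - of_int l)) \<le> cmod (coef \<phi> 0 l \<omega>) * (gw \<beta> (real N) * uu N l / gw \<beta> (of_int l))"
    by (rule mult_left_mono) simp
  moreover have "dilate \<phi> (int 0) l t = \<phi> (t - of_int l)" unfolding dilate_nat by simp
  ultimately show ?thesis by (simp only: norm_mult) (simp add: mult_ac)
qed

text \<open>The weight of \<open>l\<close> is split between \<open>x = 2 ^ j * t\<close> and
  \<open>x - l\<close>. The second part is absorbed by the decay of \<open>\<psi>\<close>; the first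
  is at most a constant times \<open>2 powr (\<beta> / 2 * j)\<close>, and against the decay of
  \<open>vv\<close> the rate \<open>\<beta> / 4\<close> is left.\<close>

lemma psi_term_bound:
  assumes B: "0 \<le> B" "cmod (coef \<psi> j l \<omega>) \<le> B * vv j l" and t: "\<bar>t\<bar> \<le> real N"
  shows "cmod (coef \<psi> j l \<omega> * dilate \<psi> (int j) l t)
    \<le> B * (1 + real N) powr (\<beta> / 2) * (2 powr (- (\<beta> / 4))) ^ j * w (\<lfloor>2 ^ j * t\<rfloor> - l)"
proof -
  define x where "x = 2 ^ j * t"
  define h where "h = gw (\<beta> / 2) x"
  have b2: "0 \<le> \<beta> / 2" using \<beta> by simp
  have "gw (\<beta> / 2) (of_int l) \<le> h * gw (\<beta> / 2) (x - of_int l)"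
    unfolding h_def using gw_submult[OF b2, of x "- (x - of_int l)"] by (simp only: gw_minus) simp
  also have "\<dots> \<le> h * gw \<beta> (x - of_int l)"
  proof (rule mult_left_mono)
    show "gw (\<beta> / 2) (x - of_int l) \<le> gw \<beta> (x - of_int l)" unfolding gw_def using \<beta> by (intro powr_mono) auto
  qed (simp add: h_def)
  finally have "gw (\<beta> / 2) (of_int l) * cmod (\<psi> (x - of_int l)) \<le> h * gw \<beta> (x - of_int l) * cmod (\<psi> (x - of_int l))"
    by (rule mult_right_mono) simp
  also have "\<dots> = h * (gw \<beta> (x - of_int l) * cmod (\<psi> (x - of_int l)))" by simp
  also have "\<dots> \<le> h * w (\<lfloor>x\<rfloor> - l)"
    using psi.bound[of "x - of_int l"] by (intro mult_left_mono) (simp_all add: h_def)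
  also have "\<dots> \<le> (2 powr (\<beta> / 2 * real j) * (1 + real N) powr (\<beta> / 2)) * w (\<lfloor>x\<rfloor> - l)"
  proof (rule mult_right_mono)
    have "1 + \<bar>x\<bar> \<le> 2 ^ j * (1 + real N)"
    proof -
      have "2 ^ j * \<bar>t\<bar> \<le> 2 ^ j * real N" using t by (intro mult_left_mono) auto
      moreover have "(1::real) \<le> 2 ^ j" by simp
      moreover have "1 + \<bar>x\<bar> = 1 + 2 ^ j * \<bar>t\<bar>" by (simp add: x_def abs_mult)
      moreover have "2 ^ j * (1 + real N) = 2 ^ j + 2 ^ j * real N" by (simp add: distrib_left)
      ultimately show ?thesis by linarith
    qed
    then have "h \<le> (2 ^ j * (1 + real N)) powr (\<beta> / 2)" unfolding h_def gw_def using b2 by (intro powr_mono2) auto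
    also have "\<dots> = 2 powr (\<beta> / 2 * real j) * (1 + real N) powr (\<beta> / 2)"
      by (simp add: powr_mult powr_powr mult.commute flip: powr_realpow)
    finally show "h \<le> 2 powr (\<beta> / 2 * real j) * (1 + real N) powr (\<beta> / 2)" .
  qed (rule phi.\<omega>_nonneg)
  finally have key: "gw (\<beta> / 2) (of_int l) * cmod (\<psi> (x - of_int l)) \<le> (2 powr (\<beta> / 2 * real j) * (1 + real N) powr (\<beta> / 2)) * w (\<lfloor>x\<rfloor> - l)" .
  have "cmod (coef \<psi> j l \<omega> * dilate \<psi> (int j) l t) = cmod (coef \<psi> j l \<omega>) * (2 powr (real j / 2) * cmod (\<psi> (x - of_int l)))"
    by (simp add: norm_mult dilate_nat x_def)
  also have "\<dots> \<le> B * vv j l * (2 powr (real j / 2) * cmod (\<psi> (x - of_int l)))"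
    by (rule mult_right_mono[OF B(2)]) simp
  also have "\<dots> = B * (2 powr (- real j / 2) * 2 powr (real j / 2)) * 2 powr (- (3/4) * \<beta> * real j) * (gw (\<beta> / 2) (of_int l) * cmod (\<psi> (x - of_int l)))"
    unfolding vv_def by (simp only: mult_ac)
  also have "2 powr (- real j / 2) * 2 powr (real j / 2) = (1::real)" by (simp flip: powr_add)
  also have "B * 1 * 2 powr (- (3/4) * \<beta> * real j) * (gw (\<beta> / 2) (of_int l) * cmod (\<psi> (x - of_int l)))
      \<le> B * 1 * 2 powr (- (3/4) * \<beta> * real j) * ((2 powr (\<beta> / 2 * real j) * (1 + real N) powr (\<beta> / 2)) * w (\<lfloor>x\<rfloor> - l))"
    using B(1) by (intro mult_left_mono key) simp
  also have "\<dots> = B * (1 + real N) powr (\<beta> / 2) * (2 powr (- (3/4) * \<beta> * real j) * 2 powr (\<beta> / 2 * real j)) * w (\<lfloor>x\<rfloor> - l)"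
    by (simp only: mult_ac mult_1_right)
  also have "2 powr (- (3/4) * \<beta> * real j) * 2 powr (\<beta> / 2 * real j) = (2 powr (- (\<beta> / 4))) ^ j"
    by (simp add: powr_power mult_ac flip: powr_add)
  finally show ?thesis unfolding x_def .
qed

text \<open>Two majorants are needed. Within a level \<open>uu\<close> is uniform in
  \<open>t\<close>, but its mass grows with the number of cells met, about \<open>2 ^ j\<close>. For
  the sum over the levels the terms are therefore added at fixed \<open>t\<close> first, which gives
  \<open>A * q ^ j * S\<close>.\<close>

lemma expansion_uniform_limit:
  assumes good: "good \<omega>" and n: "filterlim n at_top sequentially" and k0: "filterlim k0 at_top sequentially"
    and k: "\<And>j. filterlim (\<lambda>i. k i j) at_top sequentially"
  shows "uniform_limit {- real N..real N} (\<lambda>i t. expansion (n i) (k0 i) (k i) t \<omega>) (\<lambda>t. lim_expansion t \<omega>) sequentially"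
proof -
  let ?I = "{- real N..real N}"
  have I: "\<bar>t\<bar> \<le> real N" if "t \<in> ?I" for t using that by auto
  obtain B where B: "0 \<le> B" "\<And>j l. cmod (coef \<psi> j l \<omega>) \<le> B * vv j l" using good unfolding good_def by blast
  have P: "uniform_limit ?I (\<lambda>i t. \<Sum>l\<in>{- int (k0 i)..int (k0 i)}. coef \<phi> 0 l \<omega> * dilate \<phi> (int 0) l t)
     (\<lambda>t. LINT l|IZ. coef \<phi> 0 l \<omega> * dilate \<phi> (int 0) l t) sequentially"
  proof (rule uniform_truncation[OF _ _ k0])
    show "integrable IZ (\<lambda>l. gw \<beta> (real N) * (cmod (coef \<phi> 0 l \<omega>) * (uu N l / gw \<beta> (of_int l))))"
      using good unfolding good_def by (intro integrable_mult_right) blast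
  qed (rule phi_term_bound[OF I])
  define A where "A = B * (1 + real N) powr (\<beta> / 2)"
  define q where "q = 2 powr (- (\<beta> / 4))"
  have A0: "0 \<le> A" unfolding A_def using B(1) by simp
  have "2 powr (- (\<beta> / 4)) < 2 powr 0" using \<beta> by (intro powr_less_mono) auto
  then have q: "0 \<le> q" "q < 1" by (simp_all add: q_def)
  define f where "f j l t = coef \<psi> j l \<omega> * dilate \<psi> (int j) l t" for j l t
  have fb: "norm (f j l t) \<le> A * q ^ j * w (\<lfloor>2 ^ j * t\<rfloor> - l)" if "t \<in> ?I" for j l t
    unfolding f_def A_def q_def by (rule psi_term_bound[OF B(1) B(2) I[OF that]])
  have fi: "integrable IZ (\<lambda>l. A * q ^ j * w (\<lfloor>2 ^ j * t\<rfloor> - l))" for j t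
    by (intro integrable_mult_right phi.integrable_IZ_\<omega>)
  have fs: "(LINT l|IZ. A * q ^ j * w (\<lfloor>2 ^ j * t\<rfloor> - l)) = A * q ^ j * S" for j t
    by (simp add: phi.integral_IZ_\<omega>)
  have w0: "0 \<le> A * q ^ j * w l" for j l using A0 q phi.\<omega>_nonneg by simp
  have L: "uniform_limit ?I (\<lambda>i t. \<Sum>l\<in>{- int (k i j)..int (k i j)}. f j l t) (\<lambda>t. LINT l|IZ. f j l t) sequentially" for j
  proof (rule uniform_truncation[OF _ _ k])
    show "integrable IZ (\<lambda>l. A * q ^ j * uu (2 ^ j * N) l)" by (intro integrable_mult_right uu_integrable)
    fix t l assume t: "t \<in> ?I"
    have "\<bar>2 ^ j * t\<bar> \<le> real (2 ^ j * N)" using I[OF t] by (simp add: abs_mult mult_left_mono)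
    from w_le_uu[OF this, of l] have "A * q ^ j * w (\<lfloor>2 ^ j * t\<rfloor> - l) \<le> A * q ^ j * uu (2 ^ j * N) l"
      using A0 q by (intro mult_left_mono) auto
    then show "norm (f j l t) \<le> A * q ^ j * uu (2 ^ j * N) l" using fb[OF t, of j l] by linarith
  qed
  have Q: "uniform_limit ?I (\<lambda>i t. \<Sum>j<n i. \<Sum>l\<in>{- int (k i j)..int (k i j)}. f j l t) (\<lambda>t. \<Sum>j. LINT l|IZ. f j l t) sequentially"
  proof (rule uniform_limit_tannery[where M = "\<lambda>j. A * q ^ j * S", OF _ _ _ L n])
    show "summable (\<lambda>j. A * q ^ j * S)" using q by (intro summable_mult2 summable_mult summable_geometric) simp
    fix j t assume t: "t \<in> ?I"
    show "norm (\<Sum>l\<in>{- int (k i j)..int (k i j)}. f j l t) \<le> A * q ^ j * S" for i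
    proof -
      have "norm (\<Sum>l\<in>{- int (k i j)..int (k i j)}. f j l t) \<le> (\<Sum>l\<in>{- int (k i j)..int (k i j)}. A * q ^ j * w (\<lfloor>2 ^ j * t\<rfloor> - l))"
        by (rule sum_norm_le) (rule fb[OF t])
      also have "\<dots> \<le> A * q ^ j * S" unfolding fs[symmetric, of j t] by (rule IZ_sum_le[OF fi w0]) simp
      finally show ?thesis .
    qed
    have "integrable IZ (\<lambda>l. f j l t)"
      by (rule Bochner_Integration.integrable_bound[OF fi[of j t]])
         (use fb[OF t] in \<open>auto intro!: AE_I2 intro: order_trans[OF _ abs_ge_self]\<close>)
    then show "norm (LINT l|IZ. f j l t) \<le> A * q ^ j * S"
      unfolding fs[symmetric, of j t] by (rule integral_norm_le[OF _ fi]) (rule fb[OF t])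
  qed
  show ?thesis
    unfolding expansion_alt lim_expansion_def by (rule uniform_limit_add[OF P Q[unfolded f_def]])
qed

text \<open>Along the diagonal sequence the expansions converge to \<open>W t\<close> in mean square
  and, for good paths, to \<open>lim_expansion t\<close>; Fatou's lemma equates the two
  limits.\<close>

lemma lim_expansion_eq:
  assumes quarter: "1/4 < \<beta>"
  shows "AE \<omega> in M. lim_expansion t \<omega> = of_real (W t \<omega>)"
proof -
  obtain K where K: "\<And>n. n \<le> K n" and
    lim: "(\<lambda>n. E2 M (\<lambda>\<omega>. expansion n (K n) (\<lambda>_. K n) t \<omega> - of_real (W t \<omega>))) \<longlonglongrightarrow> 0"
    by (rule expansion_L2_limit[where t = t]) blast
  have Kl: "filterlim K at_top sequentially"
    by (rule filterlim_at_top_mono[OF filterlim_ident]) (use K in auto)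
  define Z where "Z n \<omega> = expansion n (K n) (\<lambda>_. K n) t \<omega> - of_real (W t \<omega>)" for n \<omega>
  have s: "sq_int M (Z n)" for n
    unfolding Z_def by (rule sq_int_diff(1)[OF expansion_sq_int sq_int_of_real[OF W_sq_int]])
  have mZ: "Z n \<in> borel_measurable M" for n using s[of n] by auto
  obtain N where N: "\<bar>t\<bar> \<le> real N" using real_arch_simple by blast
  have conv: "AE \<omega> in M. (\<lambda>n. Z n \<omega>) \<longlonglongrightarrow> lim_expansion t \<omega> - of_real (W t \<omega>)"
    using good_AE[OF quarter]
  proof eventually_elim
    case (elim \<omega>)
    have "uniform_limit {- real N..real N} (\<lambda>n t. expansion n (K n) (\<lambda>_. K n) t \<omega>) (\<lambda>t. lim_expansion t \<omega>) sequentially"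
      by (rule expansion_uniform_limit[OF elim filterlim_ident Kl Kl])
    have "t \<in> {- real N..real N}" using N by auto
    from tendsto_uniform_limitI[OF \<open>uniform_limit _ _ _ _\<close> this]
    have "(\<lambda>n. expansion n (K n) (\<lambda>_. K n) t \<omega>) \<longlonglongrightarrow> lim_expansion t \<omega>" .
    then show ?case unfolding Z_def by (intro tendsto_diff tendsto_const)
  qed
  \<comment> \<open>\<open>Y\<close> is a version of the pointwise limit whose measurability comes
    directly from that of the \<open>Z n\<close>.\<close>
  define Y where "Y \<omega> = lim (\<lambda>n. Z n \<omega>)" for \<omega>
  have mY: "Y \<in> borel_measurable M" unfolding Y_def by (rule borel_measurable_lim_metric[OF mZ])
  have Yeq: "AE \<omega> in M. Y \<omega> = lim_expansion t \<omega> - of_real (W t \<omega>)"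
    using conv by eventually_elim (simp add: Y_def limI)
  have ZY: "AE \<omega> in M. (\<lambda>n. Z n \<omega>) \<longlonglongrightarrow> Y \<omega>" using conv Yeq by eventually_elim simp
  have F: "sq_int M Y" "E2 M Y \<le> 0"
    by (rule L2_Fatou[OF s mY ZY order_refl], use lim in \<open>simp add: Z_def[abs_def]\<close>)+
  have "E2 M Y = 0" using F(2) E2_nonneg[of M Y] by linarith
  then have "AE \<omega> in M. (cmod (Y \<omega>))\<^sup>2 = 0"
    unfolding E2_def by (subst (asm) integral_nonneg_eq_0_iff_AE) (use F(1) in auto)
  with Yeq show ?thesis by eventually_elim simp
qed

lemma expansion_continuous: "continuous_on UNIV (\<lambda>t. expansion n k0 k t \<omega>)"
  unfolding expansion_alt
  by (intro continuous_on_add continuous_on_sum continuous_on_mult continuous_on_const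
      phi.dilate_continuous psi.dilate_continuous)

text \<open>On the countable separating set, uniform convergence of the paths makes the exceptional
  events \<open>B i\<close> eventually fail almost surely, so their probabilities tend to 0.
  Separability of \<open>W\<close> and continuity of the expansions bound the supremum event by
  \<open>B i\<close> up to a null set.\<close>

lemma prob_sup_tendsto:
  assumes quarter: "1/4 < \<beta>" and sep: "separable_process M W"
    and n: "filterlim n at_top sequentially" and k0: "filterlim k0 at_top sequentially"
    and k: "\<And>j. filterlim (\<lambda>i. k i j) at_top sequentially" and \<epsilon>: "0 < \<epsilon>"
  shows "(\<lambda>i. prob_sup_dist_gt M W (expansion (n i) (k0 i) (k i)) T \<epsilon>) \<longlonglongrightarrow> 0"
proof -
  define X where "X i = expansion (n i) (k0 i) (k i)" for i
  obtain Q Nl where Q: "countable Q" "closure Q = UNIV" "Nl \<in> null_sets M"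
    and sepr: "\<forall>\<omega>\<in>space M - Nl. \<forall>G C. open G \<longrightarrow> closed C \<longrightarrow> (\<forall>s\<in>G \<inter> Q. W s \<omega> \<in> C) \<longrightarrow> (\<forall>t\<in>G. W t \<omega> \<in> C)"
    using sep unfolding separable_process_def by (elim exE conjE) (rule that)
  obtain L where L: "T + 1 \<le> real L" using real_arch_simple by blast
  \<comment> \<open>\<open>U\<close> is an open neighbourhood of \<open>[0, T]\<close>: points of
    the separating set near an endpoint may lie outside the interval.\<close>
  define U where "U = {-1 <..< real L + 1}"
  define N where "N = L + 1"
  have UN: "U \<subseteq> {- real N..real N}" unfolding U_def N_def by auto
  define D where "D i s \<omega> = cmod (of_real (W s \<omega>) - X i s \<omega>)" for i s \<omega>
  have mX: "X i s \<in> borel_measurable M" for i s unfolding X_def by (rule sq_intD(1)[OF expansion_sq_int])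
  have mD: "D i s \<in> borel_measurable M" for i s
    unfolding D_def using mX[of i s] W_measurable[of s] by measurable
  define B where "B i = {\<omega> \<in> space M. \<exists>s\<in>Q \<inter> U. \<epsilon> < D i s \<omega>}" for i
  have mB: "B i \<in> sets M" for i
  proof -
    have "B i = (\<Union>s\<in>Q \<inter> U. {\<omega> \<in> space M. \<epsilon> < D i s \<omega>})" unfolding B_def by auto
    moreover have "{\<omega> \<in> space M. \<epsilon> < D i s \<omega>} \<in> sets M" for s using mD[of i s] by measurable
    ultimately show ?thesis using Q(1) by (simp add: sets.countable_UN'')
  qed
  have eq: "AE \<omega> in M. \<forall>s\<in>Q. lim_expansion s \<omega> = of_real (W s \<omega>)"
    using lim_expansion_eq[OF quarter] by (simp add: AE_ball_countable[OF Q(1)])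
  have out: "AE \<omega> in M. \<forall>\<^sub>F i in sequentially. \<omega> \<notin> B i"
    using good_AE[OF quarter] eq
  proof eventually_elim
    case (elim \<omega>)
    have "uniform_limit {- real N..real N} (\<lambda>i t. X i t \<omega>) (\<lambda>t. lim_expansion t \<omega>) sequentially"
      unfolding X_def by (rule expansion_uniform_limit[OF elim(1) n k0 k])
    from uniform_limitD[OF this \<epsilon>] show ?case
    proof eventually_elim
      case (elim i)
      show "\<omega> \<notin> B i"
      proof
        assume "\<omega> \<in> B i"
        then obtain s where s: "s \<in> Q" "s \<in> U" "\<epsilon> < D i s \<omega>" unfolding B_def by auto
        have "dist (X i s \<omega>) (of_real (W s \<omega>)) < \<epsilon>"
        proof -
          have "s \<in> {- real N..real N}" using UN s(2) by (rule subsetD)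
          then have "dist (X i s \<omega>) (lim_expansion s \<omega>) < \<epsilon>" using elim by (rule bspec[rotated])
          moreover have "lim_expansion s \<omega> = of_real (W s \<omega>)"
            using \<open>\<forall>s\<in>Q. lim_expansion s \<omega> = of_real (W s \<omega>)\<close> s(1) by (rule bspec)
          ultimately show ?thesis by (simp only:)
        qed
        then show False using s(3) by (simp add: D_def dist_norm norm_minus_commute)
      qed
    qed
  qed
  have "(\<lambda>i. LINT \<omega>|M. indicator (B i) \<omega> :: real) \<longlonglongrightarrow> (LINT \<omega>|M. 0)"
  proof (rule integral_dominated_convergence[where w = "\<lambda>_. 1"])
    show "AE \<omega> in M. (\<lambda>i. indicator (B i) \<omega> :: real) \<longlonglongrightarrow> 0"
      using out
    proof eventually_elim
      case (elim \<omega>)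
      then have "\<forall>\<^sub>F i in sequentially. (indicator (B i) \<omega> :: real) = 0" by eventually_elim simp
      then show ?case by (rule tendsto_eventually)
    qed
  qed (use mB in \<open>auto simp: indicator_def\<close>)
  then have PB: "(\<lambda>i. measure M (B i)) \<longlonglongrightarrow> 0"
    using mB by simp
  have le: "prob_sup_dist_gt M W (X i) T \<epsilon> \<le> measure M (B i)" for i
  proof -
    let ?Bad = "{\<omega> \<in> space M. (SUP t\<in>{0..T}. ereal (cmod (of_real (W t \<omega>) - X i t \<omega>))) > ereal \<epsilon>}"
    have sub: "?Bad \<subseteq> B i \<union> Nl"
    proof
      fix \<omega> assume bad: "\<omega> \<in> ?Bad"
      then obtain t where t: "t \<in> {0..T}" "\<epsilon> < D i t \<omega>" by (auto simp: less_SUP_iff D_def)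
      show "\<omega> \<in> B i \<union> Nl"
      proof (rule ccontr)
        assume nin: "\<omega> \<notin> B i \<union> Nl"
        have small: "D i s \<omega> \<le> \<epsilon>" if "s \<in> Q" "s \<in> U" for s
        proof (rule ccontr)
          assume "\<not> D i s \<omega> \<le> \<epsilon>"
          then have "\<epsilon> < D i s \<omega>" by simp
          moreover have "\<omega> \<in> space M" using bad by simp
          ultimately have "\<omega> \<in> B i" unfolding B_def using that by blast
          then show False using nin by simp
        qed
        \<comment> \<open>\<open>d\<close> leaves room for the oscillation of the expansion near
          \<open>t\<close>: deviations of at most \<open>\<epsilon>\<close> at nearby points of
          \<open>Q\<close> place \<open>W\<close> there in the closed set \<open>C\<close>, and
          separability forces \<open>W t\<close> into \<open>C\<close> as well.\<close>
        define d where "d = (D i t \<omega> - \<epsilon>) / 2"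
        have d: "0 < d" "\<epsilon> + d < D i t \<omega>" using t(2) by (simp_all add: d_def field_simps)
        have tU: "t \<in> U" using t(1) L unfolding U_def by auto
        have "isCont (\<lambda>t. X i t \<omega>) t"
          using expansion_continuous unfolding X_def by (simp add: continuous_on_eq_continuous_at)
        then obtain r where r: "0 < r" "\<And>s. dist s t < r \<Longrightarrow> dist (X i s \<omega>) (X i t \<omega>) < d"
          using d(1) unfolding continuous_at_eps_delta by blast
        define G where "G = U \<inter> ball t r"
        define C where "C = {y :: real. cmod (of_real y - X i t \<omega>) \<le> \<epsilon> + d}"
        have oG: "open G" unfolding G_def U_def by (intro open_Int open_greaterThanLessThan open_ball)
        have cC: "closed C" unfolding C_def by (intro closed_Collect_le continuous_intros)
        have GC: "\<forall>s\<in>G \<inter> Q. W s \<omega> \<in> C"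
        proof
          fix s assume s: "s \<in> G \<inter> Q"
          have "cmod (of_real (W s \<omega>) - X i t \<omega>) \<le> D i s \<omega> + dist (X i s \<omega>) (X i t \<omega>)"
            unfolding D_def dist_norm
            using norm_triangle_ineq[of "of_real (W s \<omega>) - X i s \<omega>" "X i s \<omega> - X i t \<omega>"] by simp
          moreover have "D i s \<omega> \<le> \<epsilon>" using small s unfolding G_def by blast
          moreover have "dist (X i s \<omega>) (X i t \<omega>) < d" using r(2)[of s] s unfolding G_def by (simp add: dist_commute)
          ultimately show "W s \<omega> \<in> C" unfolding C_def by simp
        qed
        have tG: "t \<in> G" unfolding G_def using tU r(1) by simp
        have "\<omega> \<in> space M - Nl" using bad nin by simp
        from sepr[rule_format, OF this oG cC GC[rule_format] tG] have "W t \<omega> \<in> C" by simp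
        then have "D i t \<omega> \<le> \<epsilon> + d" by (simp add: C_def D_def)
        then show False using d(2) by simp
      qed
    qed
    have NM: "Nl \<in> sets M" "emeasure M Nl = 0" using Q(3) by (auto simp: null_sets_def)
    interpret cM: prob_space "completion M" by (rule prob_space_completion)
    have "measure (completion M) ?Bad \<le> measure (completion M) (B i \<union> Nl)"
      by (rule cM.finite_measure_mono[OF sub]) (use mB NM in auto)
    also have "\<dots> = measure M (B i \<union> Nl)" using mB NM by (intro measure_completion) auto
    also have "\<dots> = measure M (B i)" by (rule measure_Un_null_set[OF mB Q(3)])
    finally show ?thesis by (simp add: prob_sup_dist_gt_def)
  qed
  have nonneg: "0 \<le> prob_sup_dist_gt M W (X i) T \<epsilon>" for i by (simp add: prob_sup_dist_gt_def)
  have "(\<lambda>i. prob_sup_dist_gt M W (X i) T \<epsilon>) \<longlonglongrightarrow> 0"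
    by (rule tendsto_sandwich[OF _ _ tendsto_const PB]) (use le nonneg in \<open>auto intro!: eventuallyI\<close>)
  then show ?thesis by (simp only: X_def)
qed

end

theorem theorem6:
  fixes M :: "'a measure" and W :: "real \<Rightarrow> 'a \<Rightarrow> real"
    and \<phi> \<psi> :: "real \<Rightarrow> complex"
    and \<alpha> \<gamma> a0 x0 T \<epsilon> :: real
    and \<Phi> c A :: "real \<Rightarrow> real"
    and D :: "nat \<Rightarrow> real \<Rightarrow> complex"
    and n k0' :: "nat \<Rightarrow> nat" and k :: "nat \<Rightarrow> nat \<Rightarrow> nat"
  assumes "0 < \<gamma>" "\<gamma> < 1" "1 / (2 * (1 - \<gamma>)) < \<alpha>" "\<alpha> < 2"
    and "prob_space M"
    and "separable_process M W" "gaussian_process M W" "centered_process M W"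
    and "\<And>t. AE \<omega> in M. W (- t) \<omega> = W t \<omega>"
    and "\<And>t s. (LINT \<omega>|M. W t \<omega> * W s \<omega>) = W_cov \<alpha> t s"
    and "f_wavelet \<phi>" "m_wavelet \<phi> \<psi>" "continuous_on UNIV \<phi>" "continuous_on UNIV \<psi>"
    \<comment> \<open>(a)\<close>
    and "assumption_S \<gamma> \<Phi> \<phi> \<psi>"
    and "\<And>x. c (- x) = c x" "mono_on {0..} c" "0 < c 0"
    and "\<And>a. 0 < a \<Longrightarrow> 0 < A a" "0 < a0" "0 < x0"
    and "\<And>a x. a0 \<le> a \<Longrightarrow> x0 \<le> x \<Longrightarrow> c (a * x) \<le> c x * A a"
    and "integrable lborel (\<lambda>x. c x * \<Phi> \<bar>x\<bar>)"
    and "\<And>t. sqrt (W_cov \<alpha> t t) \<le> c t"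
    \<comment> \<open>(b)\<close>
    and "integrable lborel (\<lambda>u. ln (1 + \<bar>u\<bar>) powr \<alpha> * cmod (fourier \<psi> u))"
    and "integrable lborel (\<lambda>u. ln (1 + \<bar>u\<bar>) powr \<alpha> * cmod (fourier \<phi> u))"
    \<comment> \<open>(c)\<close>
    and "integrable lborel (\<lambda>u. \<bar>u\<bar> powr \<alpha> * cmod (\<psi> u))"
    and "integrable lborel (\<lambda>u. \<bar>u\<bar> powr \<alpha> * cmod (\<phi> u))"
    \<comment> \<open>(d), where \<open>D i\<close> is the \<open>i\<close>-th derivative of the Fourier transform of \<open>\<phi>\<close>\<close>
    and "D 0 = fourier \<phi>"
    and "\<And>i z. i < 2 \<Longrightarrow> (D i has_vector_derivative D (Suc i) z) (at z)"
    and "(D 0 \<longlongrightarrow> 0) at_top" "(D 0 \<longlongrightarrow> 0) at_bot"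
    and "(D 1 \<longlongrightarrow> 0) at_top" "(D 1 \<longlongrightarrow> 0) at_bot"
    and "integrable lborel (\<lambda>u. cmod (D 1 u))"
    and "\<And>i. i \<le> 2 \<Longrightarrow> integrable lborel (\<lambda>u. ln (1 + \<bar>u\<bar>) powr \<alpha> * cmod (D i u))"
    \<comment> \<open>the sequence of truncation parameters\<close>
    and "filterlim n at_top sequentially" "filterlim k0' at_top sequentially"
    and "\<And>j. filterlim (\<lambda>i. k i j) at_top sequentially"
    and "0 < T" "0 < \<epsilon>"
  shows "(\<lambda>i. prob_sup_dist_gt M W
            (wavelet_expansion M W \<phi> \<psi> (n i) (k0' i) (k i)) T \<epsilon>) \<longlonglongrightarrow> 0"
proof -
  define \<beta> where "\<beta> = \<alpha> / 2"
  define w where "w l = gw \<beta> (of_int (\<bar>l\<bar> + 1)) * \<Phi> (max 0 (of_int \<bar>l\<bar> - 2))" for l :: int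
  \<comment> \<open>This is where the lower bound on \<open>\<alpha>\<close> supplies the condition
    \<open>1/4 < \<beta>\<close> behind the moments of order 16.\<close>
  have "1 / 2 \<le> 1 / (2 * (1 - \<gamma>))" using assms(1,2) by (intro divide_left_mono) auto
  then have quarter: "1 / 4 < \<beta>" using assms(3) by (simp add: \<beta>_def)
  then have \<beta>: "0 < \<beta>" by simp
  have \<alpha>: "\<alpha> = 2 * \<beta>" by (simp add: \<beta>_def)
  have \<Phi>: "\<And>x. 0 \<le> x \<Longrightarrow> 0 \<le> \<Phi> x" "antimono_on {0..} \<Phi>"
    "AE x in lborel. cmod (\<phi> x) \<le> \<Phi> \<bar>x\<bar>" "AE x in lborel. cmod (\<psi> x) \<le> \<Phi> \<bar>x\<bar>"
    using assms(15) by (auto simp: assumption_S_def)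
  have cb: "\<bar>x\<bar> powr \<beta> \<le> c x" for x
  proof -
    have "sqrt (W_cov \<alpha> x x) = \<bar>x\<bar> powr \<beta>"
      by (simp add: W_cov_def \<beta>_def powr_powr flip: powr_half_sqrt)
    then show ?thesis using assms(24)[of x] by simp
  qed
  have wi: "integrable IZ (\<lambda>l. gw \<beta> (of_int (\<bar>l\<bar> + 1)) * \<Phi> (max 0 (of_int \<bar>l\<bar> - 2)))"
    by (rule cell_majorant[OF less_imp_le[OF \<beta>] \<Phi>(1,2) assms(18,16,17) cb assms(23)])
  note am = amalgam_of_majorant[OF less_imp_le[OF \<beta>] \<Phi>(1,2) wi assms(13) \<Phi>(3), folded w_def]
    amalgam_of_majorant[OF less_imp_le[OF \<beta>] \<Phi>(1,2) wi assms(14) \<Phi>(4), folded w_def]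
  have D0: "(fourier \<phi> has_vector_derivative D 1 z) (at z)" for z
    using assms(30)[of 0 z] by (simp add: assms(29))
  \<comment> \<open>The second derivative of the transform is used to see that the first one is
    continuous.\<close>
  have "(D 1 has_vector_derivative D (Suc 1) z) (at z)" for z by (rule assms(30)) simp
  then have D1: "continuous_on UNIV (D 1)"
    by (intro continuous_at_imp_continuous_on ballI has_vector_derivative_continuous)
  have fbm: "abs_fbm M W \<beta>"
    using assms(5,7,8,9,10) \<beta> unfolding \<alpha> by (intro abs_fbm.intro abs_fbm_axioms.intro)
  have pair: "wavelet_pair \<beta> w \<phi> \<psi> (D 1)"
    by (intro wavelet_pair.intro wavelet_pair_axioms.intro am assms(11,12) D0 D1 assms(35))
  interpret fbm_wavelet M W \<beta> w \<phi> \<psi> "D 1"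
    by (rule fbm_wavelet.intro[OF fbm pair])
  show ?thesis
    by (rule prob_sup_tendsto[OF quarter assms(6) assms(37,38,39) assms(41)])
qed


end
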